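(* Let $(R,|\cdot|)$ be a multimetric linear type normed Dedekind domain, with respect to $|\cdot|=\prod_{j=1}^m|\cdot|_j$, with fraction field $K$. Let $f\in R[t_1,\ldots,t_n]$ be an anisotropic quadratic form. Let $d\in R$ be an odd element which is coprime to $\operatorname{disc} f$. Suppose that $n$ is even and that the base change of $f$ to $R/(d)$ is hyperbolic, i.e. isomorphic to $\bigoplus_{i=1}^{n/2}\mathbb{H}$. (a) If $|\cdot|_j$ is Archimedean for at least one $j$, then for any $0<c<C_M(R,n)$ there are $v\in R^n$ and $k\in R$ such that $$f(v)=kd,\qquad 0<|k|\le c^{-2/n}|f| .$$ (b) If the norm is of $q$-type, there are $v\in R^n$ and $k\in R\setminus\{0\}$ such that $$f(v)=kd,\qquad \deg k\le\deg f+\frac{2(mn-1)}{n}-\frac{2c_M(R,n)}{n}.$$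
   Context: Norms. A normed Dedekind domain $(R,|\cdot|)$ is a Dedekind domain $R$ with fraction field $K$ together with an ideal norm: a monoid homomorphism $|\cdot|$ from the nonzero ideals of $R$ under multiplication to $[1,\infty)$ with $|I|=1\iff I=R$. It extends to nonzero fractional ideals; for $x\in K^\times$ put $|x|=|xR|$, and $|0|=0$. For a set $X$ containing $0$, $X^\bullet=X\setminus\{0\}$. Covolumes. An $R$-lattice in $K^n$ is a finitely generated $R$-submodule $\Lambda\subset K^n$ spanning $K^n$ over $K$. For a finite length $R$-module $M\cong\bigoplus_i R/\mathfrak{p}_i^{n_i}$ put $\chi(M)=\prod_i\mathfrak{p}_i^{n_i}$. For a lattice $\Lambda$ choose $\alpha\in R^\bullet$ with $\alpha\Lambda\subset R^n$ and put $\chi(\Lambda)=\alpha^{-n}\chi(R^n/\alpha\Lambda)$ (independent of $\alpha$), $\operatorname{Covol}\Lambda=|\chi(\Lambda)|$. Multimetric norms. The norm is multimetric if $|x|=\prod_{j=1}^m|x|_j$ for all $x\in K$, where each $|\cdot|_j:K\to\mathbb{R}^{\ge0}$ is multiplicative, vanishes only at $0$, and is almost metric (for some $A$, $|x+y|_j\le A\max(|x|_j,|y|_j)$ for all $x,y$). The least such $A$ is the Artin constant; throughout the norms are normalized so that each Artin constant is at most $2$, so each $|\cdot|_j$ satisfies the triangle inequality. $|\cdot|_j$ is non-Archimedean if its Artin constant is $1$ and Archimedean otherwise. Put $\mathcal{N}=|K^\times|$, $\mathcal{N}_j=|K^\times|_j$, with closures $\overline{\mathcal{N}},\overline{\mathcal{N}_j}$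 in $\mathbb{R}^{>0}$. The norm is of $q$-type if a $q>1$ is given with $\mathcal{N}_j\subset q^{\mathbb{Z}}$ for all $j$; then $\deg=\log_q|\cdot|$, $\deg_j=\log_q|\cdot|_j$. Multimetric (multinormed) linear type. For $n\in\mathbb{Z}^+$ call $C\in\overline{\mathcal{N}}$ admissible if: for all $M=(m_{ik})\in GL_n(K)$, all $R$-lattices $\Lambda\subset K^n$ and all $\epsilon_{ij}\in\overline{\mathcal{N}_j}$ ($1\le i\le n$, $1\le j\le m$) with $|\det M|\operatorname{Covol}\Lambda\le C\prod_{i,j}\epsilon_{ij}$, there is $x\in\Lambda^\bullet$ with $|\sum_{k}m_{ik}x_k|_j\le\epsilon_{ij}$ for all $i,j$. When the norm is of $q$-type, $C$ and the $\epsilon_{ij}$ instead range over $q^{\mathbb{Z}}$. $R$ is of multimetric linear type if for every $n$ an admissible $C$ exists; $C_M(R,n)$ is the supremum of admissible $C$, and in $q$-type $c_M(R,n)=\log_qC_M(R,n)$. Quadratic forms. For $f=\sum_{1\le i\le k\le n}a_{ik}t_it_k$ over $R$: $|f|_j=\sum_{i\le k}|a_{ik}|_j$ if $|\cdot|_j$ is Archimedean, $|f|_j=\max_{i\le k}|a_{ik}|_j$ otherwise; $|f|=\prod_j|f|_j$ and, in $q$-type, $\deg f=\log_q|f|$. $f$ is anisotropic if $f(v)\ne0$ for all nonzero $v\in R^n$. $\operatorname{disc} f$ is the determinant of the matrix $(\partial^2f/\partial t_i\partial t_k)$. An element $d\in R$ is odd if $(d)$ is coprime to $2R$. $\mathbb{H}$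 is the hyperbolic plane: the quadratic form $xy$ on a free module of rank $2$. *)

theory Defs
  imports "HOL-Analysis.Elementary_Topology" "HOL-Algebra.Ideal_Product" "HOL-Algebra.Ring_Divisibility"
    "HOL-Algebra.Subrings" "HOL-Algebra.QuotRing"
    "Jordan_Normal_Form.VS_Connect"
begin

text \<open>
  The fraction field \<open>K\<close> is a type \<open>'k :: field\<close> and the Dedekind domain \<open>R\<close> is a subset of it;
  up to isomorphism every domain together with its fraction field is of this form. \<open>ring_on R\<close> is
  \<open>R\<close> as a ring record, and \<open>A ^^^ n\<close> is the free module \<open>A\<^sup>n\<close>, whose elements are the extensional
  functions \<open>{..<n} \<rightarrow> A\<close>. All indices start at \<open>0\<close>.
\<close>

abbreviation ring_on :: "'k::field set \<Rightarrow> 'k ring"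
  where "ring_on R \<equiv> class_ring \<lparr>carrier := R\<rparr>"

abbreviation free_module :: "('a, 'b) ring_scheme \<Rightarrow> nat \<Rightarrow> ('a, nat \<Rightarrow> 'a) module" (infix \<open>^^^\<close> 75)
  where "A ^^^ n \<equiv> ring.func_space A {..<n}"


section \<open>Normed Dedekind domains\<close>

definition dedekind_domain_in :: "'k::field set \<Rightarrow> bool"
  where "dedekind_domain_in R \<longleftrightarrow>
    subring R (class_ring :: 'k ring) \<and>
    (\<forall>x. \<exists>a\<in>R. \<exists>b\<in>R. b \<noteq> 0 \<and> x = a / b) \<and>
    noetherian_domain (ring_on R) \<and>
    (\<forall>x. (\<exists>p :: 'k poly. lead_coeff p = 1 \<and> (\<forall>i. coeff p i \<in> R) \<and> poly p x = 0) \<longrightarrow> x \<in> R) \<and>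
    (\<forall>P. primeideal P (ring_on R) \<and> P \<noteq> {0} \<longrightarrow> maximalideal P (ring_on R))"

text \<open>Only the values of \<open>N\<close> at nonzero ideals of \<open>R\<close> matter.\<close>

definition ideal_norm :: "'k::field set \<Rightarrow> ('k set \<Rightarrow> real) \<Rightarrow> bool"
  where "ideal_norm R N \<longleftrightarrow>
    (\<forall>I. ideal I (ring_on R) \<and> I \<noteq> {0} \<longrightarrow> 1 \<le> N I \<and> (N I = 1 \<longleftrightarrow> I = R)) \<and>
    (\<forall>I J. ideal I (ring_on R) \<and> I \<noteq> {0} \<and> ideal J (ring_on R) \<and> J \<noteq> {0} \<longrightarrow>
       N (I \<cdot>\<^bsub>ring_on R\<^esub> J) = N I * N J)"

definition frac_norm :: "'k::field set \<Rightarrow> ('k set \<Rightarrow> real) \<Rightarrow> 'k set \<Rightarrow> real"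
  where "frac_norm R N I =
    (let a = SOME a. a \<in> R \<and> a \<noteq> 0 \<and> (*) a ` I \<subseteq> R
     in N ((*) a ` I) / N (PIdl\<^bsub>ring_on R\<^esub> a))"

definition elt_norm :: "'k::field set \<Rightarrow> ('k set \<Rightarrow> real) \<Rightarrow> 'k \<Rightarrow> real"
  where "elt_norm R N x = (if x = 0 then 0 else frac_norm R N ((\<lambda>r. x * r) ` R))"


section \<open>Covolumes of lattices\<close>

definition lattice_in :: "'k::field set \<Rightarrow> nat \<Rightarrow> (nat \<Rightarrow> 'k) set \<Rightarrow> bool"
  where "lattice_in R n L \<longleftrightarrow>
    (\<exists>S. finite S \<and> S \<subseteq> carrier (class_ring ^^^ n) \<and>
         L = LinearCombinations.module.span (ring_on R) (class_ring ^^^ n) S) \<and>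
    LinearCombinations.module.span class_ring (class_ring ^^^ n) L = carrier (class_ring ^^^ n)"

text \<open>A module record also carries the ring operations \<open>mult\<close> and \<open>one\<close>, which have no meaning for
  modules and are left undefined.\<close>

definition quot_module :: "('a, 'b, 'c) module_scheme \<Rightarrow> 'b set \<Rightarrow> ('a, 'b set) module"
  where "quot_module M L = \<lparr>carrier = a_rcosets\<^bsub>M\<^esub> L, monoid.mult = undefined, one = undefined,
    zero = L, add = (\<lambda>X Y. X <+>\<^bsub>M\<^esub> Y), smult = (\<lambda>a X. \<Union>x\<in>X. L +>\<^bsub>M\<^esub> (a \<odot>\<^bsub>M\<^esub> x))\<rparr>"

definition dsum_module :: "nat \<Rightarrow> (nat \<Rightarrow> ('a, 'b, 'c) module_scheme) \<Rightarrow> ('a, nat \<Rightarrow> 'b) module"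
  where "dsum_module l M = \<lparr>carrier = (\<Pi>\<^sub>E i\<in>{..<l}. carrier (M i)), monoid.mult = undefined, one = undefined,
    zero = (\<lambda>i\<in>{..<l}. \<zero>\<^bsub>M i\<^esub>), add = (\<lambda>x y. \<lambda>i\<in>{..<l}. x i \<oplus>\<^bsub>M i\<^esub> y i),
    smult = (\<lambda>a x. \<lambda>i\<in>{..<l}. a \<odot>\<^bsub>M i\<^esub> x i)\<rparr>"

definition self_module :: "('a, 'b) ring_scheme \<Rightarrow> ('a, 'a) module"
  where "self_module A = \<lparr>carrier = carrier A, monoid.mult = undefined, one = undefined,
    zero = \<zero>\<^bsub>A\<^esub>, add = add A, smult = monoid.mult A\<rparr>"

definition module_isos :: "('a, 'r) ring_scheme \<Rightarrow> ('a, 'b, 'c) module_scheme \<Rightarrow>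
    ('a, 'd, 'e) module_scheme \<Rightarrow> ('b \<Rightarrow> 'd) set"
  where "module_isos A M M' = {\<phi> \<in> module_hom A M M'. bij_betw \<phi> (carrier M) (carrier M')}"

text \<open>\<open>chi R M\<close> is the product of the \<open>\<pp>\<^sub>i\<^bsup>e\<^sub>i\<^esup>\<close> for \<open>M \<cong> \<Oplus>\<^sub>i R/\<pp>\<^sub>i\<^bsup>e\<^sub>i\<^esup>\<close>. The primes are nonzero, as \<open>R\<close> has
  infinite length unless it is a field.\<close>

definition chi :: "'k::field set \<Rightarrow> ('k, 'b, 'c) module_scheme \<Rightarrow> 'k set"
  where "chi R M = (THE J. \<exists>l P e.
    (\<forall>i<l. primeideal (P i) (ring_on R) \<and> P i \<noteq> {0} \<and> 0 < (e i :: nat)) \<and>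
    module_isos (ring_on R) M
      (dsum_module l (\<lambda>i. quot_module (self_module (ring_on R)) (P i [^]\<^bsub>ideals_set (ring_on R)\<^esub> e i)))
      \<noteq> {} \<and>
    J = (\<Otimes>\<^bsub>ideals_set (ring_on R)\<^esub>i\<in>{..<l}. P i [^]\<^bsub>ideals_set (ring_on R)\<^esub> e i))"

definition chi_lattice :: "'k::field set \<Rightarrow> nat \<Rightarrow> (nat \<Rightarrow> 'k) set \<Rightarrow> 'k set"
  where "chi_lattice R n L =
    (let \<alpha> = SOME \<alpha>. \<alpha> \<in> R \<and> \<alpha> \<noteq> 0 \<and> (\<lambda>x. \<alpha> \<odot>\<^bsub>class_ring ^^^ n\<^esub> x) ` L \<subseteq> carrier (ring_on R ^^^ n)
     in (\<lambda>y. inverse (\<alpha> ^ n) * y) `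
          chi R (quot_module (ring_on R ^^^ n) ((\<lambda>x. \<alpha> \<odot>\<^bsub>class_ring ^^^ n\<^esub> x) ` L)))"

definition Covol :: "'k::field set \<Rightarrow> ('k set \<Rightarrow> real) \<Rightarrow> nat \<Rightarrow> (nat \<Rightarrow> 'k) set \<Rightarrow> real"
  where "Covol R N n L = frac_norm R N (chi_lattice R n L)"


section \<open>Multimetric norms\<close>

definition almost_metric :: "('k::field \<Rightarrow> real) \<Rightarrow> real \<Rightarrow> bool"
  where "almost_metric v A \<longleftrightarrow> (\<forall>x y. v (x + y) \<le> A * max (v x) (v y))"

definition artin_constant :: "('k::field \<Rightarrow> real) \<Rightarrow> real"
  where "artin_constant v = (LEAST A. almost_metric v A)"

definition almost_metric_norm :: "('k::field \<Rightarrow> real) \<Rightarrow> bool"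
  where "almost_metric_norm v \<longleftrightarrow>
    (\<forall>x. 0 \<le> v x) \<and> (\<forall>x y. v (x * y) = v x * v y) \<and> (\<forall>x. v x = 0 \<longleftrightarrow> x = 0) \<and>
    (\<exists>A. almost_metric v A)"

definition archimedean :: "('k::field \<Rightarrow> real) \<Rightarrow> bool"
  where "archimedean v \<longleftrightarrow> artin_constant v \<noteq> 1"

definition value_group :: "('k::field \<Rightarrow> real) \<Rightarrow> real set"
  where "value_group v = v ` (- {0})"

definition q_powers :: "real \<Rightarrow> real set"
  where "q_powers q = range (\<lambda>z::int. q powi z)"

text \<open>Being of \<open>q\<close>-type is extra data: \<open>qt = Some q\<close> means that \<open>q\<close> is given, and \<open>qt = None\<close> that
  no such number is given.\<close>

definition multimetric :: "'k::field set \<Rightarrow> ('k set \<Rightarrow> real) \<Rightarrow> nat \<Rightarrow> (nat \<Rightarrow> 'k \<Rightarrow> real) \<Rightarrow> real option \<Rightarrow> bool"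
  where "multimetric R N m nrm qt \<longleftrightarrow>
    (\<forall>j<m. almost_metric_norm (nrm j) \<and> artin_constant (nrm j) \<le> 2) \<and>
    (\<forall>x. elt_norm R N x = (\<Prod>j<m. nrm j x)) \<and>
    (\<forall>q. qt = Some q \<longrightarrow> 1 < q \<and> (\<forall>j<m. value_group (nrm j) \<subseteq> q_powers q))"


section \<open>Multimetric linear type\<close>

definition value_range :: "real option \<Rightarrow> ('k::field \<Rightarrow> real) \<Rightarrow> real set"
  where "value_range qt v =
    (case qt of None \<Rightarrow> closure (value_group v) \<inter> {0<..} | Some q \<Rightarrow> q_powers q)"

definition admissible :: "'k::field set \<Rightarrow> ('k set \<Rightarrow> real) \<Rightarrow> nat \<Rightarrow> (nat \<Rightarrow> 'k \<Rightarrow> real) \<Rightarrow> real option \<Rightarrow>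
    nat \<Rightarrow> real \<Rightarrow> bool"
  where "admissible R N m nrm qt n C \<longleftrightarrow>
    C \<in> value_range qt (elt_norm R N) \<and>
    (\<forall>M L \<epsilon>.
       M \<in> carrier_mat n n \<and> invertible_mat M \<and> lattice_in R n L \<and>
       (\<forall>i<n. \<forall>j<m. \<epsilon> i j \<in> value_range qt (nrm j)) \<and>
       elt_norm R N (det M) * Covol R N n L \<le> C * (\<Prod>i<n. \<Prod>j<m. \<epsilon> i j) \<longrightarrow>
       (\<exists>x\<in>L. x \<noteq> \<zero>\<^bsub>class_ring ^^^ n\<^esub> \<and>
          (\<forall>i<n. \<forall>j<m. nrm j (\<Sum>k<n. M $$ (i, k) * x k) \<le> \<epsilon> i j)))"

definition multimetric_linear_type :: "'k::field set \<Rightarrow> ('k set \<Rightarrow> real) \<Rightarrow> nat \<Rightarrow> (nat \<Rightarrow> 'k \<Rightarrow> real) \<Rightarrow>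
    real option \<Rightarrow> bool"
  where "multimetric_linear_type R N m nrm qt \<longleftrightarrow> (\<forall>n>0. \<exists>C. admissible R N m nrm qt n C)"

text \<open>The real supremum is legitimate. If all \<open>nrm j\<close> are trivial and \<open>qt = None\<close>, then \<open>C = 1\<close> is
  the only candidate. Otherwise one can take all \<open>\<epsilon> i j = \<epsilon>\<^sub>j\<close> with \<open>t = (\<Prod>j<m. \<epsilon>\<^sub>j) < 1\<close>; a nonzero
  element of \<open>R\<close> has norm at least \<open>1\<close>, so the identity matrix and the lattice \<open>R\<^sup>n\<close> show that every
  admissible \<open>C\<close> is smaller than \<open>t\<^sup>-\<^sup>n\<close>.\<close>

definition C_M :: "'k::field set \<Rightarrow> ('k set \<Rightarrow> real) \<Rightarrow> nat \<Rightarrow> (nat \<Rightarrow> 'k \<Rightarrow> real) \<Rightarrow> real option \<Rightarrow> nat \<Rightarrow> real"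
  where "C_M R N m nrm qt n = Sup {C. admissible R N m nrm qt n C}"

definition c_M :: "'k::field set \<Rightarrow> ('k set \<Rightarrow> real) \<Rightarrow> nat \<Rightarrow> (nat \<Rightarrow> 'k \<Rightarrow> real) \<Rightarrow> real \<Rightarrow> nat \<Rightarrow> real"
  where "c_M R N m nrm q n = log q (C_M R N m nrm (Some q) n)"


section \<open>Quadratic forms\<close>

text \<open>The form \<open>\<Sum>i\<le>k. a\<^sub>i\<^sub>k t\<^sub>i t\<^sub>k\<close> in \<open>n\<close> variables over \<open>A\<close> is given by its coefficients \<open>a i k\<close> with
  \<open>i \<le> k < n\<close>; all other values of \<open>a\<close> are ignored.\<close>

definition qf_over :: "('a, 'b) ring_scheme \<Rightarrow> nat \<Rightarrow> (nat \<Rightarrow> nat \<Rightarrow> 'a) \<Rightarrow> bool"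
  where "qf_over A n a \<longleftrightarrow> (\<forall>i k. i \<le> k \<and> k < n \<longrightarrow> a i k \<in> carrier A)"

definition qf_eval :: "('a, 'b) ring_scheme \<Rightarrow> nat \<Rightarrow> (nat \<Rightarrow> nat \<Rightarrow> 'a) \<Rightarrow> (nat \<Rightarrow> 'a) \<Rightarrow> 'a"
  where "qf_eval A n a v = (\<Oplus>\<^bsub>A\<^esub>i\<in>{..<n}. \<Oplus>\<^bsub>A\<^esub>k\<in>{i..<n}. a i k \<otimes>\<^bsub>A\<^esub> v i \<otimes>\<^bsub>A\<^esub> v k)"

definition qf_anisotropic :: "('a, 'b) ring_scheme \<Rightarrow> nat \<Rightarrow> (nat \<Rightarrow> nat \<Rightarrow> 'a) \<Rightarrow> bool"
  where "qf_anisotropic A n a \<longleftrightarrow>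
    (\<forall>v \<in> carrier (A ^^^ n). v \<noteq> \<zero>\<^bsub>A ^^^ n\<^esub> \<longrightarrow> qf_eval A n a v \<noteq> \<zero>\<^bsub>A\<^esub>)"

definition qf_isomorphic :: "('a, 'b) ring_scheme \<Rightarrow> nat \<Rightarrow> (nat \<Rightarrow> nat \<Rightarrow> 'a) \<Rightarrow> (nat \<Rightarrow> nat \<Rightarrow> 'a) \<Rightarrow> bool"
  where "qf_isomorphic A n a b \<longleftrightarrow>
    (\<exists>\<phi> \<in> module_isos A (A ^^^ n) (A ^^^ n).
       \<forall>v \<in> carrier (A ^^^ n). qf_eval A n b (\<phi> v) = qf_eval A n a v)"

text \<open>The orthogonal sum of hyperbolic planes, \<open>t\<^sub>0t\<^sub>1 + t\<^sub>2t\<^sub>3 + \<dots>\<close>; used for even rank only.\<close>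

definition hyperbolic_form :: "('a, 'b) ring_scheme \<Rightarrow> nat \<Rightarrow> nat \<Rightarrow> 'a"
  where "hyperbolic_form A i k = (if even i \<and> k = Suc i then \<one>\<^bsub>A\<^esub> else \<zero>\<^bsub>A\<^esub>)"

definition qf_hyperbolic :: "('a, 'b) ring_scheme \<Rightarrow> nat \<Rightarrow> (nat \<Rightarrow> nat \<Rightarrow> 'a) \<Rightarrow> bool"
  where "qf_hyperbolic A n a \<longleftrightarrow> even n \<and> qf_isomorphic A n a (hyperbolic_form A)"

definition qf_mod :: "('a, 'b) ring_scheme \<Rightarrow> 'a set \<Rightarrow> (nat \<Rightarrow> nat \<Rightarrow> 'a) \<Rightarrow> nat \<Rightarrow> nat \<Rightarrow> 'a set"
  where "qf_mod A I a = (\<lambda>i k. I +>\<^bsub>A\<^esub> a i k)"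

text \<open>The matrix of second partial derivatives: for \<open>i < k\<close> the variables \<open>t\<^sub>i\<close>, \<open>t\<^sub>k\<close> occur together
  only in \<open>a\<^sub>i\<^sub>k t\<^sub>i t\<^sub>k\<close>, while \<open>a\<^sub>i\<^sub>i t\<^sub>i\<^sup>2\<close> has second derivative \<open>2 a\<^sub>i\<^sub>i\<close>.\<close>

definition qf_disc :: "nat \<Rightarrow> (nat \<Rightarrow> nat \<Rightarrow> 'k::field) \<Rightarrow> 'k"
  where "qf_disc n a = det (mat n n (\<lambda>(i, k). if i = k then 2 * a i i else a (min i k) (max i k)))"

definition qf_norm_at :: "nat \<Rightarrow> (nat \<Rightarrow> nat \<Rightarrow> 'k::field) \<Rightarrow> ('k \<Rightarrow> real) \<Rightarrow> real"
  where "qf_norm_at n a v =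
    (if archimedean v then \<Sum>i<n. \<Sum>k=i..<n. v (a i k)
     else Max {v (a i k) | i k. i \<le> k \<and> k < n})"

definition qf_norm :: "nat \<Rightarrow> (nat \<Rightarrow> nat \<Rightarrow> 'k::field) \<Rightarrow> nat \<Rightarrow> (nat \<Rightarrow> 'k \<Rightarrow> real) \<Rightarrow> real"
  where "qf_norm n a m nrm = (\<Prod>j<m. qf_norm_at n a (nrm j))"

definition coprime_elts :: "('a, 'b) ring_scheme \<Rightarrow> 'a \<Rightarrow> 'a \<Rightarrow> bool"
  where "coprime_elts A x y \<longleftrightarrow> (PIdl\<^bsub>A\<^esub> x) <+>\<^bsub>A\<^esub> (PIdl\<^bsub>A\<^esub> y) = carrier A"

end

theory Submission
  imports Defs "HOL-Analysis.Elementary_Metric_Spaces"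
begin

text \<open>Put \<open>r = n/2\<close>. As \<open>f\<close> is hyperbolic modulo \<open>d\<close>, the odd coordinates of an isometry with
\<open>t\<^sub>0t\<^sub>1 + t\<^sub>2t\<^sub>3 + \<dots>\<close> are \<open>r\<close> linear conditions modulo \<open>d\<close> whose solutions form a lattice \<open>\<Lambda> \<subseteq> R\<^sup>n\<close>
with \<open>R\<^sup>n/\<Lambda> \<cong> (R/(d))\<^sup>r\<close>, and \<open>f\<close> takes values in \<open>(d)\<close> on \<open>\<Lambda>\<close>. If \<open>C\<close> is admissible and
\<open>|d|\<^sup>r \<le> C (\<Prod>\<^sub>j \<epsilon>\<^sub>j)\<^sup>n\<close>, then linear type yields a nonzero \<open>v \<in> \<Lambda>\<close> with \<open>|v\<^sub>i|\<^sub>j \<le> \<epsilon>\<^sub>j\<close> for all \<open>i\<close> and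
\<open>j\<close>. Each \<open>|\<cdot>|\<^sub>j\<close> satisfies the triangle inequality, so \<open>|f(v)|\<^sub>j \<le> |f|\<^sub>j \<epsilon>\<^sub>j\<^sup>2\<close>. Now \<open>f(v) = kd\<close>, and
\<open>k \<noteq> 0\<close> because \<open>f\<close> is anisotropic; therefore \<open>|k||d| \<le> |f| (\<Prod>\<^sub>j \<epsilon>\<^sub>j)\<^sup>2\<close> (\<open>small_multiple\<close>). In part (a)
the values of an Archimedean \<open>|\<cdot>|\<^sub>j\<close> are dense (\<open>archimedean_value_group_dense\<close>), so \<open>\<Prod>\<^sub>j \<epsilon>\<^sub>j\<close> can be
any positive number. In part (b) the supremum \<open>C\<^sub>M\<close> is itself admissible (\<open>C_M_admissible\<close>), and
rounding the exponent of \<open>\<Prod>\<^sub>j \<epsilon>\<^sub>j\<close> up to an integer costs at most \<open>(n - 1)/n\<close>.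

In place of \<open>\<Lambda>\<close> the proof uses a free lattice inside it. There is a matrix \<open>P\<close> over \<open>R\<close> with determinant \<open>d\<^sup>r\<close> that maps
\<open>R\<^sup>n\<close> into \<open>\<Lambda>\<close> (\<open>kernel_matrix_mod\<close>), and admissibility is applied to the matrix \<open>P\<close> and the lattice
\<open>R\<^sup>n\<close>. Consequently the only covolume that has to be computed is that of \<open>R\<^sup>n\<close> (\<open>Covol_free_module\<close>).
The matrix \<open>P\<close> is found by integral column operations: since only finitely many primes contain \<open>d\<close>,
a unimodular row modulo \<open>d\<close> acquires a unit entry when a multiple of one combination of its entries
is added to another entry (\<open>stable_range\<close>).

The covolume of \<open>R\<^sup>n\<close> is defined through a decomposition of \<open>R\<^sup>n/\<alpha>R\<^sup>n\<close> into modules \<open>R/\<pp>\<^sup>e\<close>. A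
decomposition exists by the factorization of ideals into primes (\<open>prime_factorization\<close>) and the
Chinese remainder theorem. That all decompositions give the same product of ideals is shown with
determinants (\<open>ideal_product_invariant\<close>): the product \<open>I\<^sub>1\<cdots>I\<^sub>n\<close> is the ideal generated by the
determinants of the matrices with columns in \<open>I\<^sub>1 \<oplus> \<dots> \<oplus> I\<^sub>n\<close>, and two decompositions of the same
module, each padded with copies of \<open>R\<close>, are related by a matrix of determinant one.\<close>

section \<open>Absolute values and the Artin constant\<close>

text \<open>Polynomial factors in an estimate disappear on passing to high powers, as \<open>(1 + e)\<^sup>2\<^sup>n\<close> exceeds
\<open>n\<^sup>2e\<^sup>2\<close> by Bernoulli's inequality.\<close>

lemma le_one_if_powers_linear_bound:
  fixes t :: real
  assumes "\<And>n. t ^ n \<le> 4 * (real n + 1)"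
  shows "t \<le> 1"
proof (rule ccontr)
  assume "\<not> t \<le> 1"
  define e where "e = t - 1"
  have e: "e > 0" "t = 1 + e" using \<open>\<not> t \<le> 1\<close> unfolding e_def by auto
  obtain n where n: "12 < real n * e\<^sup>2" using ex_less_of_nat_mult[of "e\<^sup>2" 12] e(1) by auto
  then have "1 \<le> real n" by (cases n) auto
  have "real n * e \<le> (1 + e) ^ n" using Bernoulli_inequality[of e n] e(1) by simp
  then have "(real n * e)\<^sup>2 \<le> ((1 + e) ^ n)\<^sup>2" using e(1) by (intro power_mono) auto
  also have "\<dots> = t ^ (2 * n)" unfolding e(2) by (simp add: power_mult mult.commute)
  also have "\<dots> \<le> 4 * (real (2 * n) + 1)" by (rule assms)
  also have "\<dots> \<le> 12 * real n" using \<open>1 \<le> real n\<close> by simp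
  finally have "real n * (real n * e\<^sup>2) \<le> real n * 12" by (simp add: power2_eq_square mult_ac)
  then show False using n \<open>1 \<le> real n\<close> by simp
qed

locale absolute_value =
  fixes v :: "'k::field \<Rightarrow> real"
  assumes almost_metric_norm: "almost_metric_norm v" and artin_constant_le_2: "artin_constant v \<le> 2"
begin

lemma nonneg [simp]: "0 \<le> v x" and mult: "v (x * y) = v x * v y" and eq_0_iff [simp]: "v x = 0 \<longleftrightarrow> x = 0"
  using almost_metric_norm unfolding almost_metric_norm_def by auto

lemma zero [simp]: "v 0 = 0" by simp

lemma pos: "x \<noteq> 0 \<Longrightarrow> 0 < v x"
  using nonneg[of x] eq_0_iff[of x] by linarith

lemma one [simp]: "v 1 = 1"
  using mult[of 1 1] eq_0_iff[of 1] by simp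

lemma power: "v (x ^ n) = v x ^ n"
  by (induct n) (simp_all add: mult)

lemma inverse: "v (inverse x) = inverse (v x)"
proof (cases "x = 0")
  case False
  then have "v x * v (inverse x) = 1" using mult[of x "inverse x"] by simp
  then show ?thesis by (metis inverse_unique)
qed simp

lemma divide: "v (x / y) = v x / v y"
  by (simp add: divide_inverse mult inverse)

lemma power_int: "v (x powi z) = v x powi z"
  by (simp add: power_int_def power inverse)

lemma minus [simp]: "v (- x) = v x"
proof -
  have "v (-1) ^ 2 = 1" using power[of "-1" 2] by simp
  then have "v (-1) = 1" using nonneg[of "-1"] by (simp add: power2_eq_1_iff)
  then show ?thesis using mult[of "-1" x] by simp
qed

lemma almost_metric_ge_1: "almost_metric v A \<Longrightarrow> 1 \<le> A"
  unfolding almost_metric_def by (metis add.right_neutral max.absorb1 mult.right_neutral one zero zero_le_one)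

text \<open>Each inequality in the definition of \<open>almost_metric\<close> is a closed condition on the constant, so the
infimum of all constants is itself one, and the \<open>LEAST\<close> in the Artin constant exists.\<close>

lemma almost_metric_artin_constant: "almost_metric v (artin_constant v)"
proof -
  define S where "S = {A. almost_metric v A}"
  have ne: "S \<noteq> {}" using almost_metric_norm unfolding S_def almost_metric_norm_def by auto
  have S1: "1 \<le> A" if "A \<in> S" for A using that almost_metric_ge_1 unfolding S_def by simp
  then have bdd: "bdd_below S" by (rule bdd_belowI)
  have "almost_metric v (Inf S)"
    unfolding almost_metric_def
  proof (intro allI)
    fix x y
    show "v (x + y) \<le> Inf S * max (v x) (v y)"
    proof (cases "max (v x) (v y) = 0")
      case True
      then have "v x = 0" "v y = 0" using nonneg[of x] nonneg[of y] by linarith+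
      then show ?thesis by simp
    next
      case False
      then have m: "0 < max (v x) (v y)" using nonneg[of x] by (metis less_eq_real_def max.coboundedI1)
      have "v (x + y) / max (v x) (v y) \<le> Inf S"
      proof (rule cInf_greatest[OF ne])
        fix A assume "A \<in> S"
        then have "v (x + y) \<le> A * max (v x) (v y)" unfolding S_def almost_metric_def by auto
        then show "v (x + y) / max (v x) (v y) \<le> A" using m by (simp add: pos_divide_le_eq)
      qed
      then show ?thesis using m by (simp add: pos_divide_le_eq)
    qed
  qed
  moreover have "artin_constant v = Inf S"
    unfolding artin_constant_def using calculation
    by (rule Least_equality) (rule cInf_lower[OF _ bdd], simp add: S_def)
  ultimately show ?thesis by simp
qed

lemma almost_metric_2: "v (x + y) \<le> 2 * max (v x) (v y)"
proof -
  have "v (x + y) \<le> artin_constant v * max (v x) (v y)"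
    using almost_metric_artin_constant unfolding almost_metric_def by simp
  also have "\<dots> \<le> 2 * max (v x) (v y)"
    using artin_constant_le_2 nonneg[of x] by (intro mult_right_mono) (auto simp: max_def)
  finally show ?thesis .
qed

text \<open>Halving the sum \<open>k\<close> times loses a factor \<open>2\<close> each time, in total just the number of terms. Adding
the terms one at a time would lose a factor exponential in their number.\<close>

lemma sum_pow2_le:
  fixes f :: "nat \<Rightarrow> 'k"
  assumes "\<And>i. i < 2 ^ k \<Longrightarrow> v (f i) \<le> M"
  shows "v (\<Sum>i<2 ^ k. f i) \<le> 2 ^ k * M"
  using assms
proof (induct k arbitrary: f)
  case 0 then show ?case by (simp add: lessThan_Suc)
next
  case (Suc k)
  have "(\<Sum>i<2 ^ Suc k. f i) = (\<Sum>i<2 ^ k. f i) + (\<Sum>i<2 ^ k. f (2 ^ k + i))"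
    using sum.atLeastLessThan_concat[of 0 "2 ^ k" "2 ^ Suc k" f] sum.shift_bounds_nat_ivl[of f 0 "2 ^ k" "2 ^ k"]
    by (simp add: atLeast0LessThan mult_2 add.commute)
  moreover have "v (\<Sum>i<2 ^ k. f i) \<le> 2 ^ k * M" "v (\<Sum>i<2 ^ k. f (2 ^ k + i)) \<le> 2 ^ k * M"
    using Suc(2) by (auto intro!: Suc(1))
  ultimately show ?case using almost_metric_2[of "\<Sum>i<2 ^ k. f i" "\<Sum>i<2 ^ k. f (2 ^ k + i)"] by simp
qed

lemma sum_le:
  fixes f :: "nat \<Rightarrow> 'k"
  assumes "\<And>i. i < n \<Longrightarrow> v (f i) \<le> M" "0 \<le> M"
  shows "v (\<Sum>i<n. f i) \<le> 2 * real n * M"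
proof (cases "n = 0")
  case False
  obtain k where k: "n \<le> 2 ^ k" "2 ^ k < 2 * n"
  proof -
    define k where "k = (LEAST k. n \<le> 2 ^ k)"
    have le: "n \<le> 2 ^ k" unfolding k_def by (rule LeastI[of _ n]) (simp add: less_imp_le)
    have "2 ^ k < 2 * n"
    proof (cases k)
      case 0 then show ?thesis using False by simp
    next
      case (Suc k')
      then have "\<not> n \<le> 2 ^ k'" unfolding k_def by (intro not_less_Least) simp
      then show ?thesis using Suc by simp
    qed
    with le show thesis by (rule that)
  qed
  have "(\<Sum>i<n. f i) = (\<Sum>i<2 ^ k. if i < n then f i else 0)"
    using k(1) by (intro sum.mono_neutral_cong_left) auto
  also have "v \<dots> \<le> 2 ^ k * M" using assms by (intro sum_pow2_le) auto
  also have "\<dots> \<le> 2 * real n * M"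
  proof (rule mult_right_mono[OF _ assms(2)])
    have "real (2 ^ k) \<le> real (2 * n)" using k(2) by (intro of_nat_mono) simp
    then show "2 ^ k \<le> 2 * real n" by simp
  qed
  finally show ?thesis .
qed simp

lemma of_nat_le: "v (of_nat n) \<le> 2 * real n"
  using sum_le[of n "\<lambda>_. 1" 1] by simp

lemma add_power_le:
  assumes M: "\<And>i. i \<le> n \<Longrightarrow> v (of_nat (n choose i)) * v x ^ i * v y ^ (n - i) \<le> M" "0 \<le> M"
  shows "v (x + y) ^ n \<le> 2 * (real n + 1) * M"
proof -
  have "v (x + y) ^ n = v (\<Sum>i<Suc n. of_nat (n choose i) * x ^ i * y ^ (n - i))"
    unfolding power[symmetric] binomial_ring by (simp add: lessThan_Suc_atMost)
  also have "\<dots> \<le> 2 * real (Suc n) * M"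
    using M by (intro sum_le) (auto simp: mult power)
  finally show ?thesis by (simp add: algebra_simps)
qed

text \<open>Artin's argument: in the binomial expansion of \<open>(x + y)\<^sup>n\<close> the number of terms costs a factor linear
in \<open>n\<close>, and replacing \<open>v\<close> of a binomial coefficient by the coefficient itself costs a factor \<open>2\<close>. What
remains is at most \<open>(v x + v y)\<^sup>n\<close>, and the factors vanish on taking \<open>n\<close>-th roots.\<close>

lemma triangle: "v (x + y) \<le> v x + v y"
proof (cases "v x + v y = 0")
  case True
  then have "v x = 0" "v y = 0" using nonneg[of x] nonneg[of y] by linarith+
  then show ?thesis by simp
next
  case False
  define s where "s = v x + v y"
  have s: "0 < s" unfolding s_def using False nonneg[of x] nonneg[of y] by linarith
  have "v (x + y) / s \<le> 1"
  proof (rule le_one_if_powers_linear_bound)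
    fix n
    have "v (x + y) ^ n \<le> 2 * (real n + 1) * (2 * s ^ n)"
    proof (rule add_power_le)
      fix i assume i: "i \<le> n"
      have "v (of_nat (n choose i)) * (v x ^ i * v y ^ (n - i)) \<le> 2 * real (n choose i) * (v x ^ i * v y ^ (n - i))"
        by (intro mult_right_mono of_nat_le) simp
      moreover have "real (n choose i) * v x ^ i * v y ^ (n - i) \<le> s ^ n"
        unfolding s_def binomial_ring using i by (intro member_le_sum) auto
      ultimately show "v (of_nat (n choose i)) * v x ^ i * v y ^ (n - i) \<le> 2 * s ^ n" by (simp add: mult.assoc)
    qed (use s in simp)
    then show "(v (x + y) / s) ^ n \<le> 4 * (real n + 1)"
      using s by (simp add: power_divide divide_le_eq algebra_simps)
  qed
  then show ?thesis using s unfolding s_def by (simp add: divide_le_eq)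
qed

lemma triangle_sum: "v (sum f S) \<le> (\<Sum>i\<in>S. v (f i))"
proof (induct S rule: infinite_finite_induct)
  case (insert i S)
  then show ?case using triangle[of "f i" "sum f S"] by simp
qed simp_all

lemma ultrametric: "\<not> archimedean v \<Longrightarrow> v (x + y) \<le> max (v x) (v y)"
  using almost_metric_artin_constant unfolding archimedean_def almost_metric_def by simp

lemma ultrametric_sum:
  assumes "\<not> archimedean v" "\<And>i. i \<in> S \<Longrightarrow> v (f i) \<le> M" "0 \<le> M"
  shows "v (sum f S) \<le> M"
  using assms(2)
proof (induct S rule: infinite_finite_induct)
  case (insert i S)
  then show ?case using ultrametric[OF assms(1), of "f i" "sum f S"] by fastforce
qed (use assms(3) in simp_all)

text \<open>If \<open>v\<close> is at most \<open>1\<close> on all natural numbers, then it is so on the binomial coefficients, and the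
argument for the triangle inequality gives the ultrametric inequality.\<close>

lemma archimedean_of_nat:
  assumes "archimedean v"
  obtains n where "1 < v (of_nat n)"
proof (rule ccontr)
  assume "\<not> thesis"
  with that have le1: "v (of_nat n) \<le> 1" for n using not_le_imp_less by blast
  have "almost_metric v 1"
    unfolding almost_metric_def
  proof (intro allI)
    fix x y
    define s where "s = max (v x) (v y)"
    have xs: "v x \<le> s" "v y \<le> s" "0 \<le> s" unfolding s_def using nonneg[of x] by (auto simp: max_def)
    show "v (x + y) \<le> 1 * max (v x) (v y)"
    proof (cases "s = 0")
      case True
      then have "v x = 0" "v y = 0" using xs nonneg[of x] nonneg[of y] by linarith+
      then show ?thesis by simp
    next
      case False
      then have s: "0 < s" using xs by simp
      have "v (x + y) / s \<le> 1"
      proof (rule le_one_if_powers_linear_bound)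
        fix n
        have "v (x + y) ^ n \<le> 2 * (real n + 1) * s ^ n"
        proof (rule add_power_le)
          fix i assume i: "i \<le> n"
          have "v (of_nat (n choose i)) * (v x ^ i * v y ^ (n - i)) \<le> 1 * (s ^ i * s ^ (n - i))"
            using xs by (intro mult_mono power_mono le1) auto
          also have "\<dots> = s ^ n" using i by (simp add: power_add[symmetric])
          finally show "v (of_nat (n choose i)) * v x ^ i * v y ^ (n - i) \<le> s ^ n" by (simp add: mult.assoc)
        qed (use s in simp)
        also have "\<dots> \<le> 4 * (real n + 1) * s ^ n" using s by (intro mult_right_mono) auto
        finally show "(v (x + y) / s) ^ n \<le> 4 * (real n + 1)"
          using s by (simp add: power_divide divide_le_eq)
      qed
      then show ?thesis using s unfolding s_def by (simp add: divide_le_eq)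
    qed
  qed
  then have "artin_constant v = 1"
    unfolding artin_constant_def by (rule Least_equality) (rule almost_metric_ge_1)
  then show False using assms unfolding archimedean_def by simp
qed

text \<open>Otherwise \<open>1\<close> would be an isolated value. If \<open>j\<close> is a natural number of large value, then \<open>v ((j + 1) / j)\<close>
differs from \<open>1\<close> by at most \<open>1 / v j\<close>, hence equals \<open>1\<close>. So \<open>v\<close> would be constant on the natural numbers
from some \<open>K\<close> on, where \<open>K\<close> is a high power of a number of value above \<open>1\<close>; but \<open>K\<close> and \<open>K\<^sup>2\<close> have
different values.\<close>

lemma archimedean_near_1:
  assumes "archimedean v" "0 < \<delta>"
  obtains y where "1 < v y" "v y < 1 + \<delta>"
proof -
  \<comment> \<open>Chosen so that \<open>1 - \<epsilon> < v y < 1\<close> implies \<open>v (1/y) < 1 + \<delta>\<close>.\<close>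
  define \<epsilon> where "\<epsilon> = \<delta> / (1 + \<delta>)"
  have \<epsilon>: "0 < \<epsilon>" "\<epsilon> \<le> \<delta>" "1 - \<epsilon> = 1 / (1 + \<delta>)"
    unfolding \<epsilon>_def using assms(2) by (auto simp: field_simps)
  have "\<exists>y. v y \<noteq> 1 \<and> \<bar>v y - 1\<bar> < \<epsilon>"
  proof (rule ccontr)
    assume "\<not> ?thesis"
    then have iso: "v y = 1" if "\<bar>v y - 1\<bar> < \<epsilon>" for y using that by blast
    obtain m where m: "1 < v (of_nat m)" using archimedean_of_nat[OF assms(1)] .
    obtain k where k: "1 + 1 / \<epsilon> < v (of_nat m) ^ k" using real_arch_pow[OF m] by blast
    define K where "K = m ^ k"
    have vK: "1 < v (of_nat K)" "1 / \<epsilon> < v (of_nat K)"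
      using k \<epsilon>(1) unfolding K_def by (simp_all add: power) (smt (verit) divide_pos_pos)+
    have step: "v (of_nat (Suc j)) = v (of_nat j)" if j: "1 / \<epsilon> < v (of_nat j)" for j
    proof -
      have p: "0 < v (of_nat j)" using j \<epsilon>(1) by (smt (verit) divide_pos_pos)
      have "v (of_nat (Suc j)) \<le> v (of_nat j) + 1" "v (of_nat j) \<le> v (of_nat (Suc j)) + 1"
        using triangle[of "of_nat j" 1] triangle[of "of_nat (Suc j)" "-1"] by (simp_all add: add.commute)
      then have "\<bar>v (of_nat (Suc j)) - v (of_nat j)\<bar> \<le> 1" by linarith
      have "v (of_nat (Suc j) / of_nat j) - 1 = (v (of_nat (Suc j)) - v (of_nat j)) / v (of_nat j)"
        using p unfolding divide diff_divide_distrib by (metis divide_self less_irrefl)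
      then have "\<bar>v (of_nat (Suc j) / of_nat j) - 1\<bar> \<le> 1 / v (of_nat j)"
        using p \<open>\<bar>v (of_nat (Suc j)) - v (of_nat j)\<bar> \<le> 1\<close> by (simp add: abs_divide divide_right_mono)
      also have "\<dots> < \<epsilon>" using j p \<epsilon>(1) by (simp add: divide_less_eq mult.commute)
      finally have "v (of_nat (Suc j) / of_nat j) = 1" by (rule iso)
      then show ?thesis unfolding divide using divide_eq_1_iff by metis
    qed
    have "v (of_nat (K + j)) = v (of_nat K)" for j
    proof (induct j)
      case (Suc j)
      then show ?case using step[of "K + j"] vK(2) by (simp del: of_nat_Suc of_nat_add)
    qed simp
    moreover have "K + (K * K - K) = K * K" by (cases K) auto
    ultimately have "v (of_nat K) * v (of_nat K) = v (of_nat K)"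
      by (metis mult of_nat_mult)
    then show False using vK by simp
  qed
  then obtain y where y: "v y \<noteq> 1" "\<bar>v y - 1\<bar> < \<epsilon>" by blast
  show thesis
  proof (cases "1 < v y")
    case True
    then show thesis using that[of y] y \<epsilon> by simp
  next
    case False
    have "1 / (1 + \<delta>) < v y" using y(2) unfolding \<epsilon>(3)[symmetric] by linarith
    moreover from this have "0 < v y" using assms(2) by (smt (verit) divide_pos_pos)
    ultimately have "1 / v y < 1 + \<delta>" using assms(2) by (simp add: field_simps)
    moreover have "1 < 1 / v y" using False y(1) \<open>0 < v y\<close> by simp
    ultimately show thesis using that[of "1 / y"] by (simp add: divide)
  qed
qed

text \<open>The powers of an element whose value is slightly larger than \<open>1\<close> come close to every positive number.\<close>

lemma archimedean_value_group_dense: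
  assumes "archimedean v" "0 < r"
  shows "r \<in> closure (value_group v)"
  unfolding closure_approachable
proof (intro allI impI)
  fix e :: real assume "0 < e"
  then have "0 < e / r" using assms(2) by simp
  then obtain y where y: "1 < v y" "v y < 1 + e / r" using archimedean_near_1[OF assms(1)] by metis
  define z where "z = \<lfloor>log (v y) r\<rfloor>"
  have "v y powr z \<le> v y powr (log (v y) r)" "v y powr (log (v y) r) < v y powr (z + 1)"
    using y(1) unfolding z_def by (intro powr_mono powr_less_mono, linarith+)+
  moreover have "v y powr z = v y powi z" using y(1) by (intro powr_real_of_int') auto
  ultimately have z: "v y powi z \<le> r" "r < v y powi z * v y"
    using y(1) assms(2) by (simp_all add: powr_add powr_log_cancel)
  have "r - v y powi z < v y powi z * (v y - 1)" using z(2) by (simp add: algebra_simps)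
  also have "\<dots> \<le> r * (v y - 1)" using z(1) y(1) by (intro mult_right_mono) auto
  also have "\<dots> < r * (e / r)" using y(2) assms(2) by (intro mult_strict_left_mono) auto
  also have "\<dots> = e" using assms(2) by simp
  finally have "dist (v (y powi z)) r < e" unfolding power_int using z(1) by (simp add: dist_real_def)
  moreover have "y \<noteq> 0" using y(1) by auto
  then have "v (y powi z) \<in> value_group v" unfolding value_group_def by auto
  ultimately show "\<exists>x\<in>value_group v. dist x r < e" by blast
qed

lemma discrete_not_archimedean:
  assumes "1 < q" "value_group v \<subseteq> q_powers q"
  shows "\<not> archimedean v"
proof
  assume "archimedean v"
  then obtain y where y: "1 < v y" "v y < 1 + (q - 1)" using archimedean_near_1[of "q - 1"] assms(1) by auto
  then have "y \<noteq> 0" by auto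
  then obtain z :: int where z: "v y = q powi z" using assms(2) unfolding value_group_def q_powers_def by auto
  have "0 < z"
  proof (rule ccontr)
    assume "\<not> 0 < z"
    then have "q powi z \<le> q powi 0" using assms(1) by (intro power_int_increasing) auto
    then show False using y(1) z by simp
  qed
  then have "q powi 1 \<le> q powi z" using assms(1) by (intro power_int_increasing) auto
  then show False using y(2) z by simp
qed

lemma quadratic_form_le:
  fixes a :: "nat \<Rightarrow> nat \<Rightarrow> 'k" and x :: "nat \<Rightarrow> 'k"
  assumes "0 < n" "0 \<le> \<epsilon>" "\<And>i. i < n \<Longrightarrow> v (x i) \<le> \<epsilon>"
  shows "v (\<Sum>i<n. \<Sum>k\<in>{i..<n}. a i k * x i * x k) \<le> qf_norm_at n a v * \<epsilon>\<^sup>2"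
proof -
  have summand: "v (a i k * x i * x k) \<le> v (a i k) * \<epsilon>\<^sup>2" if "i < n" "k < n" for i k
    using assms that unfolding mult power2_eq_square mult.assoc
    by (intro mult_left_mono mult_mono) auto
  show ?thesis
  proof (cases "archimedean v")
    case True
    have "v (\<Sum>i<n. \<Sum>k\<in>{i..<n}. a i k * x i * x k) \<le> (\<Sum>i<n. \<Sum>k\<in>{i..<n}. v (a i k * x i * x k))"
      by (intro order.trans[OF triangle_sum] sum_mono triangle_sum)
    also have "\<dots> \<le> (\<Sum>i<n. \<Sum>k\<in>{i..<n}. v (a i k) * \<epsilon>\<^sup>2)"
      by (intro sum_mono summand) auto
    finally show ?thesis using True unfolding qf_norm_at_def by (simp add: sum_distrib_right)
  next
    case False
    let ?S = "{v (a i k) |i k. i \<le> k \<and> k < n}"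
    have "?S \<subseteq> (\<lambda>(i, k). v (a i k)) ` ({..<n} \<times> {..<n})" by auto
    then have fin: "finite ?S" by (rule finite_subset) simp
    have le: "v (a i k) \<le> qf_norm_at n a v" if "i \<le> k" "k < n" for i k
      using False that unfolding qf_norm_at_def by (auto intro!: Max_ge[OF fin])
    have "0 \<le> qf_norm_at n a v" using le[of 0 0] assms(1) nonneg[of "a 0 0"] by linarith
    then have M: "0 \<le> qf_norm_at n a v * \<epsilon>\<^sup>2" by simp
    show ?thesis
    proof (intro ultrametric_sum[OF False] M)
      fix i k assume "i \<in> {..<n}" "k \<in> {i..<n}"
      then show "v (a i k * x i * x k) \<le> qf_norm_at n a v * \<epsilon>\<^sup>2"
        using summand[of i k] mult_right_mono[OF le[of i k], of "\<epsilon>\<^sup>2"] by auto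
    qed
  qed
qed

end

section \<open>Ideals as subsets of the fraction field\<close>

text \<open>This keeps \<open>ring_on R\<close>, which is a record update, from being evaluated by the simplifier.\<close>

declare partial_object.update_convs [simp del]

locale dedekind =
  fixes R :: "'k::field set"
  assumes dedekind_domain_in: "dedekind_domain_in R"
begin

lemma subring_R: "subring R (class_ring :: 'k ring)"
  and noetherian: "noetherian_domain (ring_on R)"
  and prime_maximal: "primeideal P (ring_on R) \<Longrightarrow> P \<noteq> {0} \<Longrightarrow> maximalideal P (ring_on R)"
  using dedekind_domain_in unfolding dedekind_domain_in_def by auto

lemma integrally_closed:
  assumes "lead_coeff p = 1" "\<And>i. coeff p i \<in> R" "poly p x = 0"
  shows "x \<in> R"
  using dedekind_domain_in assms unfolding dedekind_domain_in_def by blast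

sublocale A: noetherian_domain "ring_on R"
  rewrites "carrier (ring_on R) = R" and "monoid.mult (ring_on R) = (*)" and "add (ring_on R) = (+)"
    and "one (ring_on R) = 1" and "zero (ring_on R) = 0"
  using noetherian by simp_all

lemma zero_R: "0 \<in> R" and one_R: "1 \<in> R"
  and add_R: "x \<in> R \<Longrightarrow> y \<in> R \<Longrightarrow> x + y \<in> R"
  and mult_R: "x \<in> R \<Longrightarrow> y \<in> R \<Longrightarrow> x * y \<in> R"
  using subringE[OF subring_R] by auto

lemma minus_R [intro]: "x \<in> R \<Longrightarrow> - x \<in> R"
proof -
  assume x: "x \<in> R"
  have "\<ominus>\<^bsub>class_ring\<^esub> x = - x" 
    using abelian_group.minus_equality[OF ring.is_abelian_group[OF class_ring.ring_axioms], of "-x" x] by simp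
  then show "- x \<in> R" using subringE(5)[OF subring_R x] by simp
qed

lemma diff_R [intro]: "x \<in> R \<Longrightarrow> y \<in> R \<Longrightarrow> x - y \<in> R"
  using add_R[of x "-y"] minus_R[of y] by simp

lemma power_R [intro]: "x \<in> R \<Longrightarrow> x ^ e \<in> R"
  by (induct e) auto

lemma sum_R [intro]: "(\<And>i. i \<in> S \<Longrightarrow> f i \<in> R) \<Longrightarrow> sum f S \<in> R"
  by (induct S rule: infinite_finite_induct) auto

lemma prod_R [intro]: "(\<And>i. i \<in> S \<Longrightarrow> f i \<in> R) \<Longrightarrow> prod f S \<in> R"
  by (induct S rule: infinite_finite_induct) auto

lemma finsum_R: "(\<And>i. i \<in> S \<Longrightarrow> f i \<in> R) \<Longrightarrow> finsum (ring_on R) f S = sum f S"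
proof (induct S rule: infinite_finite_induct)
  case (insert x F)
  then show ?case using A.finsum_insert[of F x f] by auto
qed (auto simp: A.finsum_empty[simplified] A.add.finprod_infinite[simplified] finsum_def finprod_def)

abbreviation ideal_of_R :: "'k set \<Rightarrow> bool"
  where "ideal_of_R I \<equiv> ideal I (ring_on R)"

lemma ideal_iff:
  "ideal_of_R I \<longleftrightarrow> I \<subseteq> R \<and> 0 \<in> I \<and> (\<forall>x\<in>I. \<forall>y\<in>I. x + y \<in> I) \<and> (\<forall>r\<in>R. \<forall>x\<in>I. r * x \<in> I)"
proof
  assume I: "ideal_of_R I"
  interpret ideal I "ring_on R" by (rule I)
  show "I \<subseteq> R \<and> 0 \<in> I \<and> (\<forall>x\<in>I. \<forall>y\<in>I. x + y \<in> I) \<and> (\<forall>r\<in>R. \<forall>x\<in>I. r * x \<in> I)"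
    using a_subset zero_closed a_closed I_l_closed by auto
next
  assume I: "I \<subseteq> R \<and> 0 \<in> I \<and> (\<forall>x\<in>I. \<forall>y\<in>I. x + y \<in> I) \<and> (\<forall>r\<in>R. \<forall>x\<in>I. r * x \<in> I)"
  show "ideal_of_R I"
  proof (rule idealI)
    show "ring (ring_on R)" by (rule A.ring_axioms)
    have "inv\<^bsub>add_monoid (ring_on R)\<^esub> x = - x" "- x \<in> I" if x: "x \<in> I" for x
    proof -
      have "(-1) * x \<in> I" using I x minus_R[OF one_R] by blast
      then show "-x \<in> I" by simp
      show "inv\<^bsub>add_monoid (ring_on R)\<^esub> x = - x"
        using abelian_group.minus_equality[OF ring.is_abelian_group[OF A.ring_axioms], of "-x" x] x I \<open>-x \<in> I\<close>
        unfolding a_inv_def by auto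
    qed
    then show "subgroup I (add_monoid (ring_on R))"
      unfolding subgroup_def using I by auto
    show "\<And>a x. a \<in> I \<Longrightarrow> x \<in> carrier (ring_on R) \<Longrightarrow> x \<otimes>\<^bsub>ring_on R\<^esub> a \<in> I"
      "\<And>a x. a \<in> I \<Longrightarrow> x \<in> carrier (ring_on R) \<Longrightarrow> a \<otimes>\<^bsub>ring_on R\<^esub> x \<in> I"
      using I by simp_all (metis mult.commute)
  qed
qed

lemma idealD:
  assumes "ideal_of_R I"
  shows "I \<subseteq> R" "0 \<in> I" "x \<in> I \<Longrightarrow> y \<in> I \<Longrightarrow> x + y \<in> I" "r \<in> R \<Longrightarrow> x \<in> I \<Longrightarrow> r * x \<in> I"
    "r \<in> R \<Longrightarrow> x \<in> I \<Longrightarrow> x * r \<in> I"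
  using assms unfolding ideal_iff by (auto simp: mult.commute[of x r])

lemma ideal_uminus: "ideal_of_R I \<Longrightarrow> x \<in> I \<Longrightarrow> - x \<in> I"
  using idealD(4)[of I "-1" x] minus_R[OF one_R] by auto

lemma ideal_diff: "ideal_of_R I \<Longrightarrow> x \<in> I \<Longrightarrow> y \<in> I \<Longrightarrow> x - y \<in> I"
  using idealD(3)[of I x "-y"] ideal_uminus[of I y] by auto

lemma ideal_sum: "ideal_of_R I \<Longrightarrow> (\<And>i. i \<in> S \<Longrightarrow> f i \<in> I) \<Longrightarrow> sum f S \<in> I"
  by (induct S rule: infinite_finite_induct) (auto intro: idealD(2,3))

lemma ideal_R: "ideal_of_R R"
  unfolding ideal_iff by auto

lemma ideal_eq_R: "ideal_of_R I \<Longrightarrow> 1 \<in> I \<Longrightarrow> I = R"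
  using idealD(1)[of I] idealD(4)[of I _ 1] by fastforce

lemma PIdl_eq: "a \<in> R \<Longrightarrow> PIdl\<^bsub>ring_on R\<^esub> a = (*) a ` R"
  unfolding cgenideal_def by (auto simp: mult.commute)

lemma ideal_image:
  assumes "a \<in> R" "ideal_of_R I" shows "ideal_of_R ((*) a ` I)"
proof -
  note I = idealD[OF assms(2)]
  have "a * x + a * y \<in> (*) a ` I" if "x \<in> I" "y \<in> I" for x y
    using I(3)[OF that] by (metis distrib_left image_eqI)
  moreover have "r * (a * x) \<in> (*) a ` I" if "x \<in> I" "r \<in> R" for x r
    using I(4)[OF that(2,1)] by (metis mult.left_commute image_eqI)
  moreover have "0 \<in> (*) a ` I" using I(2) by force
  moreover have "(*) a ` I \<subseteq> R" using I(1) assms(1) by auto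
  ultimately show ?thesis unfolding ideal_iff by blast
qed

lemma ideal_principal: "a \<in> R \<Longrightarrow> ideal_of_R ((*) a ` R)"
  using ideal_image ideal_R by auto

lemma principal_nonzero: "a \<noteq> 0 \<Longrightarrow> (*) a ` R \<noteq> {0}"
  using one_R by (metis image_eqI mult.right_neutral singletonD)

lemma ideal_add: 
  assumes "ideal_of_R I" "ideal_of_R J" shows "ideal_of_R {x + y |x y. x \<in> I \<and> y \<in> J}"
  unfolding ideal_iff
proof (intro conjI ballI)
  show "{x + y |x y. x \<in> I \<and> y \<in> J} \<subseteq> R" using assms idealD(1) by blast
  show "0 \<in> {x + y |x y. x \<in> I \<and> y \<in> J}" using idealD(2)[OF assms(1)] idealD(2)[OF assms(2)] by force
next
  fix u v assume "u \<in> {x + y |x y. x \<in> I \<and> y \<in> J}" "v \<in> {x + y |x y. x \<in> I \<and> y \<in> J}"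
  then obtain x y x' y' where "u = x + y" "v = x' + y'" "x \<in> I" "y \<in> J" "x' \<in> I" "y' \<in> J" by auto
  then have "u + v = (x + x') + (y + y')" "x + x' \<in> I" "y + y' \<in> J" 
    using assms idealD(3) by (auto simp: algebra_simps)
  then show "u + v \<in> {x + y |x y. x \<in> I \<and> y \<in> J}" by blast
next
  fix r u assume "r \<in> R" "u \<in> {x + y |x y. x \<in> I \<and> y \<in> J}"
  then obtain x y where "u = x + y" "x \<in> I" "y \<in> J" by auto
  then have "r * u = r * x + r * y" "r * x \<in> I" "r * y \<in> J"
    using \<open>r \<in> R\<close> assms idealD(4) by (auto simp: distrib_left)
  then show "r * u \<in> {x + y |x y. x \<in> I \<and> y \<in> J}" by blast
qed

text \<open>The form in which the Noetherian property is used: the union of a chain of ideals belongs to the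
chain, so Zorn's lemma applies to every nonempty family of ideals.\<close>

lemma maximal_member:
  assumes "S \<noteq> {}" "\<And>I. I \<in> S \<Longrightarrow> ideal_of_R I"
  obtains M where "M \<in> S" "\<And>I. I \<in> S \<Longrightarrow> M \<subseteq> I \<Longrightarrow> I = M"
proof -
  have "\<exists>M\<in>S. \<forall>X\<in>S. M \<subseteq> X \<longrightarrow> X = M"
  proof (rule subset_Zorn_nonempty[OF assms(1)])
    fix C assume C: "C \<noteq> {}" "subset.chain S C"
    then have "subset.chain {I. ideal_of_R I} C"
      using assms(2) unfolding subset.chain_def by auto
    then have "\<Union>C \<in> C" using A.ideal_chain_is_trivial[of C] C by auto
    then show "\<Union>C \<in> S" using C unfolding subset.chain_def by auto
  qed
  then show thesis using that by blast
qed

abbreviation nonzero_prime :: "'k set \<Rightarrow> bool"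
  where "nonzero_prime P \<equiv> primeideal P (ring_on R) \<and> P \<noteq> {0}"

lemma primeD:
  assumes "primeideal P (ring_on R)"
  shows "ideal_of_R P" "1 \<notin> P" "x \<in> R \<Longrightarrow> y \<in> R \<Longrightarrow> x * y \<in> P \<Longrightarrow> x \<in> P \<or> y \<in> P"
proof -
  interpret primeideal P "ring_on R" by (rule assms)
  show i: "ideal_of_R P" by (rule is_ideal)
  show "1 \<notin> P" using ideal_eq_R[OF i] I_notcarr by auto
  show "x \<in> R \<Longrightarrow> y \<in> R \<Longrightarrow> x * y \<in> P \<Longrightarrow> x \<in> P \<or> y \<in> P" using I_prime by auto
qed

lemma nonzero_prime_maximal:
  assumes "nonzero_prime P" "ideal_of_R J" "P \<subseteq> J"
  shows "J = P \<or> J = R"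
proof -
  interpret maximalideal P "ring_on R" using prime_maximal assms by auto
  show ?thesis using I_maximal[OF assms(2,3)] idealD(1)[OF assms(2)] by auto
qed

lemma exists_prime_above:
  assumes "ideal_of_R I" "I \<noteq> R"
  obtains P where "primeideal P (ring_on R)" "I \<subseteq> P"
proof -
  obtain P where P: "P \<in> {J. ideal_of_R J \<and> I \<subseteq> J \<and> J \<noteq> R}"
    "\<And>J. J \<in> {J. ideal_of_R J \<and> I \<subseteq> J \<and> J \<noteq> R} \<Longrightarrow> P \<subseteq> J \<Longrightarrow> J = P"
    using maximal_member[of "{J. ideal_of_R J \<and> I \<subseteq> J \<and> J \<noteq> R}"] assms by blast
  have "maximalideal P (ring_on R)"
    unfolding maximalideal_def maximalideal_axioms_def using P by auto
  then have "primeideal P (ring_on R)" using A.maximalideal_prime by auto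
  then show thesis using that P by auto
qed

abbreviation iprod (infixl \<open>\<star>\<close> 80) where "I \<star> J \<equiv> I \<cdot>\<^bsub>ring_on R\<^esub> J"

lemma iprodI: "x \<in> I \<Longrightarrow> y \<in> J \<Longrightarrow> x * y \<in> I \<star> J"
  using ideal_prod.prod[of x I y J "ring_on R"] by simp

lemma ideal_iprod: "ideal_of_R I \<Longrightarrow> ideal_of_R J \<Longrightarrow> ideal_of_R (I \<star> J)"
  by (rule A.ideal_prod_is_ideal)

lemma iprod_subset:
  assumes "ideal_of_R S" "\<And>x y. x \<in> I \<Longrightarrow> y \<in> J \<Longrightarrow> x * y \<in> S"
  shows "I \<star> J \<subseteq> S"
proof
  fix z assume "z \<in> I \<star> J"
  then show "z \<in> S" by (induct rule: ideal_prod.induct) (use assms idealD(3) in auto)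
qed

lemma iprod_subset_Int: "ideal_of_R I \<Longrightarrow> ideal_of_R J \<Longrightarrow> I \<star> J \<subseteq> I \<inter> J"
  by (rule A.ideal_prod_inter)

lemma prime_iprod: "primeideal P (ring_on R) \<Longrightarrow> ideal_of_R I \<Longrightarrow> ideal_of_R J \<Longrightarrow> I \<star> J \<subseteq> P \<Longrightarrow> I \<subseteq> P \<or> J \<subseteq> P"
  by (rule A.primeideal_divides_ideal_prod)

lemma nonzero_ideal_elem:
  assumes "ideal_of_R I" "I \<noteq> {0}"
  obtains x where "x \<in> I" "x \<noteq> 0"
  using idealD(2)[OF assms(1)] assms(2) by (metis insert_absorb insertI1 subsetI subset_singleton_iff insert_not_empty singleton_iff)

section \<open>Factorization of ideals into primes\<close>

lemma prime_if_not_split: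
  assumes I: "ideal_of_R I" "I \<noteq> R"
    and split: "\<And>a b. a \<in> R \<Longrightarrow> b \<in> R \<Longrightarrow> a * b \<in> I \<Longrightarrow> a \<in> I \<or> b \<in> I"
  shows "primeideal I (ring_on R)"
  unfolding primeideal_def primeideal_axioms_def
  using assms A.is_cring by auto

lemma ideal_prime_product:
  assumes "\<forall>P\<in>set Ps. nonzero_prime P" shows "ideal_of_R (foldr (\<star>) Ps R)"
  using assms
proof (induct Ps)
  case (Cons P Ps)
  then show ?case using ideal_iprod[OF primeD(1)[of P], of "foldr (\<star>) Ps R"] by simp
qed (simp add: ideal_R)

text \<open>A maximal counterexample \<open>M\<close> is not prime, so there are \<open>a, b \<notin> M\<close> with \<open>ab \<in> M\<close>. Both \<open>M + (a)\<close> and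
\<open>M + (b)\<close> contain products of primes, and their product lies in \<open>M\<close>.\<close>

lemma contains_prime_product:
  assumes "ideal_of_R I" "I \<noteq> {0}"
  shows "\<exists>Ps. (\<forall>P\<in>set Ps. nonzero_prime P) \<and> foldr (\<star>) Ps R \<subseteq> I"
proof (rule ccontr)
  let ?good = "\<lambda>I. \<exists>Ps. (\<forall>P\<in>set Ps. nonzero_prime P) \<and> foldr (\<star>) Ps R \<subseteq> I"
  define S where "S = {J. ideal_of_R J \<and> J \<noteq> {0} \<and> \<not> ?good J}"
  assume "\<not> ?thesis"
  then have "S \<noteq> {}" using assms unfolding S_def by blast
  moreover have "\<And>J. J \<in> S \<Longrightarrow> ideal_of_R J" unfolding S_def by blast
  ultimately obtain M where M: "M \<in> S" "\<And>J. J \<in> S \<Longrightarrow> M \<subseteq> J \<Longrightarrow> J = M"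
    using maximal_member[of S] by metis
  have idM: "ideal_of_R M" and M0: "M \<noteq> {0}" and bad: "\<not> ?good M"
    using M(1) unfolding S_def by auto
  have "M \<noteq> R"
  proof
    assume "M = R"
    then have "?good M" by (intro exI[of _ "[]"]) simp
    with bad show False by blast
  qed
  moreover have "\<not> primeideal M (ring_on R)"
  proof
    assume p: "primeideal M (ring_on R)"
    have "M \<star> R \<subseteq> M" using iprod_subset_Int[OF idM ideal_R] by blast
    with p M0 have "?good M" by (intro exI[of _ "[M]"]) simp
    with bad show False by blast
  qed
  ultimately obtain a b where ab: "a \<in> R" "b \<in> R" "a * b \<in> M" "a \<notin> M" "b \<notin> M"
    using prime_if_not_split[OF idM] by blast
  define Q where "Q c = {x + y |x y. x \<in> M \<and> y \<in> (*) c ` R}" for c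
  have Q: "ideal_of_R (Q c)" "M \<subseteq> Q c" "c \<in> Q c" if "c \<in> R" for c
  proof -
    show "ideal_of_R (Q c)" unfolding Q_def
      by (rule ideal_add[OF idM ideal_principal[OF that]])
    have "x + c * 0 \<in> Q c" if "x \<in> M" for x using that unfolding Q_def by blast
    then show "M \<subseteq> Q c" by auto
    have "0 + c * 1 \<in> Q c" using idealD(2)[OF idM] unfolding Q_def by blast
    then show "c \<in> Q c" by simp
  qed
  have "?good (Q c)" if c: "c \<in> R" "c \<notin> M" for c
  proof (rule ccontr)
    assume "\<not> ?good (Q c)"
    moreover have "Q c \<noteq> {0}"
      using Q(2)[OF c(1)] M0 idealD(2)[OF idM] by blast
    ultimately have "Q c \<in> S" using Q(1)[OF c(1)] unfolding S_def by blast
    then have "Q c = M" using M(2) Q(2)[OF c(1)] by blast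
    then show False using Q(3)[OF c(1)] c(2) by blast
  qed
  then obtain Ps Qs where Ps: "\<forall>P\<in>set Ps. nonzero_prime P" "foldr (\<star>) Ps R \<subseteq> Q a"
    and Qs: "\<forall>P\<in>set Qs. nonzero_prime P" "foldr (\<star>) Qs R \<subseteq> Q b"
    using ab by meson
  note idf = ideal_prime_product
  have app: "foldr (\<star>) (Ls @ Qs) R = foldr (\<star>) Ls R \<star> foldr (\<star>) Qs R" if "\<forall>P\<in>set Ls. nonzero_prime P" for Ls
    using that
  proof (induct Ls)
    case Nil
    show ?case using A.ideal_prod_commute[OF ideal_R idf[OF Qs(1)]] A.ideal_prod_one[OF idf[OF Qs(1)]] by simp
  next
    case (Cons P Ls)
    then show ?case using A.ideal_prod_assoc[OF primeD(1)[of P] idf[of Ls] idf[OF Qs(1)]] by simp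
  qed
  have "foldr (\<star>) Ps R \<star> foldr (\<star>) Qs R \<subseteq> M"
  proof (rule iprod_subset[OF idM])
    fix x y assume "x \<in> foldr (\<star>) Ps R" "y \<in> foldr (\<star>) Qs R"
    then have "x \<in> Q a" "y \<in> Q b" using Ps(2) Qs(2) by auto
    then obtain u r v s where uv: "x = u + a * r" "y = v + b * s" "u \<in> M" "v \<in> M" "r \<in> R" "s \<in> R"
      unfolding Q_def by blast
    have "x * y = (v + b * s) * u + (a * r) * v + (r * s) * (a * b)"
      unfolding uv by (simp add: algebra_simps)
    moreover have "v \<in> R" using uv(4) idealD(1)[OF idM] by auto
    ultimately show "x * y \<in> M" using uv ab
      by (auto intro!: idealD(3,4)[OF idM] add_R mult_R)
  qed
  then have "foldr (\<star>) (Ps @ Qs) R \<subseteq> M" using app[OF Ps(1)] by simp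
  with Ps(1) Qs(1) have "?good M" by (intro exI[of _ "Ps @ Qs"]) auto
  with bad show False by blast
qed

text \<open>For \<open>0 \<noteq> c \<in> I\<close> the \<open>R\<close>-modules spanned by \<open>c, cx, \<dots>, cx\<^sup>n\<^sup>-\<^sup>1\<close> are ideals of \<open>R\<close>, because \<open>cx\<^sup>i \<in> I\<close>. They form
an ascending chain; where it becomes stationary it yields a monic equation for \<open>x\<close>, and \<open>R\<close> is
integrally closed.\<close>

lemma stable_multiplier_in_R:
  assumes I: "ideal_of_R I" "I \<noteq> {0}" and x: "\<And>y. y \<in> I \<Longrightarrow> x * y \<in> I"
  shows "x \<in> R"
proof -
  obtain c where c: "c \<in> I" "c \<noteq> 0" using nonzero_ideal_elem[OF I] .
  have pow: "c * x ^ n \<in> I" for n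
  proof (induct n)
    case (Suc n)
    have "c * x ^ Suc n = x * (c * x ^ n)" by simp
    then show ?case using x[OF Suc] by (simp only:)
  qed (simp add: c)
  have powR: "c * x ^ n \<in> R" for n using pow idealD(1)[OF I(1)] by blast
  define J where "J n = {\<Sum>i<n. r i * (c * x ^ i) |r. \<forall>i. r i \<in> R}" for n
  have idJ: "ideal_of_R (J n)" for n
    unfolding ideal_iff
  proof (intro conjI ballI)
    show "J n \<subseteq> R" unfolding J_def using powR by auto
    show "0 \<in> J n" unfolding J_def by (rule CollectI, rule exI[of _ "\<lambda>_. 0"]) simp
  next
    fix u v assume "u \<in> J n" "v \<in> J n"
    then obtain r s where "u = (\<Sum>i<n. r i * (c * x ^ i))" "v = (\<Sum>i<n. s i * (c * x ^ i))"
      "\<forall>i. r i \<in> R" "\<forall>i. s i \<in> R" unfolding J_def by blast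
    then show "u + v \<in> J n" unfolding J_def
      by (intro CollectI exI[of _ "\<lambda>i. r i + s i"]) (auto simp: distrib_right sum.distrib)
  next
    fix t u assume "t \<in> R" "u \<in> J n"
    then obtain r where "u = (\<Sum>i<n. r i * (c * x ^ i))" "\<forall>i. r i \<in> R" unfolding J_def by blast
    with \<open>t \<in> R\<close> show "t * u \<in> J n" unfolding J_def
      by (intro CollectI exI[of _ "\<lambda>i. t * r i"]) (auto simp: sum_distrib_left mult.assoc)
  qed
  obtain M where M: "M \<in> range J" "\<And>I. I \<in> range J \<Longrightarrow> M \<subseteq> I \<Longrightarrow> I = M"
    by (rule maximal_member[of "range J"]) (use idJ in auto)
  then obtain n where "M = J n" by auto
  then have n: "\<And>k. J n \<subseteq> J k \<Longrightarrow> J k = J n" using M(2) by simp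
  have "J n \<subseteq> J (Suc n)"
  proof
    fix u assume "u \<in> J n"
    then obtain r where u: "u = (\<Sum>i<n. r i * (c * x ^ i))" "\<forall>i. r i \<in> R" unfolding J_def by blast
    then have "u = (\<Sum>i<Suc n. (r(n := 0)) i * (c * x ^ i))" by simp
    moreover have "\<forall>i. (r(n := 0)) i \<in> R" using u by auto
    ultimately show "u \<in> J (Suc n)" unfolding J_def by blast
  qed
  then have "J (Suc n) = J n" by (rule n)
  moreover have "c * x ^ n \<in> J (Suc n)" unfolding J_def
    by (rule CollectI, rule exI[of _ "\<lambda>i. if i = n then 1 else 0"]) auto
  ultimately obtain r where r: "c * x ^ n = (\<Sum>i<n. r i * (c * x ^ i))" "\<forall>i. r i \<in> R"
    unfolding J_def by blast
  have "c * x ^ n = c * (\<Sum>i<n. r i * x ^ i)"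
    unfolding r(1) by (simp add: sum_distrib_left mult.left_commute)
  then have rx: "x ^ n = (\<Sum>i<n. r i * x ^ i)" using c by simp
  define p where "p = monom 1 n - (\<Sum>i<n. monom (r i) i)"
  have cf: "coeff p i = (if i = n then 1 else if i < n then - r i else 0)" for i
    unfolding p_def by (auto simp: coeff_sum sum.delta' cong: if_cong)
  have "degree p = n"
    by (rule antisym[OF degree_le le_degree]) (auto simp: cf)
  then have "lead_coeff p = 1" by (simp add: cf)
  moreover have "coeff p i \<in> R" for i using r(2) minus_R by (auto simp: cf)
  moreover have "poly p x = 0" unfolding p_def by (simp add: poly_sum poly_monom rx)
  ultimately show "x \<in> R" by (rule integrally_closed)
qed

text \<open>For \<open>0 \<noteq> a \<in> P\<close> take a product of primes inside \<open>(a)\<close> with as few factors as possible. As nonzero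
primes are maximal, \<open>P\<close> is one of the factors. The product of the other factors has an element \<open>b\<close>
outside \<open>(a)\<close>, and \<open>x = b/a\<close> has the required properties.\<close>

lemma prime_partial_inverse:
  assumes P: "nonzero_prime P"
  shows "\<exists>x. x \<notin> R \<and> (\<forall>y\<in>P. x * y \<in> R)"
proof -
  note idP = primeD(1)[OF conjunct1[OF P]]
  obtain a where a: "a \<in> P" "a \<noteq> 0" using nonzero_ideal_elem[OF idP] P by blast
  have aR: "a \<in> R" using a idealD(1)[OF idP] by blast
  define good where "good Ps \<longleftrightarrow> (\<forall>P\<in>set Ps. nonzero_prime P) \<and> foldr (\<star>) Ps R \<subseteq> (*) a ` R" for Ps
  have "\<exists>Ps. good Ps"
    unfolding good_def using contains_prime_product[OF ideal_principal[OF aR] principal_nonzero[OF a(2)]] .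
  then obtain Ps where Ps: "good Ps" "\<And>Qs. good Qs \<Longrightarrow> length Ps \<le> length Qs"
    using ex_has_least_nat[of good _ length] by metis
  note idf = ideal_prime_product
  have "\<exists>Q\<in>set Ls. Q \<subseteq> P" if "foldr (\<star>) Ls R \<subseteq> P" "\<forall>P\<in>set Ls. nonzero_prime P" for Ls
    using that
  proof (induct Ls)
    case Nil then show ?case using primeD(2)[of P] P one_R by auto
  next
    case (Cons Q Ls)
    then show ?case
      using prime_iprod[of P Q "foldr (\<star>) Ls R"] P primeD(1)[of Q] idf[of Ls] by auto
  qed
  moreover have aRP: "(*) a ` R \<subseteq> P" using a(1) idealD(5)[OF idP] by auto
  ultimately obtain Q where Q: "Q \<in> set Ps" "Q \<subseteq> P"
    using Ps(1) unfolding good_def by (meson order.trans)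
  have "P = Q \<or> P = R" using nonzero_prime_maximal[of Q P] Q Ps(1) idP unfolding good_def by blast
  then have PQ: "P = Q" using primeD(2)[of P] P by auto
  define Qs where "Qs = remove1 P Ps"
  have Qs: "\<forall>P\<in>set Qs. nonzero_prime P" using Ps(1) unfolding Qs_def good_def by (meson in_mono set_remove1_subset)
  have fold: "foldr (\<star>) Ls R = P \<star> foldr (\<star>) (remove1 P Ls) R" if "P \<in> set Ls" "\<forall>P\<in>set Ls. nonzero_prime P" for Ls
    using that
  proof (induct Ls)
    case (Cons Q Ls)
    show ?case
    proof (cases "Q = P")
      case False
      then have "P \<in> set Ls" using Cons by auto
      then have *: "foldr (\<star>) Ls R = P \<star> foldr (\<star>) (remove1 P Ls) R" using Cons by auto
      have i: "ideal_of_R (foldr (\<star>) (remove1 P Ls) R)"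
        using Cons(3) set_remove1_subset[of P Ls] by (intro idf) auto
      have iQ: "ideal_of_R Q" using Cons(3) primeD(1)[of Q] by auto
      have "Q \<star> (P \<star> foldr (\<star>) (remove1 P Ls) R) = P \<star> (Q \<star> foldr (\<star>) (remove1 P Ls) R)"
        using A.ideal_prod_assoc[OF idP iQ i] A.ideal_prod_assoc[OF iQ idP i] A.ideal_prod_commute[OF idP iQ] by simp
      then show ?thesis using False * by simp
    qed simp
  qed simp
  have "\<not> good Qs"
  proof
    assume "good Qs" then have "length Ps \<le> length Qs" by (rule Ps(2))
    moreover have "length Qs < length Ps" unfolding Qs_def using Q PQ length_pos_if_in_set[OF Q(1)]
      by (simp add: length_remove1)
    ultimately show False by simp
  qed
  then obtain b where b: "b \<in> foldr (\<star>) Qs R" "b \<notin> (*) a ` R" using Qs unfolding good_def by blast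
  have bR: "b \<in> R" using b(1) idealD(1)[OF idf[OF Qs]] by blast
  have "b / a \<notin> R"
  proof
    assume "b / a \<in> R"
    then have "a * (b / a) \<in> (*) a ` R" by blast
    then show False using b(2) a(2) by simp
  qed
  moreover have "b / a * y \<in> R" if "y \<in> P" for y
  proof -
    have "y * b \<in> P \<star> foldr (\<star>) Qs R" by (rule iprodI[OF that b(1)])
    also have "\<dots> = foldr (\<star>) Ps R" using fold[of Ps] Q PQ Ps(1) unfolding Qs_def good_def by simp
    also have "\<dots> \<subseteq> (*) a ` R" using Ps(1) unfolding good_def by blast
    finally obtain r where "y * b = a * r" "r \<in> R" by blast
    then show ?thesis using a(2) by (simp add: field_simps)
  qed
  ultimately show ?thesis by auto
qed

text \<open>Let \<open>P \<supseteq> I\<close> be prime and let \<open>x \<notin> R\<close> satisfy \<open>xP \<subseteq> R\<close>. By \<open>stable_multiplier_in_R\<close> neither \<open>xP \<subseteq> P\<close> nor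
\<open>xI \<subseteq> I\<close> holds. The first gives \<open>P + xP = R\<close>, as \<open>P\<close> is maximal, and thus \<open>P(I + xI) = I\<close>; the second shows
that \<open>J = I + xI\<close> is larger than \<open>I\<close>.\<close>

lemma ideal_eq_prime_times_larger:
  assumes I: "ideal_of_R I" "I \<noteq> {0}" "I \<noteq> R"
  obtains P J where "nonzero_prime P" "ideal_of_R J" "I \<subset> J" "I = P \<star> J"
proof -
  obtain P where P: "primeideal P (ring_on R)" "I \<subseteq> P" using exists_prime_above[OF I(1,3)] .
  note idP = primeD(1)[OF P(1)]
  have P0: "P \<noteq> {0}" using P(2) I(2) idealD(2)[OF I(1)] by blast
  obtain x where x: "x \<notin> R" "\<And>y. y \<in> P \<Longrightarrow> x * y \<in> R"
    using prime_partial_inverse[OF conjI[OF P(1) P0]] by auto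
  have mul: "ideal_of_R ((*) x ` I)" if "ideal_of_R I" "I \<subseteq> P" for I
    unfolding ideal_iff
  proof (intro conjI ballI)
    show "(*) x ` I \<subseteq> R" using x(2) that(2) by auto
    show "0 \<in> (*) x ` I" using idealD(2)[OF that(1)] by force
    fix u v assume "u \<in> (*) x ` I" "v \<in> (*) x ` I"
    then obtain y z where yz: "u = x * y" "v = x * z" "y \<in> I" "z \<in> I" by (elim imageE)
    have "u + v = x * (y + z)" using yz by (simp add: distrib_left)
    moreover have "y + z \<in> I" by (rule idealD(3)[OF that(1) yz(3,4)])
    ultimately show "u + v \<in> (*) x ` I" by blast
  next
    fix r u assume r: "r \<in> R" and "u \<in> (*) x ` I"
    then obtain y where y: "u = x * y" "y \<in> I" by (elim imageE)
    have "r * u = x * (r * y)" using y by simp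
    moreover have "r * y \<in> I" by (rule idealD(4)[OF that(1) r y(2)])
    ultimately show "r * u \<in> (*) x ` I" by blast
  qed
  define J where "J I = {u + v |u v. u \<in> I \<and> v \<in> (*) x ` I}" for I
  have J: "ideal_of_R (J I)" "I \<subseteq> J I" "y \<in> I \<Longrightarrow> x * y \<in> J I" if "ideal_of_R I" "I \<subseteq> P" for I y
  proof -
    show "ideal_of_R (J I)" unfolding J_def by (rule ideal_add[OF that(1) mul[OF that]])
    have mem: "u + x * z \<in> J I" if "u \<in> I" "z \<in> I" for u z
      unfolding J_def using that by auto
    note I0 = idealD(2)[OF \<open>ideal_of_R I\<close>]
    show "I \<subseteq> J I"
    proof
      fix u assume "u \<in> I" from mem[OF this I0] show "u \<in> J I" by simp
    qed
    assume "y \<in> I" from mem[OF I0 this] show "x * y \<in> J I" by simp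
  qed
  have JE: "\<exists>y\<in>I. \<exists>z\<in>I. w = y + x * z" if "w \<in> J I" for w I
    using that unfolding J_def by auto
  have "J P = P \<or> J P = R" 
    by (rule nonzero_prime_maximal[OF conjI[OF P(1) P0] J(1)[OF idP order_refl] J(2)[OF idP order_refl]])
  moreover have "J P \<noteq> P"
  proof
    assume eq: "J P = P"
    have "x \<in> R" using J(3)[OF idP order_refl] unfolding eq by (rule stable_multiplier_in_R[OF idP P0])
    with x(1) show False ..
  qed
  ultimately have "1 \<in> J P" using one_R by simp
  then have "\<exists>y\<in>P. \<exists>z\<in>P. 1 = y + x * z" by (rule JE)
  then obtain p q where pq: "1 = p + x * q" "p \<in> P" "q \<in> P" by (elim bexE)
  show thesis
  proof (rule that[of P "J I"])
    show "nonzero_prime P" using P(1) P0 by blast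
    show "ideal_of_R (J I)" using J(1)[OF I(1) P(2)] .
    have "J I \<noteq> I"
    proof
      assume eq: "J I = I"
      have "x \<in> R" using J(3)[OF I(1) P(2)] unfolding eq by (rule stable_multiplier_in_R[OF I(1,2)])
      with x(1) show False ..
    qed
    then show "I \<subset> J I" using J(2)[OF I(1) P(2)] by (simp add: psubset_eq)
    show "I = P \<star> J I"
    proof
      show "P \<star> J I \<subseteq> I"
      proof (rule iprod_subset[OF I(1)])
        fix u w assume u: "u \<in> P" and wJ: "w \<in> J I"
        obtain y z where w: "w = y + x * z" "y \<in> I" "z \<in> I" using JE[OF wJ] by (elim bexE)
        have "u \<in> R" by (rule subsetD[OF idealD(1)[OF idP] u])
        then have "u * y \<in> I" by (rule idealD(4)[OF I(1) _ w(2)])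
        moreover have "(x * u) * z \<in> I" using x(2) u by (intro idealD(4)[OF I(1) _ w(3)]) simp
        ultimately have "u * y + (x * u) * z \<in> I" by (rule idealD(3)[OF I(1)])
        then show "u * w \<in> I" unfolding w by (simp add: algebra_simps)
      qed
      show "I \<subseteq> P \<star> J I"
      proof
        fix y assume y: "y \<in> I"
        have "p * y \<in> P \<star> J I" using J(2)[OF I(1) P(2)] y by (intro iprodI[OF pq(2)]) blast
        moreover have "q * (x * y) \<in> P \<star> J I" by (rule iprodI[OF pq(3) J(3)[OF I(1) P(2) y]])
        ultimately have "p * y + q * (x * y) \<in> P \<star> J I"
          by (rule idealD(3)[OF ideal_iprod[OF idP J(1)[OF I(1) P(2)]]])
        moreover have "p * y + q * (x * y) = (p + x * q) * y" by (simp add: algebra_simps)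
        then have "p * y + q * (x * y) = y" unfolding pq(1)[symmetric] by simp
        ultimately show "y \<in> P \<star> J I" by simp
      qed
    qed
  qed
qed

sublocale ideals: comm_monoid "ideals_set (ring_on R)"
  rewrites "carrier (ideals_set (ring_on R)) = {I. ideal_of_R I}"
    and "monoid.mult (ideals_set (ring_on R)) = (\<star>)"
    and "one (ideals_set (ring_on R)) = R"
  using A.ideals_set_is_comm_monoid by (simp_all add: ideals_set_def)

lemma ideals_set_simps [simp]:
  "one (ideals_set (ring_on R)) = R" "monoid.mult (ideals_set (ring_on R)) = (\<star>)"
  by (simp_all add: ideals_set_def)

abbreviation ideal_power :: "'k set \<Rightarrow> nat \<Rightarrow> 'k set"  (infixr \<open>^\<^sub>R\<close> 85)
  where "I ^\<^sub>R e \<equiv> I [^]\<^bsub>ideals_set (ring_on R)\<^esub> e"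

abbreviation ideal_product :: "nat \<Rightarrow> (nat \<Rightarrow> 'k set) \<Rightarrow> 'k set"
  where "ideal_product l I \<equiv> finprod (ideals_set (ring_on R)) I {..<l}"

lemma ideal_ideal_power: "ideal_of_R I \<Longrightarrow> ideal_of_R (I ^\<^sub>R e)"
  using ideals.nat_pow_closed[of I e] by simp

lemma ideal_ideal_product: "(\<And>i. i < l \<Longrightarrow> ideal_of_R (I i)) \<Longrightarrow> ideal_of_R (ideal_product l I)"
  using ideals.finprod_closed[of I "{..<l}"] by auto

lemma ideal_product_Suc:
  "(\<And>i. i < Suc l \<Longrightarrow> ideal_of_R (I i)) \<Longrightarrow> ideal_product (Suc l) I = I l \<star> ideal_product l I"
  unfolding lessThan_Suc using ideals.finprod_insert[of "{..<l}" l I] by auto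

lemma ideal_product_cong:
  assumes "\<And>i. i < l \<Longrightarrow> ideal_of_R (J i)" "\<And>i. i < l \<Longrightarrow> I i = J i"
  shows "ideal_product l I = ideal_product l J"
  using assms by (intro ideals.finprod_cong') auto

text \<open>Noetherian induction with \<open>ideal_eq_prime_times_larger\<close>. If the new prime already occurs as \<open>Q k\<close>, then
it is absorbed by a product whose \<open>k\<close>-th factor is \<open>Q k\<close> and whose other factors are \<open>R\<close>.\<close>

lemma prime_factorization:
  assumes "ideal_of_R I" "I \<noteq> {0}"
  shows "\<exists>l P e. (\<forall>i<l. nonzero_prime (P i) \<and> 0 < (e i :: nat)) \<and> inj_on P {..<l} \<and>
    I = ideal_product l (\<lambda>i. P i ^\<^sub>R e i)"
proof (rule ccontr)
  define good where "good I \<longleftrightarrow> (\<exists>l P e. (\<forall>i<l. nonzero_prime (P i) \<and> 0 < (e i :: nat)) \<and> inj_on P {..<l} \<and>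
    I = ideal_product l (\<lambda>i. P i ^\<^sub>R e i))" for I
  define S where "S = {J. ideal_of_R J \<and> J \<noteq> {0} \<and> \<not> good J}"
  assume "\<not> ?thesis"
  then have "I \<in> S" using assms unfolding S_def good_def by simp
  then have "S \<noteq> {}" by auto
  moreover have "\<And>J. J \<in> S \<Longrightarrow> ideal_of_R J" unfolding S_def by simp
  ultimately obtain M where M: "M \<in> S" "\<And>J. J \<in> S \<Longrightarrow> M \<subseteq> J \<Longrightarrow> J = M"
    using maximal_member[of S] by metis
  have idM: "ideal_of_R M" and M0: "M \<noteq> {0}" and bad: "\<not> good M"
    using M(1) unfolding S_def by auto
  have "good R" unfolding good_def by (rule exI[of _ 0]) simp
  with bad have "M \<noteq> R" by auto
  then obtain P J where PJ: "nonzero_prime P" "ideal_of_R J" "M \<subset> J" "M = P \<star> J"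
    using ideal_eq_prime_times_larger[OF idM M0] by metis
  note idP = primeD(1)[OF conjunct1[OF PJ(1)]]
  have "J \<noteq> {0}" using PJ(3) M0 idealD(2)[OF idM] by auto
  moreover have "J \<notin> S" using M(2)[of J] PJ(3) by auto
  ultimately have "good J" using PJ(2) unfolding S_def by simp
  then obtain l Q e where Q: "\<And>i. i < l \<Longrightarrow> nonzero_prime (Q i)" "\<And>i. i < l \<Longrightarrow> 0 < (e i :: nat)"
    "inj_on Q {..<l}" and J: "J = ideal_product l (\<lambda>i. Q i ^\<^sub>R e i)"
    unfolding good_def by blast
  have idQ: "ideal_of_R (Q i ^\<^sub>R f)" if "i < l" for i f
    using Q(1)[OF that] primeD(1) ideal_ideal_power by simp
  have "good M"
  proof (cases "P \<in> Q ` {..<l}")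
    case True
    then obtain k where k: "k < l" "P = Q k" by auto
    have "ideal_product l (\<lambda>i. Q i ^\<^sub>R (e(k := Suc (e k))) i) =
      ideal_product l (\<lambda>i. Q i ^\<^sub>R e i \<star> (if k = i then Q i else R))"
    proof (rule ideals.finprod_cong')
      show "(\<lambda>i. Q i ^\<^sub>R e i \<star> (if k = i then Q i else R)) \<in> {..<l} \<rightarrow> {I. ideal_of_R I}"
        using idQ Q(1) primeD(1) ideal_R ideal_iprod by auto
      fix i assume "i \<in> {..<l}"
      then show "Q i ^\<^sub>R (e(k := Suc (e k))) i = Q i ^\<^sub>R e i \<star> (if k = i then Q i else R)"
        using ideals.nat_pow_Suc A.ideal_prod_one[OF idQ] by simp
    qed simp
    also have "\<dots> = J \<star> ideal_product l (\<lambda>i. if k = i then Q i else R)"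
      unfolding J using idQ Q(1) primeD(1) ideal_R by (intro ideals.finprod_multf) auto
    also have "ideal_product l (\<lambda>i. if k = i then Q i else R) = P"
      using k Q(1) primeD(1) by (subst ideals.finprod_singleton) auto
    also have "J \<star> P = M" using PJ(2,4) idP A.ideal_prod_commute by simp
    finally show ?thesis unfolding good_def
      using Q by (intro exI[of _ l] exI[of _ Q] exI[of _ "e(k := Suc (e k))"]) auto
  next
    case False
    have "ideal_product (Suc l) (\<lambda>i. (Q(l := P)) i ^\<^sub>R (e(l := 1)) i) =
      P ^\<^sub>R 1 \<star> ideal_product l (\<lambda>i. (Q(l := P)) i ^\<^sub>R (e(l := 1)) i)"
      using idQ ideal_iprod[OF ideal_R idP] by (subst ideal_product_Suc) (auto simp: less_Suc_eq)
    also have "ideal_product l (\<lambda>i. (Q(l := P)) i ^\<^sub>R (e(l := 1)) i) = J"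
      unfolding J using idQ by (intro ideal_product_cong) auto
    also have "P ^\<^sub>R 1 = P" using ideals.nat_pow_Suc[of P 0] ideals.nat_pow_0[of P]
        A.ideal_prod_commute[OF ideal_R idP] A.ideal_prod_one[OF idP] by simp
    also have "P \<star> J = M" using PJ(4) ..
    finally have "M = ideal_product (Suc l) (\<lambda>i. (Q(l := P)) i ^\<^sub>R (e(l := 1)) i)" ..
    moreover have "inj_on (Q(l := P)) {..<Suc l}"
      using False Q(3) unfolding lessThan_Suc by (auto simp: inj_on_def)
    moreover have "\<forall>i<Suc l. nonzero_prime ((Q(l := P)) i) \<and> 0 < (e(l := 1)) i"
      using Q(1,2) PJ(1) by (auto simp: less_Suc_eq)
    ultimately show ?thesis unfolding good_def by blast
  qed
  with bad show False ..
qed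

section \<open>Comaximal ideals and the stable range\<close>

definition comaximal :: "'k set \<Rightarrow> 'k set \<Rightarrow> bool"
  where "comaximal I J \<longleftrightarrow> (\<exists>x\<in>I. \<exists>y\<in>J. x + y = 1)"

lemma comaximal_sym: "comaximal I J \<Longrightarrow> comaximal J I"
  unfolding comaximal_def by (metis add.commute)

lemma comaximal_R: "ideal_of_R I \<Longrightarrow> comaximal I R"
  unfolding comaximal_def using idealD(2)[of I] by force

lemma comaximal_iprod:
  assumes I: "ideal_of_R I" and J: "ideal_of_R J" "ideal_of_R J'" "comaximal I J" "comaximal I J'"
  shows "comaximal I (J \<star> J')"
proof -
  obtain x y x' y' where xy: "x \<in> I" "y \<in> J" "x + y = 1" "x' \<in> I" "y' \<in> J'" "x' + y' = 1"
    using J(3,4) unfolding comaximal_def by blast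
  have R: "x' \<in> R" "y \<in> R" using xy idealD(1)[OF I] idealD(1)[OF J(1)] by auto
  have "1 = (x + y) * (x' + y')" using xy(3,6) by simp
  also have "\<dots> = (x * (x' + y') + y * x') + y * y'" by (simp add: algebra_simps)
  finally have "(x + y * x') + y * y' = 1" using xy(6) by simp
  moreover have "x + y * x' \<in> I"
    by (rule idealD(3)[OF I xy(1) idealD(4)[OF I R(2) xy(4)]])
  ultimately show ?thesis unfolding comaximal_def using iprodI[OF xy(2,5)] by blast
qed

lemma comaximal_power:
  assumes I: "ideal_of_R I" "ideal_of_R J" "comaximal I J" shows "comaximal I (J ^\<^sub>R e)"
proof (induct e)
  case 0 then show ?case using comaximal_R[OF I(1)] ideals.nat_pow_0 by simp
next
  case (Suc e)
  then show ?case using comaximal_iprod[OF I(1) ideal_ideal_power[OF I(2)] I(2) Suc I(3)] by simp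
qed

lemma comaximal_product:
  assumes I: "ideal_of_R I" "\<And>i. i < l \<Longrightarrow> ideal_of_R (J i)" "\<And>i. i < l \<Longrightarrow> comaximal I (J i)"
  shows "comaximal I (ideal_product l J)"
  using I(2,3)
proof (induct l)
  case 0 then show ?case using comaximal_R[OF I(1)] by simp
next
  case (Suc l)
  then have "comaximal I (ideal_product l J)" by simp
  moreover have "ideal_of_R (ideal_product l J)" using Suc by (intro ideal_ideal_product) simp
  ultimately show ?case using comaximal_iprod[OF I(1), of "J l" "ideal_product l J"] Suc
    by (subst ideal_product_Suc) simp_all
qed

lemma comaximal_primes:
  assumes P: "nonzero_prime P" "nonzero_prime Q" "P \<noteq> Q"
  shows "comaximal P Q"
proof -
  note idP = primeD(1)[OF conjunct1[OF P(1)]] and idQ = primeD(1)[OF conjunct1[OF P(2)]]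
  let ?J = "{x + y |x y. x \<in> P \<and> y \<in> Q}"
  have J: "ideal_of_R ?J" by (rule ideal_add[OF idP idQ])
  have "P \<subseteq> ?J"
  proof
    fix x assume "x \<in> P"
    then have "x + 0 \<in> ?J" using idealD(2)[OF idQ] by blast
    then show "x \<in> ?J" by simp
  qed
  then have *: "?J = P \<or> ?J = R" by (rule nonzero_prime_maximal[OF P(1) J])
  have "Q \<subseteq> ?J"
  proof
    fix y assume "y \<in> Q"
    then have "0 + y \<in> ?J" using idealD(2)[OF idP] by blast
    then show "y \<in> ?J" by simp
  qed
  have "?J \<noteq> P"
  proof
    assume "?J = P"
    then have "Q \<subseteq> P" using \<open>Q \<subseteq> ?J\<close> by simp
    then have "P = Q \<or> P = R" by (rule nonzero_prime_maximal[OF P(2) idP])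
    then show False using P(3) primeD(2)[of P] P(1) one_R by auto
  qed
  then have "1 \<in> ?J" using * one_R by simp
  then obtain x y where "1 = x + y" "x \<in> P" "y \<in> Q" by (elim CollectE exE conjE)
  then show ?thesis unfolding comaximal_def by metis
qed

text \<open>Both parts are proved together, by induction on \<open>l\<close>: the second one identifies the product of the first
\<open>l\<close> ideals with their intersection, and this product is comaximal with the next ideal.\<close>

lemma chinese_remainder:
  assumes I: "\<And>i. i < l \<Longrightarrow> ideal_of_R (I i)"
    and comax: "\<And>i j. i < l \<Longrightarrow> j < l \<Longrightarrow> i \<noteq> j \<Longrightarrow> comaximal (I i) (I j)"
  shows "(\<forall>i<l. y i \<in> R) \<Longrightarrow> \<exists>x\<in>R. \<forall>i<l. x - y i \<in> I i"
    and "ideal_product l I = {x \<in> R. \<forall>i<l. x \<in> I i}"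
  using assms
proof (induct l)
  case 0
  { case 1 then show ?case by auto next case 2 then show ?case by simp }
next
  case (Suc l)
  have idp: "ideal_of_R (ideal_product l I)" if "\<And>i. i < Suc l \<Longrightarrow> ideal_of_R (I i)"
    using that by (intro ideal_ideal_product) simp
  have co: "comaximal (I l) (ideal_product l I)"
    if "\<And>i. i < Suc l \<Longrightarrow> ideal_of_R (I i)" "\<And>i j. i < Suc l \<Longrightarrow> j < Suc l \<Longrightarrow> i \<noteq> j \<Longrightarrow> comaximal (I i) (I j)"
    using that by (intro comaximal_product) auto
  {
    case 1
    have eq: "ideal_product l I = {x \<in> R. \<forall>i<l. x \<in> I i}" using 1 by (intro Suc(2)) auto
    have "\<exists>x\<in>R. \<forall>i<l. x - y i \<in> I i" using 1 by (intro Suc(1)) auto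
    then obtain x where x: "x \<in> R" "\<And>i. i < l \<Longrightarrow> x - y i \<in> I i" by auto
    obtain u v where uv: "u \<in> I l" "v \<in> ideal_product l I" "u + v = 1"
      using co[OF 1(2,3)] unfolding comaximal_def by blast
    have idl: "ideal_of_R (I l)" using 1(2) by simp
    have R: "u \<in> R" "v \<in> R" "y l \<in> R" using uv eq idealD(1)[OF idl] 1(1) by auto
    have "x + (y l - x) * v \<in> R" using R x(1) by (intro add_R mult_R diff_R)
    moreover have "x + (y l - x) * v - y i \<in> I i" if i: "i < Suc l" for i
    proof (cases "i = l")
      case True
      have "x + (y l - x) * v - y l = (x - y l) * (u + v) - (x - y l) * v" unfolding uv(3) by (simp add: algebra_simps)
      also have "\<dots> = (x - y l) * u" by (simp add: algebra_simps)
      also have "\<dots> \<in> I l" using R x(1) by (intro idealD(4)[OF idl _ uv(1)] diff_R)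
      finally show ?thesis using True by simp
    next
      case False
      then have il: "i < l" using i by simp
      have idi: "ideal_of_R (I i)" using 1(2) i by simp
      have "v \<in> I i" using uv(2) eq il by auto
      then have "(y l - x) * v \<in> I i" using R x(1) by (intro idealD(4)[OF idi] diff_R)
      from idealD(3)[OF idi x(2)[OF il] this]
      show ?thesis by (simp add: algebra_simps)
    qed
    ultimately show ?case by blast
  next
    case 2
    have eq: "ideal_product l I = {x \<in> R. \<forall>i<l. x \<in> I i}" using 2 by (intro Suc(2)) auto
    have idl: "ideal_of_R (I l)" using 2(1) by simp
    have idp': "ideal_of_R (ideal_product l I)" using 2(1) by (rule idp)
    note idlp = ideal_iprod[OF idl idp']
    obtain u v where uv: "u \<in> I l" "v \<in> ideal_product l I" "u + v = 1"
      using co[OF 2] unfolding comaximal_def by blast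
    have "ideal_product (Suc l) I = I l \<star> ideal_product l I" using 2(1) by (rule ideal_product_Suc)
    also have "\<dots> = I l \<inter> ideal_product l I"
    proof
      show "I l \<star> ideal_product l I \<subseteq> I l \<inter> ideal_product l I" by (rule iprod_subset_Int[OF idl idp[OF 2(1)]])
      show "I l \<inter> ideal_product l I \<subseteq> I l \<star> ideal_product l I"
      proof
        fix x assume x: "x \<in> I l \<inter> ideal_product l I"
        have "u * x \<in> I l \<star> ideal_product l I" using x uv(1) by (intro iprodI) auto
        moreover have "x * v \<in> I l \<star> ideal_product l I" using x uv(2) by (intro iprodI) auto
        ultimately have "u * x + x * v \<in> I l \<star> ideal_product l I"
          using idealD(3)[OF idlp] by simp
        moreover have "u * x + x * v = (u + v) * x" by (simp add: algebra_simps)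
        ultimately show "x \<in> I l \<star> ideal_product l I" unfolding uv(3) by simp
      qed
    qed
    also have "\<dots> = {x \<in> R. \<forall>i<Suc l. x \<in> I i}"
      unfolding eq using less_Suc_eq by auto
    finally show ?case .
  }
qed

lemma prime_power_decomposition:
  assumes "ideal_of_R I" "I \<noteq> {0}"
  obtains l P e where "\<And>i. i < l \<Longrightarrow> nonzero_prime (P i)" "\<And>i. i < l \<Longrightarrow> 0 < (e i :: nat)"
    "\<And>i. i < l \<Longrightarrow> ideal_of_R (P i ^\<^sub>R e i)"
    "\<And>i j. i < l \<Longrightarrow> j < l \<Longrightarrow> i \<noteq> j \<Longrightarrow> comaximal (P i ^\<^sub>R e i) (P j ^\<^sub>R e j)"
    "I = ideal_product l (\<lambda>i. P i ^\<^sub>R e i)"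
proof -
  obtain l P e where P: "\<And>i. i < l \<Longrightarrow> nonzero_prime (P i)" "\<And>i. i < l \<Longrightarrow> 0 < (e i :: nat)"
    "inj_on P {..<l}" "I = ideal_product l (\<lambda>i. P i ^\<^sub>R e i)"
    using prime_factorization[OF assms] by (elim exE conjE) blast
  have id: "ideal_of_R (P i)" if "i < l" for i using P(1)[OF that] primeD(1) by simp
  have "comaximal (P i ^\<^sub>R e i) (P j ^\<^sub>R e j)" if "i < l" "j < l" "i \<noteq> j" for i j
  proof -
    have "comaximal (P i) (P j)" using that P(3) by (intro comaximal_primes P(1)) (auto simp: inj_on_def)
    then have "comaximal (P i) (P j ^\<^sub>R e j)" using id that by (intro comaximal_power)
    then have "comaximal (P j ^\<^sub>R e j) (P i)" by (rule comaximal_sym)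
    then have "comaximal (P j ^\<^sub>R e j) (P i ^\<^sub>R e i)" using id that by (intro comaximal_power ideal_ideal_power)
    then show ?thesis by (rule comaximal_sym)
  qed
  with P(1,2) ideal_ideal_power[OF id] show thesis using P(4) by (rule that)
qed

lemma ideal_product_subset_prime:
  assumes Q: "primeideal Q (ring_on R)" and I: "\<And>i. i < l \<Longrightarrow> ideal_of_R (I i)" and "ideal_product l I \<subseteq> Q"
  shows "\<exists>i<l. I i \<subseteq> Q"
  using I assms(3)
proof (induct l)
  case 0 then show ?case using primeD(2)[OF Q] one_R by auto
next
  case (Suc l)
  have "I l \<star> ideal_product l I \<subseteq> Q" using Suc ideal_product_Suc[of l I] by simp
  then have "I l \<subseteq> Q \<or> ideal_product l I \<subseteq> Q"
    using Suc(2) by (intro prime_iprod[OF Q] ideal_ideal_product) auto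
  then show ?case using Suc less_Suc_eq by metis
qed

lemma power_subset_prime:
  assumes Q: "primeideal Q (ring_on R)" and I: "ideal_of_R I" "I ^\<^sub>R e \<subseteq> Q"
  shows "I \<subseteq> Q"
  using I(2)
proof (induct e)
  case 0 then show ?case using primeD(2)[OF Q] one_R by auto
next
  case (Suc e)
  then have "I ^\<^sub>R e \<subseteq> Q \<or> I \<subseteq> Q"
    using prime_iprod[OF Q ideal_ideal_power[OF I(1)] I(1), of e] by simp
  then show ?case using Suc(1) by metis
qed

lemma power_subset: "ideal_of_R I \<Longrightarrow> 0 < e \<Longrightarrow> I ^\<^sub>R e \<subseteq> I"
  using iprod_subset_Int[OF ideal_ideal_power, of I I "e - 1"] ideals.nat_pow_Suc[of I "e - 1"] by auto

text \<open>Only the finitely many primes \<open>P\<^sub>i\<close> in the factorization of \<open>(d)\<close> contain \<open>d\<close>. Choose \<open>t\<close> congruent to \<open>1\<close>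
modulo \<open>P\<^sub>i\<close> if \<open>a \<in> P\<^sub>i\<close>, and to \<open>0\<close> otherwise. In the first case \<open>b \<notin> P\<^sub>i\<close>, so in both cases \<open>a + tb \<notin> P\<^sub>i\<close>.\<close>

lemma stable_range:
  assumes d: "d \<in> R" "d \<noteq> 0" and ab: "a \<in> R" "b \<in> R"
    and unimod: "u \<in> R" "v \<in> R" "w \<in> R" "a * u + b * v + d * w = 1"
  obtains t s z where "t \<in> R" "s \<in> R" "z \<in> R" "(a + t * b) * s + d * z = 1"
proof -
  obtain l P e where P: "\<And>i. i < l \<Longrightarrow> nonzero_prime (P i)" "\<And>i. i < l \<Longrightarrow> 0 < (e i :: nat)"
    "\<And>i. i < l \<Longrightarrow> ideal_of_R (P i ^\<^sub>R e i)"
    "\<And>i j. i < l \<Longrightarrow> j < l \<Longrightarrow> i \<noteq> j \<Longrightarrow> comaximal (P i ^\<^sub>R e i) (P j ^\<^sub>R e j)"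
    and dP: "(*) d ` R = ideal_product l (\<lambda>i. P i ^\<^sub>R e i)"
    using prime_power_decomposition[OF ideal_principal[OF d(1)] principal_nonzero[OF d(2)]] by blast
  have idP: "ideal_of_R (P i)" if "i < l" for i using P(1)[OF that] primeD(1) by simp
  have Psub: "P i ^\<^sub>R e i \<subseteq> P i" if "i < l" for i using power_subset[OF idP[OF that] P(2)[OF that]] .
  have "\<exists>t\<in>R. \<forall>i<l. t - (if a \<in> P i then 1 else 0) \<in> P i ^\<^sub>R e i"
    by (rule chinese_remainder(1)[OF P(3,4)]) auto
  then obtain t where t: "t \<in> R" "\<And>i. i < l \<Longrightarrow> t - (if a \<in> P i then 1 else 0) \<in> P i" using Psub by blast
  have dPi: "d \<in> P i" if i: "i < l" for i
  proof -
    have "d * 1 \<in> (*) d ` R" using one_R by blast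
    then show ?thesis using Psub[OF i] i chinese_remainder(2)[OF P(3,4)] unfolding dP by auto
  qed
  define J where "J = {x + y |x y. x \<in> (*) (a + t * b) ` R \<and> y \<in> (*) d ` R}"
  have atb: "a + t * b \<in> R" using ab t(1) by (intro add_R mult_R)
  have J: "ideal_of_R J" unfolding J_def by (intro ideal_add ideal_principal atb d(1))
  have JI: "(a + t * b) * x + d * y \<in> J" if "x \<in> R" "y \<in> R" for x y using that unfolding J_def by blast
  have "J = R"
  proof (rule ccontr)
    assume "J \<noteq> R"
    then obtain Q where Q: "primeideal Q (ring_on R)" "J \<subseteq> Q" using exists_prime_above[OF J] by metis
    note idQ = primeD(1)[OF Q(1)]
    have "(*) d ` R \<subseteq> Q"
    proof
      fix z assume "z \<in> (*) d ` R"
      then obtain y where "z = d * y" "y \<in> R" by (elim imageE)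
      then show "z \<in> Q" using JI[of 0 y] Q(2) by auto
    qed
    then obtain i where i: "i < l" "P i ^\<^sub>R e i \<subseteq> Q"
      using ideal_product_subset_prime[OF Q(1), of l "\<lambda>i. P i ^\<^sub>R e i"] P(3) unfolding dP by auto
    then have "P i \<subseteq> Q" using power_subset_prime[OF Q(1) idP] by simp
    then have "Q = P i \<or> Q = R" by (rule nonzero_prime_maximal[OF P(1)[OF i(1)] idQ])
    then have QP: "Q = P i" using primeD(2)[OF Q(1)] one_R by auto
    have in1: "a + t * b \<in> P i" using JI[of 1 0] Q(2) QP by auto
    have aP: "a \<in> P i"
    proof (rule ccontr)
      assume na: "a \<notin> P i"
      then have "t \<in> P i" using t(2)[OF i(1)] by simp
      then have "t * b \<in> P i" using ab idealD(5)[OF idP[OF i(1)]] by simp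
      from ideal_diff[OF idP[OF i(1)] in1 this] show False using na by simp
    qed
    then have "t - 1 \<in> P i" using t(2)[OF i(1)] by simp
    then have "(t - 1) * b \<in> P i" using ab idealD(5)[OF idP[OF i(1)]] by simp
    from ideal_diff[OF idP[OF i(1)] ideal_diff[OF idP[OF i(1)] in1 aP] this]
    have bP: "b \<in> P i" by (simp add: algebra_simps)
    have "a * u + b * v + d * w \<in> P i"
      using unimod aP bP dPi[OF i(1)] by (intro idealD(3)[OF idP[OF i(1)]] idealD(5)[OF idP[OF i(1)]])
    then show False using unimod(4) primeD(2)[of "P i"] P(1)[OF i(1)] by simp
  qed
  then have "1 \<in> J" using one_R by simp
  then obtain s z where "s \<in> R" "z \<in> R" "(a + t * b) * s + d * z = 1" unfolding J_def by auto
  then show thesis using that t(1) by blast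
qed

end

section \<open>Products of ideals and determinants\<close>

lemma det_unit_triangular:
  assumes "T \<in> carrier_mat N N" "\<And>i. i < N \<Longrightarrow> T $$ (i, i) = 1"
    and "(\<forall>i j. i < j \<and> j < N \<longrightarrow> T $$ (i, j) = 0) \<or> (\<forall>i j. j < i \<and> i < N \<longrightarrow> T $$ (i, j) = 0)"
  shows "det T = 1"
proof -
  have "diag_mat T = map (\<lambda>_. 1) [0..<N]"
    unfolding diag_mat_def using assms(1,2) by (intro map_cong) auto
  then have "prod_list (diag_mat T) = 1" by (simp add: map_replicate_const)
  moreover have "det T = prod_list (diag_mat T)"
    using assms(3)
  proof
    assume "\<forall>i j. i < j \<and> j < N \<longrightarrow> T $$ (i, j) = 0"
    then show ?thesis by (intro det_lower_triangular[OF _ assms(1)]) simp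
  next
    assume "\<forall>i j. j < i \<and> i < N \<longrightarrow> T $$ (i, j) = 0"
    then show ?thesis using assms(1) by (intro det_upper_triangular[OF _ assms(1)]) auto
  qed
  ultimately show ?thesis by simp
qed

lemma mult_mat_vec_nth:
  assumes "A \<in> carrier_mat N N" "x \<in> carrier_vec N" "i < N"
  shows "(A *\<^sub>v x) $ i = (\<Sum>j = 0..<N. A $$ (i, j) * x $ j)"
  using assms by (auto simp: scalar_prod_def intro: sum.cong)

context dedekind begin

lemma prod_mem_ideal_product:
  assumes "\<And>k. k < N \<Longrightarrow> ideal_of_R (K k)" "\<And>k. k < N \<Longrightarrow> x k \<in> K k"
  shows "(\<Prod>k<N. x k) \<in> ideal_product N K"
  using assms
proof (induct N)
  case (Suc N)
  have "x N * (\<Prod>k<N. x k) \<in> K N \<star> ideal_product N K" using Suc by (intro iprodI) auto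
  then show ?case using ideal_product_Suc[OF Suc(2)] by (simp add: mult.commute)
qed simp

text \<open>The products \<open>x\<^sub>0\<cdots>x\<^sub>N\<^sub>-\<^sub>1\<close> with \<open>x\<^sub>k \<in> K\<^sub>k\<close> generate the product of the ideals \<open>K\<^sub>k\<close>.\<close>

lemma ideal_product_subset:
  assumes "\<And>k. k < N \<Longrightarrow> ideal_of_R (K k)" "ideal_of_R S"
    and "\<And>x. (\<And>k. k < N \<Longrightarrow> x k \<in> K k) \<Longrightarrow> (\<Prod>k<N. x k) \<in> S"
  shows "ideal_product N K \<subseteq> S"
  using assms
proof (induct N arbitrary: S)
  case 0
  then have "1 \<in> S" by simp
  then show ?case using ideal_eq_R[OF 0(2)] by simp
next
  case (Suc N)
  have "K N \<star> ideal_product N K \<subseteq> S"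
  proof (rule iprod_subset[OF Suc(3)])
    fix z y assume z: "z \<in> K N" and y: "y \<in> ideal_product N K"
    have zR: "z \<in> R" using z idealD(1)[OF Suc(2)[of N]] by auto
    \<comment> \<open>For fixed \<open>z\<close> the elements that \<open>z\<close> multiplies into \<open>S\<close> form an ideal, to which the induction
      hypothesis applies.\<close>
    define S' where "S' = {y \<in> R. z * y \<in> S}"
    have "ideal_of_R S'"
      unfolding ideal_iff
    proof (intro conjI ballI)
      show "0 \<in> S'" using idealD(2)[OF Suc(3)] unfolding S'_def by simp
      show "S' \<subseteq> R" unfolding S'_def by auto
      show "x + y \<in> S'" if "x \<in> S'" "y \<in> S'" for x y
        using that idealD(3)[OF Suc(3), of "z * x" "z * y"] add_R unfolding S'_def by (simp add: distrib_left)
      show "r * x \<in> S'" if "x \<in> S'" "r \<in> R" for x r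
        using that idealD(4)[OF Suc(3), of r "z * x"] mult_R unfolding S'_def by (simp add: mult.left_commute)
    qed
    moreover have "(\<Prod>k<N. x k) \<in> S'" if x: "\<And>k. k < N \<Longrightarrow> x k \<in> K k" for x
    proof -
      have "(\<Prod>k<Suc N. (x(N := z)) k) \<in> S" using x z by (intro Suc(4)) (auto simp: less_Suc_eq)
      moreover have "(\<Prod>k<Suc N. (x(N := z)) k) = z * (\<Prod>k<N. x k)" by (simp add: mult.commute)
      moreover have "x k \<in> R" if "k < N" for k
        using x[OF that] idealD(1)[OF Suc(2)[of k]] that by auto
      then have "(\<Prod>k<N. x k) \<in> R" by (intro prod_R) simp
      ultimately show ?thesis unfolding S'_def by (simp del: prod.lessThan_Suc)
    qed
    ultimately have "ideal_product N K \<subseteq> S'" using Suc(2) by (intro Suc(1)) auto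
    then show "z * y \<in> S" using y unfolding S'_def by auto
  qed
  then show ?case using ideal_product_Suc[OF Suc(2)] by simp
qed

lemma ideal_product_append:
  assumes "\<And>k. k < n + l \<Longrightarrow> ideal_of_R (K k)"
  shows "ideal_product (n + l) K = ideal_product n K \<star> ideal_product l (\<lambda>i. K (n + i))"
  using assms
proof (induct l)
  case 0
  have "ideal_of_R (ideal_product n K)" using 0 by (intro ideal_ideal_product) simp
  from A.ideal_prod_one[OF this] show ?case by simp
next
  case (Suc l)
  have i: "ideal_of_R (ideal_product n K)" "ideal_of_R (ideal_product l (\<lambda>i. K (n + i)))" "ideal_of_R (K (n + l))"
    using Suc(2) by (auto intro!: ideal_ideal_product)
  have "ideal_product (n + Suc l) K = K (n + l) \<star> ideal_product (n + l) K"
    using ideal_product_Suc[of "n + l" K] Suc(2) by simp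
  also have "ideal_product (n + l) K = ideal_product n K \<star> ideal_product l (\<lambda>i. K (n + i))" using Suc by simp
  also have "K (n + l) \<star> \<dots> = ideal_product n K \<star> (K (n + l) \<star> ideal_product l (\<lambda>i. K (n + i)))"
    using A.ideal_prod_assoc[OF i(3,1,2)] A.ideal_prod_assoc[OF i(1,3,2)] A.ideal_prod_commute[OF i(1,3)] by simp
  also have "K (n + l) \<star> ideal_product l (\<lambda>i. K (n + i)) = ideal_product (Suc l) (\<lambda>i. K (n + i))"
    using ideal_product_Suc[of l "\<lambda>i. K (n + i)"] Suc(2) by simp
  finally show ?case .
qed

lemma ideal_product_R: "ideal_product l (\<lambda>_. R) = R"
proof -
  have "ideal_product l (\<lambda>_. R) = ideal_product l (\<lambda>i. one (ideals_set (ring_on R)))" by simp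
  then show ?thesis using ideals.finprod_one by simp
qed

text \<open>A generator \<open>x\<^sub>0\<cdots>x\<^sub>N\<^sub>-\<^sub>1\<close> of the product of the \<open>K\<^sub>k\<close> is the determinant of a diagonal matrix with columns in
\<open>\<Oplus>\<^sub>k K\<^sub>k\<close>. Multiplication by \<open>T\<close> preserves the determinant and moves the columns into \<open>\<Oplus>\<^sub>k K'\<^sub>k\<close>; then every
term of the Leibniz formula lies in the product of the \<open>K'\<^sub>k\<close>.\<close>

lemma ideal_product_mono_unimodular:
  assumes T: "T \<in> carrier_mat N N" "det T = 1"
    and K: "\<And>k. k < N \<Longrightarrow> ideal_of_R (K k)" and K': "\<And>k. k < N \<Longrightarrow> ideal_of_R (K' k)"
    and TK: "\<And>x. x \<in> carrier_vec N \<Longrightarrow> (\<And>i. i < N \<Longrightarrow> x $ i \<in> K i) \<Longrightarrow> (\<And>i. i < N \<Longrightarrow> (T *\<^sub>v x) $ i \<in> K' i)"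
  shows "ideal_product N K \<subseteq> ideal_product N K'"
proof (rule ideal_product_subset[OF K ideal_ideal_product[OF K']])
  fix x assume x: "\<And>k. k < N \<Longrightarrow> x k \<in> K k"
  define D where "D = mat N N (\<lambda>(i, k). if i = k then x k else 0)"
  have D: "D \<in> carrier_mat N N" unfolding D_def by simp
  have "det D = (\<Prod>k<N. x k)"
  proof -
    have "upper_triangular D" unfolding D_def by auto
    then have "det D = prod_list (diag_mat D)" using D by (rule det_upper_triangular)
    also have "diag_mat D = map x [0..<N]" unfolding diag_mat_def D_def by (auto intro: map_cong)
    also have "prod_list \<dots> = (\<Prod>k<N. x k)" 
      by (subst prod.distinct_set_conv_list[symmetric]) (auto simp: atLeast0LessThan)
    finally show ?thesis .
  qed
  then have "(\<Prod>k<N. x k) = det (T * D)" using det_mult[OF T(1) D] T(2) by simp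
  also have "\<dots> = (\<Sum>p | p permutes {0..<N}. of_int (sign p) * (\<Prod>i = 0..<N. (T * D) $$ (i, p i)))"
    using T(1) D by (intro det_def') auto
  also have "\<dots> \<in> ideal_product N K'"
  proof (rule ideal_sum[OF ideal_ideal_product[OF K']], assumption)
    fix p assume "p \<in> {p. p permutes {0..<N}}"
    then have p: "p permutes {0..<N}" by simp
    have "(T * D) $$ (i, p i) \<in> K' i" if i: "i < N" for i
    proof -
      have pi: "p i < N" using permutes_in_image[OF p, of i] i by simp
      have "(T * D) $$ (i, p i) = (T *\<^sub>v col D (p i)) $ i" using i pi T(1) D by simp
      also have "\<dots> \<in> K' i"
      proof (rule TK)
        show "col D (p i) \<in> carrier_vec N" using D by (simp add: carrier_vecI)
        show "col D (p i) $ j \<in> K j" if j: "j < N" for j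
          using j pi x[OF j] idealD(2)[OF K[OF j]] unfolding D_def by (cases "j = p i") simp_all
      qed (rule i)
      finally show ?thesis .
    qed
    then have "(\<Prod>i = 0..<N. (T * D) $$ (i, p i)) \<in> ideal_product N K'"
      using prod_mem_ideal_product[OF K', of N _ "\<lambda>i. (T * D) $$ (i, p i)"] by (simp add: atLeast0LessThan)
    moreover have "of_int (sign p) = (1 :: 'k) \<or> of_int (sign p) = (-1 :: 'k)"
      unfolding sign_def by simp
    ultimately show "of_int (sign p) * (\<Prod>i = 0..<N. (T * D) $$ (i, p i)) \<in> ideal_product N K'"
      using ideal_uminus[OF ideal_ideal_product[OF K']] by auto
  qed
  finally show "(\<Prod>k<N. x k) \<in> ideal_product N K'" .
qed

text \<open>The product of the ideals in a decomposition \<open>\<Oplus>\<^sub>k R/I\<^sub>k\<close> depends on the module only. Here \<open>a\<close> represents an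
isomorphism onto \<open>\<Oplus>\<^sub>i R/J\<^sub>i\<close> and \<open>b\<close> a right inverse of it. The submodule \<open>{(x, y). ax + y \<in> \<Oplus>J}\<close> of
\<open>R\<^sup>n\<^sup>+\<^sup>l\<close> is mapped onto \<open>R\<^sup>n \<oplus> (\<Oplus>J)\<close> by the shear \<open>(x, y) \<mapsto> (x, ax + y)\<close>, and onto \<open>(\<Oplus>I) \<oplus> R\<^sup>l\<close> by the
shear \<open>(x, y) \<mapsto> (x + by, y)\<close>. Shears have determinant one, so \<open>ideal_product_mono_unimodular\<close> gives both
inclusions.\<close>

lemma ideal_product_invariant:
  fixes a b :: "nat \<Rightarrow> nat \<Rightarrow> 'k"
  assumes I: "\<And>k. k < n \<Longrightarrow> ideal_of_R (I k)" and J: "\<And>i. i < l \<Longrightarrow> ideal_of_R (J i)"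
    and a: "\<And>i k. i < l \<Longrightarrow> k < n \<Longrightarrow> a i k \<in> R" and b: "\<And>k i. k < n \<Longrightarrow> i < l \<Longrightarrow> b k i \<in> R"
    and ker: "\<And>x. (\<And>k. k < n \<Longrightarrow> x k \<in> R) \<Longrightarrow>
      (\<forall>k<n. x k \<in> I k) \<longleftrightarrow> (\<forall>i<l. (\<Sum>k<n. a i k * x k) \<in> J i)"
    and ab: "\<And>i j. i < l \<Longrightarrow> j < l \<Longrightarrow> (\<Sum>k<n. a i k * b k j) - (if i = j then 1 else 0) \<in> J i"
  shows "ideal_product n I = ideal_product l J"
proof -
  define N where "N = n + l"
  \<comment> \<open>The two shears for \<open>s = 1\<close>, and their inverses for \<open>s = -1\<close>.\<close>
  define S where "S = (\<lambda>s::'k. mat N N (\<lambda>(i, k). if i = k then 1 else if n \<le> i \<and> k < n then s * a (i - n) k else 0))"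
  define U where "U = (\<lambda>s::'k. mat N N (\<lambda>(i, k). if i = k then 1 else if i < n \<and> n \<le> k then s * b i (k - n) else 0))"
  have carr: "S s \<in> carrier_mat N N" "U s \<in> carrier_mat N N" for s unfolding S_def U_def by auto
  have det: "det (S s) = 1" "det (U s) = 1" for s
    by (rule det_unit_triangular[OF carr(1)], (auto simp: S_def)[2])
      (rule det_unit_triangular[OF carr(2)], (auto simp: U_def)[2])
  have split: "(\<Sum>k = 0..<N. f k) = (\<Sum>k<n. f k) + (\<Sum>i<l. f (n + i))" for f :: "nat \<Rightarrow> 'k"
  proof -
    have "(\<Sum>k = 0..<N. f k) = (\<Sum>k = 0..<n. f k) + (\<Sum>k = n..<n + l. f k)"
      unfolding N_def by (subst sum.atLeastLessThan_concat) auto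
    also have "(\<Sum>k = n..<n + l. f k) = (\<Sum>i = 0..<l. f (n + i))"
      using sum.shift_bounds_nat_ivl[of f 0 n l] by (simp add: add.commute)
    finally show ?thesis by (simp add: atLeast0LessThan)
  qed
  have S1: "(S s *\<^sub>v x) $ k = x $ k" if "k < n" "x \<in> carrier_vec N" for s x k
  proof -
    have "(S s *\<^sub>v x) $ k = (\<Sum>j = 0..<N. S s $$ (k, j) * x $ j)"
      using that by (intro mult_mat_vec_nth carr) (auto simp: N_def)
    also have "\<dots> = (\<Sum>j = 0..<N. if j = k then x $ k else 0)"
      using that unfolding S_def N_def by (intro sum.cong) auto
    finally show ?thesis using that unfolding N_def by simp
  qed
  have S2: "(S s *\<^sub>v x) $ (n + i) = x $ (n + i) + s * (\<Sum>k<n. a i k * x $ k)" if "i < l" "x \<in> carrier_vec N" for s x i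
  proof -
    have "(S s *\<^sub>v x) $ (n + i) = (\<Sum>j = 0..<N. S s $$ (n + i, j) * x $ j)"
      using that by (intro mult_mat_vec_nth carr) (auto simp: N_def)
    also have "\<dots> = (\<Sum>k<n. s * (a i k * x $ k)) + (\<Sum>j<l. if j = i then x $ (n + i) else 0)"
      unfolding split using that unfolding S_def N_def by (intro arg_cong2[where f = "(+)"] sum.cong) auto
    finally show ?thesis using that by (simp add: sum_distrib_left add.commute)
  qed
  have U1: "(U s *\<^sub>v x) $ k = x $ k + s * (\<Sum>i<l. b k i * x $ (n + i))" if "k < n" "x \<in> carrier_vec N" for s x k
  proof -
    have "(U s *\<^sub>v x) $ k = (\<Sum>j = 0..<N. U s $$ (k, j) * x $ j)"
      using that by (intro mult_mat_vec_nth carr) (auto simp: N_def)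
    also have "\<dots> = (\<Sum>j<n. if j = k then x $ k else 0) + (\<Sum>i<l. s * (b k i * x $ (n + i)))"
      unfolding split using that unfolding U_def N_def by (intro arg_cong2[where f = "(+)"] sum.cong) auto
    finally show ?thesis using that by (simp add: sum_distrib_left)
  qed
  have U2: "(U s *\<^sub>v x) $ (n + i) = x $ (n + i)" if "i < l" "x \<in> carrier_vec N" for s x i
  proof -
    have "(U s *\<^sub>v x) $ (n + i) = (\<Sum>j = 0..<N. U s $$ (n + i, j) * x $ j)"
      using that by (intro mult_mat_vec_nth carr) (auto simp: N_def)
    also have "\<dots> = (\<Sum>j = 0..<N. if j = n + i then x $ (n + i) else 0)"
      using that unfolding U_def N_def by (intro sum.cong) auto
    finally show ?thesis using that unfolding N_def by simp
  qed
  have aby: "(\<Sum>k<n. a i k * (\<Sum>j<l. b k j * y j)) - y i \<in> J i"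
    if i: "i < l" and y: "\<And>j. j < l \<Longrightarrow> y j \<in> R" for i y
  proof -
    have "(\<Sum>k<n. a i k * (\<Sum>j<l. b k j * y j)) = (\<Sum>j<l. (\<Sum>k<n. a i k * b k j) * y j)"
      unfolding sum_distrib_left sum_distrib_right by (subst sum.swap) (simp add: mult.assoc)
    moreover have "y i = (\<Sum>j<l. (if i = j then 1 else 0) * y j)" using i by (simp add: if_distrib[of "\<lambda>z. z * _"] cong: if_cong)
    ultimately have "(\<Sum>k<n. a i k * (\<Sum>j<l. b k j * y j)) - y i =
      (\<Sum>j<l. ((\<Sum>k<n. a i k * b k j) - (if i = j then 1 else 0)) * y j)"
      by (simp only: sum_subtractf[symmetric] left_diff_distrib)
    also have "\<dots> \<in> J i" using ab[OF i] y by (intro ideal_sum[OF J[OF i]] idealD(5)[OF J[OF i]]) auto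
    finally show ?thesis .
  qed
  define K where "K i = (if i < n then I i else R)" for i
  define K' where "K' i = (if i < n then R else J (i - n))" for i
  have K: "ideal_of_R (K i)" if "i < N" for i using that I ideal_R unfolding K_def by simp
  have K': "ideal_of_R (K' i)" if "i < N" for i using that J ideal_R unfolding K'_def N_def by simp
  have ideal_in_R: "z \<in> R" if "z \<in> I k" "k < n" for z k using idealD(1)[OF I[OF that(2)]] that(1) by auto
  have ideal_in_R': "z \<in> R" if "z \<in> J k" "k < l" for z k using idealD(1)[OF J[OF that(2)]] that(1) by auto
  have idx: "i < n \<or> (\<exists>i'<l. i = n + i')" if "i < N" for i
    using that unfolding N_def by (metis add_diff_inverse_nat less_diff_conv2 nat_add_left_cancel_less not_le)
  have mv: "(X * Y) *\<^sub>v x = X *\<^sub>v (Y *\<^sub>v x)" if "X \<in> carrier_mat N N" "Y \<in> carrier_mat N N" "x \<in> carrier_vec N"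
    for X Y :: "'k mat" and x using assoc_mult_mat_vec[OF that] .
  have cv: "X *\<^sub>v x \<in> carrier_vec N" if "X \<in> carrier_mat N N" "x \<in> carrier_vec N" for X :: "'k mat" and x
    using that by auto
  have sub1: "ideal_product N K \<subseteq> ideal_product N K'"
  proof (rule ideal_product_mono_unimodular[OF _ _ K K'])
    show "S 1 * U (-1) \<in> carrier_mat N N" by (rule mult_carrier_mat[OF carr(1,2)])
    show "det (S 1 * U (-1)) = 1" using det_mult[OF carr(1,2)] det by simp
    fix x i assume x: "x \<in> carrier_vec N" and xK: "\<And>i. i < N \<Longrightarrow> x $ i \<in> K i" and i: "i < N"
    have xI: "x $ k \<in> I k" if "k < n" for k using xK[of k] that unfolding K_def N_def by simp
    have xR: "x $ (n + j) \<in> R" if "j < l" for j using xK[of "n + j"] that unfolding K_def N_def by simp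
    have Tx: "(S 1 * U (-1)) *\<^sub>v x = S 1 *\<^sub>v (U (-1) *\<^sub>v x)" by (rule mv[OF carr(1,2) x])
    have Ux: "U (-1) *\<^sub>v x \<in> carrier_vec N" by (rule cv[OF carr(2) x])
    from idx[OF i] show "((S 1 * U (-1)) *\<^sub>v x) $ i \<in> K' i"
    proof (elim disjE exE conjE)
      assume "i < n"
      have "((S 1 * U (-1)) *\<^sub>v x) $ i = x $ i - (\<Sum>j<l. b i j * x $ (n + j))"
        unfolding Tx S1[OF \<open>i < n\<close> Ux] U1[OF \<open>i < n\<close> x] by simp
      also have "\<dots> \<in> R"
        using \<open>i < n\<close> xR b ideal_in_R[OF xI] by (intro diff_R sum_R mult_R) auto
      finally show ?thesis using \<open>i < n\<close> unfolding K'_def by simp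
    next
      fix i' assume i': "i' < l" "i = n + i'"
      have "((S 1 * U (-1)) *\<^sub>v x) $ i = x $ (n + i') + (\<Sum>k<n. a i' k * (x $ k - (\<Sum>j<l. b k j * x $ (n + j))))"
        unfolding Tx i'(2) S2[OF i'(1) Ux] U2[OF i'(1) x] using U1[OF _ x] by simp
      also have "\<dots> = (\<Sum>k<n. a i' k * x $ k) - ((\<Sum>k<n. a i' k * (\<Sum>j<l. b k j * x $ (n + j))) - x $ (n + i'))"
        by (simp add: right_diff_distrib sum_subtractf)
      also have "\<dots> \<in> J i'"
      proof (rule ideal_diff[OF J[OF i'(1)]])
        show "(\<Sum>k<n. a i' k * x $ k) \<in> J i'" using ker[of "\<lambda>k. x $ k"] xI ideal_in_R i'(1) by auto
        show "(\<Sum>k<n. a i' k * (\<Sum>j<l. b k j * x $ (n + j))) - x $ (n + i') \<in> J i'"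
          using xR by (intro aby[OF i'(1)])
      qed
      finally show ?thesis unfolding K'_def i'(2) by simp
    qed
  qed auto
  have sub2: "ideal_product N K' \<subseteq> ideal_product N K"
  proof (rule ideal_product_mono_unimodular[OF _ _ K' K])
    show "U 1 * S (-1) \<in> carrier_mat N N" by (rule mult_carrier_mat[OF carr(2,1)])
    show "det (U 1 * S (-1)) = 1" using det_mult[OF carr(2,1)] det by simp
    fix x i assume x: "x \<in> carrier_vec N" and xK: "\<And>i. i < N \<Longrightarrow> x $ i \<in> K' i" and i: "i < N"
    have xR: "x $ k \<in> R" if "k < n" for k using xK[of k] that unfolding K'_def N_def by simp
    have xJ: "x $ (n + j) \<in> J j" if "j < l" for j using xK[of "n + j"] that unfolding K'_def N_def by simp
    have Tx: "(U 1 * S (-1)) *\<^sub>v x = U 1 *\<^sub>v (S (-1) *\<^sub>v x)" by (rule mv[OF carr(2,1) x])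
    have Sx: "S (-1) *\<^sub>v x \<in> carrier_vec N" by (rule cv[OF carr(1) x])
    define y where "y j = x $ (n + j) - (\<Sum>k<n. a j k * x $ k)" for j
    have yR: "y j \<in> R" if "j < l" for j unfolding y_def using that xR a ideal_in_R'[OF xJ]
      by (intro diff_R sum_R mult_R) auto
    from idx[OF i] show "((U 1 * S (-1)) *\<^sub>v x) $ i \<in> K i"
    proof (elim disjE exE conjE)
      assume "i < n"
      define u where "u k = x $ k + (\<Sum>j<l. b k j * y j)" for k
      have uR: "u k \<in> R" if "k < n" for k unfolding u_def using that xR yR b
        by (intro add_R sum_R mult_R) auto
      have "\<forall>k<n. u k \<in> I k"
      proof (subst ker)
        show "\<And>k. k < n \<Longrightarrow> u k \<in> R" by (rule uR)
        show "\<forall>i<l. (\<Sum>k<n. a i k * u k) \<in> J i"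
        proof (intro allI impI)
          fix j assume j: "j < l"
          have "(\<Sum>k<n. a j k * u k) = ((\<Sum>k<n. a j k * (\<Sum>j<l. b k j * y j)) - y j) + x $ (n + j)"
            unfolding u_def by (simp add: distrib_left sum.distrib y_def)
          also have "\<dots> \<in> J j" using xJ[OF j] aby[OF j yR] by (intro idealD(3)[OF J[OF j]])
          finally show "(\<Sum>k<n. a j k * u k) \<in> J j" .
        qed
      qed
      moreover have "((U 1 * S (-1)) *\<^sub>v x) $ i = u i"
        unfolding Tx U1[OF \<open>i < n\<close> Sx] S1[OF \<open>i < n\<close> x] u_def y_def using S2[OF _ x] by simp
      ultimately show ?thesis using \<open>i < n\<close> unfolding K_def by simp
    next
      fix i' assume i': "i' < l" "i = n + i'"
      have "((U 1 * S (-1)) *\<^sub>v x) $ i = y i'"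
        unfolding Tx i'(2) U2[OF i'(1) Sx] S2[OF i'(1) x] y_def by simp
      then show ?thesis using yR[OF i'(1)] i'(2) unfolding K_def by simp
    qed
  qed auto
  have "ideal_product n I = ideal_product n K"
    using I by (intro ideal_product_cong) (auto simp: K_def)
  moreover have "ideal_product l (\<lambda>i. K (n + i)) = R"
    unfolding K_def using ideal_product_R by simp
  moreover have "ideal_product n K' = R"
    using ideal_product_R[of n] ideal_product_cong[of n "\<lambda>_. R" K'] ideal_R unfolding K'_def by simp
  moreover have "ideal_product l (\<lambda>i. K' (n + i)) = ideal_product l J"
    unfolding K'_def by simp
  moreover have "ideal_product N K = ideal_product n K \<star> ideal_product l (\<lambda>i. K (n + i))"
    using K unfolding N_def by (intro ideal_product_append)
  moreover have "ideal_product N K' = ideal_product n K' \<star> ideal_product l (\<lambda>i. K' (n + i))"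
    using K' unfolding N_def by (intro ideal_product_append)
  moreover have "ideal_of_R (ideal_product n I)" "ideal_of_R (ideal_product l J)"
    using I J by (auto intro!: ideal_ideal_product)
  ultimately show ?thesis
    using sub1 sub2 A.ideal_prod_one A.ideal_prod_commute[OF ideal_R] by simp
qed

section \<open>Quotient modules\<close>

definition residue :: "'k set \<Rightarrow> 'k \<Rightarrow> 'k set"
  where "residue I x = {z \<in> R. z - x \<in> I}"

lemma residue_self: "ideal_of_R I \<Longrightarrow> x \<in> R \<Longrightarrow> x \<in> residue I x"
  unfolding residue_def using idealD(2) by simp

lemma residue_eq_iff:
  assumes "ideal_of_R I" "x \<in> R" "y \<in> R"
  shows "residue I x = residue I y \<longleftrightarrow> x - y \<in> I"
proof
  assume "residue I x = residue I y"
  then show "x - y \<in> I" using residue_self[OF assms(1,2)] unfolding residue_def by simp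
next
  assume xy: "x - y \<in> I"
  have "z - y \<in> I \<longleftrightarrow> z - x \<in> I" for z
    using idealD(3)[OF assms(1) _ xy, of "z - x"] ideal_diff[OF assms(1) _ xy, of "z - y"] by auto
  then show "residue I x = residue I y" unfolding residue_def by simp
qed

lemma coset_self_module:
  assumes "ideal_of_R I" "x \<in> R"
  shows "I +>\<^bsub>self_module (ring_on R)\<^esub> x = residue I x"
proof
  show "I +>\<^bsub>self_module (ring_on R)\<^esub> x \<subseteq> residue I x"
    using idealD(1)[OF assms(1)] assms(2) unfolding a_r_coset_def' residue_def self_module_def by auto
  show "residue I x \<subseteq> I +>\<^bsub>self_module (ring_on R)\<^esub> x"
  proof
    fix z assume "z \<in> residue I x"
    then have "z - x \<in> I" unfolding residue_def by auto
    then show "z \<in> I +>\<^bsub>self_module (ring_on R)\<^esub> x"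
      unfolding a_r_coset_def' self_module_def by (auto intro!: bexI[of _ "z - x"])
  qed
qed

lemma quot_self_module:
  assumes I: "ideal_of_R I"
  defines "Q \<equiv> quot_module (self_module (ring_on R)) I"
  shows "carrier Q = residue I ` R"
    and "x \<in> R \<Longrightarrow> y \<in> R \<Longrightarrow> residue I x \<oplus>\<^bsub>Q\<^esub> residue I y = residue I (x + y)"
    and "r \<in> R \<Longrightarrow> x \<in> R \<Longrightarrow> r \<odot>\<^bsub>Q\<^esub> residue I x = residue I (r * x)"
proof -
  have "carrier (self_module (ring_on R)) = R" unfolding self_module_def by simp
  then show "carrier Q = residue I ` R"
    unfolding Q_def quot_module_def A_RCOSETS_def' using coset_self_module[OF I] by auto
  show "residue I x \<oplus>\<^bsub>Q\<^esub> residue I y = residue I (x + y)" if x: "x \<in> R" and y: "y \<in> R"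
  proof -
    have "residue I x \<oplus>\<^bsub>Q\<^esub> residue I y = {u + v |u v. u \<in> residue I x \<and> v \<in> residue I y}"
      unfolding Q_def quot_module_def self_module_def set_add_def' by auto
    also have "\<dots> = residue I (x + y)"
    proof
      show "{u + v |u v. u \<in> residue I x \<and> v \<in> residue I y} \<subseteq> residue I (x + y)"
      proof
        fix z assume "z \<in> {u + v |u v. u \<in> residue I x \<and> v \<in> residue I y}"
        then obtain u v where "z = u + v" "u \<in> R" "v \<in> R" "u - x \<in> I" "v - y \<in> I" unfolding residue_def by auto
        moreover from this have "(u - x) + (v - y) \<in> I" by (intro idealD(3)[OF I])
        ultimately show "z \<in> residue I (x + y)" unfolding residue_def using add_R by (simp add: algebra_simps)
      qed
      show "residue I (x + y) \<subseteq> {u + v |u v. u \<in> residue I x \<and> v \<in> residue I y}"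
      proof
        fix z assume z: "z \<in> residue I (x + y)"
        have "z - y \<in> residue I x" using z diff_R y unfolding residue_def by (simp add: algebra_simps)
        moreover have "z = (z - y) + y" by simp
        ultimately show "z \<in> {u + v |u v. u \<in> residue I x \<and> v \<in> residue I y}"
          using residue_self[OF I y] by blast
      qed
    qed
    finally show ?thesis .
  qed
  show "r \<odot>\<^bsub>Q\<^esub> residue I x = residue I (r * x)" if r: "r \<in> R" and x: "x \<in> R"
  proof -
    have "r \<odot>\<^bsub>Q\<^esub> residue I x = (\<Union>z\<in>residue I x. residue I (r * z))"
    proof -
      have "I +>\<^bsub>self_module (ring_on R)\<^esub> (r * z) = residue I (r * z)" if "z \<in> residue I x" for z
        using that r mult_R by (intro coset_self_module[OF I]) (simp add: residue_def)
      then show ?thesis unfolding Q_def quot_module_def by (simp add: self_module_def)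
    qed
    also have "\<dots> = (\<Union>z\<in>residue I x. residue I (r * x))"
    proof (rule SUP_cong[OF refl])
      fix z assume z: "z \<in> residue I x"
      have "r * z - r * x \<in> I"
        using z idealD(4)[OF I r, of "z - x"] unfolding residue_def by (simp add: right_diff_distrib)
      then show "residue I (r * z) = residue I (r * x)"
        using z r x mult_R residue_eq_iff[OF I] by (simp add: residue_def)
    qed
    finally show ?thesis using residue_self[OF I x] by auto
  qed
qed

lemma free_module:
  shows "carrier (ring_on R ^^^ n) = ({..<n} \<rightarrow>\<^sub>E R)"
    and "x \<oplus>\<^bsub>ring_on R ^^^ n\<^esub> y = (\<lambda>v\<in>{..<n}. x v + y v)"
    and "r \<odot>\<^bsub>ring_on R ^^^ n\<^esub> x = (\<lambda>v\<in>{..<n}. r * x v)"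
  unfolding A.func_space_def by simp_all

lemma restrict_Rn: "(\<And>v. v < n \<Longrightarrow> f v \<in> R) \<Longrightarrow> (\<lambda>v\<in>{..<n}. f v) \<in> {..<n} \<rightarrow>\<^sub>E R"
  by auto

text \<open>The index map \<open>s\<close> makes it possible to constrain one coordinate by several ideals. In this way
\<open>\<alpha>R\<^sup>n\<close> is described both by the ideal \<open>(\<alpha>)\<close> and by the prime powers that divide it.\<close>

definition box :: "nat \<Rightarrow> nat \<Rightarrow> (nat \<Rightarrow> nat) \<Rightarrow> (nat \<Rightarrow> 'k set) \<Rightarrow> (nat \<Rightarrow> 'k) set"
  where "box n l s I = {x \<in> {..<n} \<rightarrow>\<^sub>E R. \<forall>t<l. x (s t) \<in> I t}"

definition box_coset :: "nat \<Rightarrow> nat \<Rightarrow> (nat \<Rightarrow> nat) \<Rightarrow> (nat \<Rightarrow> 'k set) \<Rightarrow> (nat \<Rightarrow> 'k) \<Rightarrow> (nat \<Rightarrow> 'k) set"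
  where "box_coset n l s I x = {z \<in> {..<n} \<rightarrow>\<^sub>E R. \<forall>t<l. z (s t) - x (s t) \<in> I t}"

context
  fixes n l :: nat and s :: "nat \<Rightarrow> nat" and I :: "nat \<Rightarrow> 'k set"
  assumes ideals: "\<forall>t<l. ideal_of_R (I t)" and indices: "\<forall>t<l. s t < n"
begin

lemmas I_ideal = ideals[rule_format] and s_less = indices[rule_format]

lemma box_coset_self: "x \<in> {..<n} \<rightarrow>\<^sub>E R \<Longrightarrow> x \<in> box_coset n l s I x"
  unfolding box_coset_def using idealD(2)[OF I_ideal] by simp

lemma box_coset_eq_iff:
  assumes "x \<in> {..<n} \<rightarrow>\<^sub>E R" "y \<in> {..<n} \<rightarrow>\<^sub>E R"
  shows "box_coset n l s I x = box_coset n l s I y \<longleftrightarrow> (\<forall>t<l. x (s t) - y (s t) \<in> I t)"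
proof
  assume "box_coset n l s I x = box_coset n l s I y"
  then show "\<forall>t<l. x (s t) - y (s t) \<in> I t" using box_coset_self[OF assms(1)] unfolding box_coset_def by simp
next
  assume xy: "\<forall>t<l. x (s t) - y (s t) \<in> I t"
  have "z (s t) - y (s t) \<in> I t \<longleftrightarrow> z (s t) - x (s t) \<in> I t" if t: "t < l" for t z
    using xy t idealD(3)[OF I_ideal[OF t], of "z (s t) - x (s t)" "x (s t) - y (s t)"]
      ideal_diff[OF I_ideal[OF t], of "z (s t) - y (s t)" "x (s t) - y (s t)"] by auto
  then show "box_coset n l s I x = box_coset n l s I y" unfolding box_coset_def by blast
qed

lemma coset_box:
  assumes x: "x \<in> {..<n} \<rightarrow>\<^sub>E R"
  shows "box n l s I +>\<^bsub>ring_on R ^^^ n\<^esub> x = box_coset n l s I x"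
proof
  have xR: "x v \<in> R" if "v < n" for v using x that by auto
  show "box n l s I +>\<^bsub>ring_on R ^^^ n\<^esub> x \<subseteq> box_coset n l s I x"
  proof
    fix z assume "z \<in> box n l s I +>\<^bsub>ring_on R ^^^ n\<^esub> x"
    then obtain h where h: "h \<in> box n l s I" "z = (\<lambda>v\<in>{..<n}. h v + x v)"
      unfolding a_r_coset_def' free_module by auto
    then have hR: "h v \<in> R" if "v < n" for v using that unfolding box_def by auto
    have "z \<in> {..<n} \<rightarrow>\<^sub>E R" unfolding h(2) using hR xR by (intro restrict_Rn add_R)
    moreover have "z (s t) - x (s t) \<in> I t" if "t < l" for t
      unfolding h(2) using s_less[OF that] h(1) that unfolding box_def by simp
    ultimately show "z \<in> box_coset n l s I x" unfolding box_coset_def by simp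
  qed
  show "box_coset n l s I x \<subseteq> box n l s I +>\<^bsub>ring_on R ^^^ n\<^esub> x"
  proof
    fix z assume z: "z \<in> box_coset n l s I x"
    then have zE: "z \<in> {..<n} \<rightarrow>\<^sub>E R" and zR: "z v \<in> R" if "v < n" for v
      using that unfolding box_coset_def by auto
    define h where "h = (\<lambda>v\<in>{..<n}. z v - x v)"
    have "h \<in> {..<n} \<rightarrow>\<^sub>E R" unfolding h_def using zR xR by (intro restrict_Rn diff_R)
    moreover have "h (s t) \<in> I t" if "t < l" for t
      unfolding h_def using s_less[OF that] z that unfolding box_coset_def by simp
    ultimately have "h \<in> box n l s I" unfolding box_def by simp
    moreover have "z = (\<lambda>v\<in>{..<n}. h v + x v)"
    proof
      fix v show "z v = (\<lambda>v\<in>{..<n}. h v + x v) v"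
        using z unfolding box_coset_def h_def by (cases "v < n") (auto simp: PiE_def extensional_def)
    qed
    ultimately show "z \<in> box n l s I +>\<^bsub>ring_on R ^^^ n\<^esub> x"
      unfolding a_r_coset_def' free_module by auto
  qed
qed

lemma quot_box:
  defines "Q \<equiv> quot_module (ring_on R ^^^ n) (box n l s I)"
  shows "carrier Q = box_coset n l s I ` ({..<n} \<rightarrow>\<^sub>E R)"
    and "x \<in> {..<n} \<rightarrow>\<^sub>E R \<Longrightarrow> y \<in> {..<n} \<rightarrow>\<^sub>E R \<Longrightarrow>
      box_coset n l s I x \<oplus>\<^bsub>Q\<^esub> box_coset n l s I y = box_coset n l s I (\<lambda>v\<in>{..<n}. x v + y v)"
    and "r \<in> R \<Longrightarrow> x \<in> {..<n} \<rightarrow>\<^sub>E R \<Longrightarrow>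
      r \<odot>\<^bsub>Q\<^esub> box_coset n l s I x = box_coset n l s I (\<lambda>v\<in>{..<n}. r * x v)"
proof -
  show "carrier Q = box_coset n l s I ` ({..<n} \<rightarrow>\<^sub>E R)"
    unfolding Q_def quot_module_def A_RCOSETS_def' using coset_box free_module(1) by auto
  show "box_coset n l s I x \<oplus>\<^bsub>Q\<^esub> box_coset n l s I y = box_coset n l s I (\<lambda>v\<in>{..<n}. x v + y v)"
    if x: "x \<in> {..<n} \<rightarrow>\<^sub>E R" and y: "y \<in> {..<n} \<rightarrow>\<^sub>E R"
  proof -
    let ?X = "box_coset n l s I x" and ?Y = "box_coset n l s I y" and ?Z = "box_coset n l s I (\<lambda>v\<in>{..<n}. x v + y v)"
    have "?X \<oplus>\<^bsub>Q\<^esub> ?Y = {(\<lambda>w\<in>{..<n}. u w + v w) |u v. u \<in> ?X \<and> v \<in> ?Y}"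
      unfolding Q_def quot_module_def set_add_def' by (auto simp: free_module)
    also have "\<dots> = ?Z"
    proof
      show "{(\<lambda>w\<in>{..<n}. u w + v w) |u v. u \<in> ?X \<and> v \<in> ?Y} \<subseteq> ?Z"
      proof
        fix z assume "z \<in> {(\<lambda>w\<in>{..<n}. u w + v w) |u v. u \<in> ?X \<and> v \<in> ?Y}"
        then obtain u v where z: "z = (\<lambda>w\<in>{..<n}. u w + v w)" and u: "u \<in> ?X" and v: "v \<in> ?Y" by auto
        have "z \<in> {..<n} \<rightarrow>\<^sub>E R" unfolding z using u v unfolding box_coset_def by (intro restrict_Rn add_R) auto
        moreover have "z (s t) - (x (s t) + y (s t)) \<in> I t" if "t < l" for t
        proof -
          have "(u (s t) - x (s t)) + (v (s t) - y (s t)) \<in> I t"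
            using u v that unfolding box_coset_def by (intro idealD(3)[OF I_ideal[OF that]]) auto
          then show ?thesis unfolding z using s_less[OF that] by (simp add: algebra_simps)
        qed
        ultimately show "z \<in> ?Z" unfolding box_coset_def using s_less by auto
      qed
      show "?Z \<subseteq> {(\<lambda>w\<in>{..<n}. u w + v w) |u v. u \<in> ?X \<and> v \<in> ?Y}"
      proof
        fix z assume z: "z \<in> ?Z"
        define u where "u = (\<lambda>w\<in>{..<n}. z w - y w)"
        have "u \<in> {..<n} \<rightarrow>\<^sub>E R" unfolding u_def using z y unfolding box_coset_def by (intro restrict_Rn diff_R) auto
        moreover have "u (s t) - x (s t) \<in> I t" if "t < l" for t
        proof -
          have "z (s t) - (\<lambda>v\<in>{..<n}. x v + y v) (s t) \<in> I t" using z that unfolding box_coset_def by simp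
          then show ?thesis using s_less[OF that] unfolding u_def by (simp add: algebra_simps)
        qed
        ultimately have "u \<in> ?X" unfolding box_coset_def by simp
        moreover have "z = (\<lambda>w\<in>{..<n}. u w + y w)"
        proof
          fix v show "z v = (\<lambda>v\<in>{..<n}. u v + y v) v"
            using z unfolding box_coset_def u_def by (cases "v < n") (auto simp: PiE_def extensional_def)
        qed
        ultimately show "z \<in> {(\<lambda>w\<in>{..<n}. u w + v w) |u v. u \<in> ?X \<and> v \<in> ?Y}"
          using box_coset_self[OF y] by blast
      qed
    qed
    finally show ?thesis .
  qed
  show "r \<odot>\<^bsub>Q\<^esub> box_coset n l s I x = box_coset n l s I (\<lambda>v\<in>{..<n}. r * x v)"
    if r: "r \<in> R" and x: "x \<in> {..<n} \<rightarrow>\<^sub>E R"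
  proof -
    have in_Rn: "(\<lambda>v\<in>{..<n}. r * z v) \<in> {..<n} \<rightarrow>\<^sub>E R" if "z \<in> {..<n} \<rightarrow>\<^sub>E R" for z
      using that r by (intro restrict_Rn mult_R) auto
    have "r \<odot>\<^bsub>Q\<^esub> box_coset n l s I x = (\<Union>z\<in>box_coset n l s I x. box n l s I +>\<^bsub>ring_on R ^^^ n\<^esub> (\<lambda>v\<in>{..<n}. r * z v))"
      unfolding Q_def quot_module_def by (simp add: free_module)
    also have "\<dots> = (\<Union>z\<in>box_coset n l s I x. box_coset n l s I (\<lambda>v\<in>{..<n}. r * x v))"
    proof (rule SUP_cong[OF refl])
      fix z assume z: "z \<in> box_coset n l s I x"
      then have zE: "z \<in> {..<n} \<rightarrow>\<^sub>E R" unfolding box_coset_def by simp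
      have "r * z (s t) - r * x (s t) \<in> I t" if "t < l" for t
        using z that idealD(4)[OF I_ideal[OF that] r, of "z (s t) - x (s t)"] unfolding box_coset_def
        by (simp add: right_diff_distrib)
      then have "box_coset n l s I (\<lambda>v\<in>{..<n}. r * z v) = box_coset n l s I (\<lambda>v\<in>{..<n}. r * x v)"
        using box_coset_eq_iff[OF in_Rn[OF zE] in_Rn[OF x]] s_less by simp
      then show "box n l s I +>\<^bsub>ring_on R ^^^ n\<^esub> (\<lambda>v\<in>{..<n}. r * z v) = box_coset n l s I (\<lambda>v\<in>{..<n}. r * x v)"
        using coset_box[OF in_Rn[OF zE]] by simp
    qed
    finally show ?thesis using box_coset_self[OF x] by auto
  qed
qed

end

lemma dsum_residues:
  assumes ideals: "\<forall>i<l. ideal_of_R (J i)"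
  defines "D \<equiv> dsum_module l (\<lambda>i. quot_module (self_module (ring_on R)) (J i))"
  defines "res \<equiv> \<lambda>y. \<lambda>i\<in>{..<l}. residue (J i) (y i)"
  shows "X \<in> carrier D \<longleftrightarrow> (\<exists>y. (\<forall>i<l. y i \<in> R) \<and> X = res y)"
    and "(\<And>i. i < l \<Longrightarrow> y i \<in> R) \<Longrightarrow> (\<And>i. i < l \<Longrightarrow> z i \<in> R) \<Longrightarrow> res y \<oplus>\<^bsub>D\<^esub> res z = res (\<lambda>i. y i + z i)"
    and "r \<in> R \<Longrightarrow> (\<And>i. i < l \<Longrightarrow> y i \<in> R) \<Longrightarrow> r \<odot>\<^bsub>D\<^esub> res y = res (\<lambda>i. r * y i)"
    and "(\<And>i. i < l \<Longrightarrow> y i \<in> R) \<Longrightarrow> (\<And>i. i < l \<Longrightarrow> z i \<in> R) \<Longrightarrow> res y = res z \<longleftrightarrow> (\<forall>i<l. y i - z i \<in> J i)"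
proof -
  note J = ideals[rule_format]
  have carr: "carrier D = (\<Pi>\<^sub>E i\<in>{..<l}. residue (J i) ` R)"
    unfolding D_def dsum_module_def using quot_self_module(1)[OF J] by (auto intro!: PiE_cong)
  show "X \<in> carrier D \<longleftrightarrow> (\<exists>y. (\<forall>i<l. y i \<in> R) \<and> X = res y)"
  proof
    assume X: "X \<in> carrier D"
    then have "\<forall>i\<in>{..<l}. \<exists>y\<in>R. X i = residue (J i) y" unfolding carr by auto
    then obtain y where y: "\<forall>i\<in>{..<l}. y i \<in> R \<and> X i = residue (J i) (y i)" by metis
    then have "X = res y" using X unfolding carr res_def by (intro ext) (auto simp: PiE_def extensional_def)
    with y show "\<exists>y. (\<forall>i<l. y i \<in> R) \<and> X = res y" by auto
  qed (auto simp: carr res_def)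
  show "res y \<oplus>\<^bsub>D\<^esub> res z = res (\<lambda>i. y i + z i)" if "\<And>i. i < l \<Longrightarrow> y i \<in> R" "\<And>i. i < l \<Longrightarrow> z i \<in> R"
    unfolding D_def dsum_module_def res_def using that quot_self_module(2)[OF J] by (auto intro!: restrict_ext)
  show "r \<odot>\<^bsub>D\<^esub> res y = res (\<lambda>i. r * y i)" if "r \<in> R" "\<And>i. i < l \<Longrightarrow> y i \<in> R"
    unfolding D_def dsum_module_def res_def using that quot_self_module(3)[OF J] by (auto intro!: restrict_ext)
  show "res y = res z \<longleftrightarrow> (\<forall>i<l. y i - z i \<in> J i)"
    if yz: "\<And>i. i < l \<Longrightarrow> y i \<in> R" "\<And>i. i < l \<Longrightarrow> z i \<in> R"
  proof -
    have "res y = res z \<longleftrightarrow> (\<forall>i<l. residue (J i) (y i) = residue (J i) (z i))"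
    proof
      assume eq: "res y = res z"
      show "\<forall>i<l. residue (J i) (y i) = residue (J i) (z i)"
      proof (intro allI impI)
        fix i assume "i < l"
        then show "residue (J i) (y i) = residue (J i) (z i)" using fun_cong[OF eq, of i] unfolding res_def by simp
      qed
    qed (auto simp: res_def intro!: restrict_ext)
    then show ?thesis using residue_eq_iff[OF J] yz by simp
  qed
qed

text \<open>The isomorphism takes the coset of \<open>x\<close> to the residues of the coordinates \<open>x (s t)\<close> modulo \<open>I t\<close>. It is
injective because the same congruences define the box.\<close>

lemma quot_box_isomorphic_dsum:
  assumes I: "\<And>t. t < l \<Longrightarrow> ideal_of_R (I t)" and s: "\<And>t. t < l \<Longrightarrow> s t < n"
    and surj: "\<And>y. (\<And>t. t < l \<Longrightarrow> y t \<in> R) \<Longrightarrow> \<exists>x \<in> {..<n} \<rightarrow>\<^sub>E R. \<forall>t<l. x (s t) - y t \<in> I t"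
  shows "module_isos (ring_on R) (quot_module (ring_on R ^^^ n) (box n l s I))
    (dsum_module l (\<lambda>t. quot_module (self_module (ring_on R)) (I t))) \<noteq> {}"
proof -
  let ?Q = "quot_module (ring_on R ^^^ n) (box n l s I)"
  let ?D = "dsum_module l (\<lambda>t. quot_module (self_module (ring_on R)) (I t))"
  let ?c = "box_coset n l s I"
  have I': "\<forall>t<l. ideal_of_R (I t)" and s': "\<forall>t<l. s t < n" using I s by auto
  define res where "res y = (\<lambda>i\<in>{..<l}. residue (I i) (y i))" for y
  define \<phi> where "\<phi> = (\<lambda>X. \<lambda>t\<in>{..<l}. {z \<in> R. \<exists>x\<in>X. z - x (s t) \<in> I t})"
  note Q = quot_box[where I = I, OF I' s']
  note D = dsum_residues[where J = I, OF I', folded res_def]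
  have \<phi>: "\<phi> (?c x) = res (\<lambda>t. x (s t))" if x: "x \<in> {..<n} \<rightarrow>\<^sub>E R" for x
    unfolding \<phi>_def res_def
  proof (intro restrict_ext)
    fix t assume "t \<in> {..<l}"
    then have t: "t < l" by simp
    show "{z \<in> R. \<exists>x\<in>?c x. z - x (s t) \<in> I t} = residue (I t) (x (s t))"
    proof
      show "residue (I t) (x (s t)) \<subseteq> {z \<in> R. \<exists>x\<in>?c x. z - x (s t) \<in> I t}"
        unfolding residue_def using box_coset_self[where I = I, OF I' s' x] by auto
      show "{z \<in> R. \<exists>x\<in>?c x. z - x (s t) \<in> I t} \<subseteq> residue (I t) (x (s t))"
      proof
        fix z assume "z \<in> {z \<in> R. \<exists>x\<in>?c x. z - x (s t) \<in> I t}"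
        then obtain x' where x': "z \<in> R" "x' \<in> ?c x" "z - x' (s t) \<in> I t" by auto
        then have "x' (s t) - x (s t) \<in> I t" using t unfolding box_coset_def by simp
        from idealD(3)[OF I[OF t] x'(3) this] x'(1) show "z \<in> residue (I t) (x (s t))"
          unfolding residue_def by simp
      qed
    qed
  qed
  have xs: "x (s t) \<in> R" if "x \<in> {..<n} \<rightarrow>\<^sub>E R" "t < l" for x t using that s[OF that(2)] by auto
  have in_Rn: "(\<lambda>v\<in>{..<n}. x v + y v) \<in> {..<n} \<rightarrow>\<^sub>E R" "r \<in> R \<Longrightarrow> (\<lambda>v\<in>{..<n}. r * x v) \<in> {..<n} \<rightarrow>\<^sub>E R"
    if "x \<in> {..<n} \<rightarrow>\<^sub>E R" "y \<in> {..<n} \<rightarrow>\<^sub>E R" for x y :: "nat \<Rightarrow> 'k" and r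
    using that by (auto intro!: restrict_Rn add_R mult_R)
  have res_cong: "res y = res z" if "\<And>t. t < l \<Longrightarrow> y t = z t" for y z
    unfolding res_def using that by (auto intro!: restrict_ext)
  have "\<phi> \<in> module_hom (ring_on R) ?Q ?D"
    unfolding module_hom_def
  proof (intro CollectI conjI allI impI)
    show "\<phi> \<in> carrier ?Q \<rightarrow> carrier ?D"
    proof
      fix X assume "X \<in> carrier ?Q"
      then obtain x where x: "x \<in> {..<n} \<rightarrow>\<^sub>E R" "X = ?c x" unfolding Q(1) by auto
      then show "\<phi> X \<in> carrier ?D" unfolding x(2) \<phi>[OF x(1)] D(1) using xs[OF x(1)] by (intro exI[of _ "\<lambda>t. x (s t)"]) simp
    qed
  next
    fix X Y assume "X \<in> carrier ?Q \<and> Y \<in> carrier ?Q"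
    then obtain x y where x: "x \<in> {..<n} \<rightarrow>\<^sub>E R" "X = ?c x" and y: "y \<in> {..<n} \<rightarrow>\<^sub>E R" "Y = ?c y" unfolding Q(1) by auto
    have "\<phi> (X \<oplus>\<^bsub>?Q\<^esub> Y) = res (\<lambda>t. (\<lambda>v\<in>{..<n}. x v + y v) (s t))"
      unfolding x(2) y(2) Q(2)[OF x(1) y(1)] by (rule \<phi>[OF in_Rn(1)[OF x(1) y(1)]])
    also have "\<dots> = res (\<lambda>t. x (s t) + y (s t))" using s by (intro res_cong) simp
    also have "\<dots> = \<phi> X \<oplus>\<^bsub>?D\<^esub> \<phi> Y"
      unfolding x(2) y(2) \<phi>[OF x(1)] \<phi>[OF y(1)] using xs[OF x(1)] xs[OF y(1)] by (subst D(2)) auto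
    finally show "\<phi> (X \<oplus>\<^bsub>?Q\<^esub> Y) = \<phi> X \<oplus>\<^bsub>?D\<^esub> \<phi> Y" .
  next
    fix r X assume "r \<in> carrier (ring_on R) \<and> X \<in> carrier ?Q"
    then obtain x where x: "x \<in> {..<n} \<rightarrow>\<^sub>E R" "X = ?c x" and r: "r \<in> R" unfolding Q(1) by auto
    have "\<phi> (r \<odot>\<^bsub>?Q\<^esub> X) = res (\<lambda>t. (\<lambda>v\<in>{..<n}. r * x v) (s t))"
      unfolding x(2) Q(3)[OF r x(1)] by (rule \<phi>[OF in_Rn(2)[OF x(1) x(1) r]])
    also have "\<dots> = res (\<lambda>t. r * x (s t))" using s by (intro res_cong) simp
    also have "\<dots> = r \<odot>\<^bsub>?D\<^esub> \<phi> X"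
      unfolding x(2) \<phi>[OF x(1)] using xs[OF x(1)] r by (subst D(3)) auto
    finally show "\<phi> (r \<odot>\<^bsub>?Q\<^esub> X) = r \<odot>\<^bsub>?D\<^esub> \<phi> X" .
  qed
  moreover have "bij_betw \<phi> (carrier ?Q) (carrier ?D)"
  proof (rule bij_betw_imageI)
    show "inj_on \<phi> (carrier ?Q)"
    proof (rule inj_onI)
      fix X Y assume "X \<in> carrier ?Q" "Y \<in> carrier ?Q" and eq: "\<phi> X = \<phi> Y"
      then obtain x y where x: "x \<in> {..<n} \<rightarrow>\<^sub>E R" "X = ?c x" and y: "y \<in> {..<n} \<rightarrow>\<^sub>E R" "Y = ?c y" unfolding Q(1) by auto
      have "res (\<lambda>t. x (s t)) = res (\<lambda>t. y (s t))" using eq unfolding x(2) y(2) \<phi>[OF x(1)] \<phi>[OF y(1)] .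
      then have "\<forall>t<l. x (s t) - y (s t) \<in> I t" using xs[OF x(1)] xs[OF y(1)] by (subst (asm) D(4)) auto
      then show "X = Y" unfolding x(2) y(2) using box_coset_eq_iff[where I = I, OF I' s' x(1) y(1)] by simp
    qed
    show "\<phi> ` carrier ?Q = carrier ?D"
    proof
      show "\<phi> ` carrier ?Q \<subseteq> carrier ?D"
      proof
        fix Y assume "Y \<in> \<phi> ` carrier ?Q"
        then obtain x where x: "x \<in> {..<n} \<rightarrow>\<^sub>E R" "Y = \<phi> (?c x)" unfolding Q(1) by auto
        then show "Y \<in> carrier ?D" unfolding x(2) \<phi>[OF x(1)] D(1) using xs[OF x(1)]
          by (intro exI[of _ "\<lambda>t. x (s t)"]) simp
      qed
      show "carrier ?D \<subseteq> \<phi> ` carrier ?Q"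
      proof
        fix Y assume "Y \<in> carrier ?D"
        then obtain y where y: "\<forall>t<l. y t \<in> R" "Y = res y" unfolding D(1) by auto
        then obtain x where x: "x \<in> {..<n} \<rightarrow>\<^sub>E R" "\<forall>t<l. x (s t) - y t \<in> I t" using surj[of y] by auto
        have "res (\<lambda>t. x (s t)) = res y" using x y(1) xs[OF x(1)] by (subst D(4)) auto
        then have "Y = \<phi> (?c x)" using \<phi>[OF x(1)] y(2) by simp
        then show "Y \<in> \<phi> ` carrier ?Q" unfolding Q(1) using x(1) by auto
      qed
    qed
  qed
  ultimately show ?thesis unfolding module_isos_def by auto
qed

definition unit_vector :: "nat \<Rightarrow> nat \<Rightarrow> nat \<Rightarrow> 'k"
  where "unit_vector n k = (\<lambda>i\<in>{..<n}. if i = k then 1 else 0)"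

lemma unit_vector_in_Rn: "unit_vector n k \<in> {..<n} \<rightarrow>\<^sub>E R"
  unfolding unit_vector_def by (intro restrict_Rn) simp

text \<open>A linear map on \<open>R\<^sup>n\<close> is given by a matrix. The target consists of families of cosets in both
applications; it enters only through the map \<open>rep\<close> that takes a family of representatives to the
family of their cosets.\<close>

lemma linear_expansion:
  fixes \<Phi> rep :: "(nat \<Rightarrow> 'k) \<Rightarrow> 'c" and n l :: nat
  assumes range: "\<And>x. x \<in> {..<n} \<rightarrow>\<^sub>E R \<Longrightarrow> \<exists>u. (\<forall>i<l. u i \<in> R) \<and> \<Phi> x = rep u"
    and add: "\<And>x y u w. x \<in> {..<n} \<rightarrow>\<^sub>E R \<Longrightarrow> y \<in> {..<n} \<rightarrow>\<^sub>E R \<Longrightarrow> \<forall>i<l. u i \<in> R \<Longrightarrow> \<forall>i<l. w i \<in> R \<Longrightarrow>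
      \<Phi> x = rep u \<Longrightarrow> \<Phi> y = rep w \<Longrightarrow> \<Phi> (\<lambda>v\<in>{..<n}. x v + y v) = rep (\<lambda>i. u i + w i)"
    and smult: "\<And>r x u. r \<in> R \<Longrightarrow> x \<in> {..<n} \<rightarrow>\<^sub>E R \<Longrightarrow> \<forall>i<l. u i \<in> R \<Longrightarrow>
      \<Phi> x = rep u \<Longrightarrow> \<Phi> (\<lambda>v\<in>{..<n}. r * x v) = rep (\<lambda>i. r * u i)"
  obtains \<beta> where "\<And>k i. i < l \<Longrightarrow> \<beta> k i \<in> R"
    "\<And>x. x \<in> {..<n} \<rightarrow>\<^sub>E R \<Longrightarrow> \<Phi> x = rep (\<lambda>i. \<Sum>k<n. \<beta> k i * x k)"
proof -
  let ?e = "unit_vector n"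
  have "\<forall>k. \<exists>u. (\<forall>i<l. u i \<in> R) \<and> \<Phi> (?e k) = rep u" using range[OF unit_vector_in_Rn] by simp
  then obtain \<beta> where \<beta>: "\<And>k. \<forall>i<l. \<beta> k i \<in> R" "\<And>k. \<Phi> (?e k) = rep (\<beta> k)" by metis
  have trunc: "\<Phi> (\<lambda>v\<in>{..<n}. if v < m then x v else 0) = rep (\<lambda>i. \<Sum>k<m. \<beta> k i * x k)"
    if x: "x \<in> {..<n} \<rightarrow>\<^sub>E R" and "m \<le> n" for m x
    using that(2)
  proof (induct m)
    case 0
    have "\<Phi> (\<lambda>v\<in>{..<n}. 0 * ?e 0 v) = rep (\<lambda>i. 0 * \<beta> 0 i)"
      by (rule smult[OF zero_R unit_vector_in_Rn \<beta>])
    then show ?case by (simp add: restrict_def)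
  next
    case (Suc m)
    have xk: "x k \<in> R" if "k < n" for k using x that by auto
    have xm: "x m \<in> R" "\<And>k. k < m \<Longrightarrow> x k \<in> R" using xk Suc(2) by simp_all
    have p: "(\<lambda>v\<in>{..<n}. if v < m then x v else 0) \<in> {..<n} \<rightarrow>\<^sub>E R" using xk by (intro restrict_Rn) simp
    have xe: "(\<lambda>v\<in>{..<n}. x m * ?e m v) \<in> {..<n} \<rightarrow>\<^sub>E R"
      using xm(1) unit_vector_in_Rn[of n m] by (intro restrict_Rn mult_R) auto
    have "(\<lambda>v\<in>{..<n}. if v < Suc m then x v else 0) =
      (\<lambda>v\<in>{..<n}. (\<lambda>v\<in>{..<n}. if v < m then x v else 0) v + (\<lambda>v\<in>{..<n}. x m * ?e m v) v)"
      unfolding unit_vector_def by (rule restrict_ext) (auto simp: less_Suc_eq)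
    moreover have "\<Phi> \<dots> = rep (\<lambda>i. (\<Sum>k<m. \<beta> k i * x k) + x m * \<beta> m i)"
    proof (rule add[OF p xe])
      show "\<forall>i<l. (\<Sum>k<m. \<beta> k i * x k) \<in> R" using \<beta>(1) xm(2) by (auto intro!: sum_R mult_R)
      show "\<forall>i<l. x m * \<beta> m i \<in> R" using \<beta>(1) xm(1) by (auto intro!: mult_R)
      show "\<Phi> (\<lambda>v\<in>{..<n}. x m * ?e m v) = rep (\<lambda>i. x m * \<beta> m i)"
        by (rule smult[OF xm(1) unit_vector_in_Rn \<beta>])
      show "\<Phi> (\<lambda>v\<in>{..<n}. if v < m then x v else 0) = rep (\<lambda>i. \<Sum>k<m. \<beta> k i * x k)"
        by (rule Suc(1)[OF Suc_leD[OF Suc(2)]])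
    qed
    ultimately have "\<Phi> (\<lambda>v\<in>{..<n}. if v < Suc m then x v else 0) = rep (\<lambda>i. (\<Sum>k<m. \<beta> k i * x k) + x m * \<beta> m i)"
      by (simp only:)
    then show ?case unfolding sum.lessThan_Suc by (simp only: mult.commute[of "x m"])
  qed
  show thesis
  proof (rule that)
    show "\<beta> k i \<in> R" if "i < l" for k i using \<beta>(1) that by simp
    show "\<Phi> x = rep (\<lambda>i. \<Sum>k<n. \<beta> k i * x k)" if x: "x \<in> {..<n} \<rightarrow>\<^sub>E R" for x
    proof -
      have "(\<lambda>v\<in>{..<n}. if v < n then x v else 0) = x" using x by (auto simp: PiE_def extensional_def)
      then show ?thesis using trunc[OF x order_refl] by simp
    qed
  qed
qed

text \<open>A matrix of the isomorphism, and preimages of the unit vectors of the direct sum, satisfy the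
assumptions of \<open>ideal_product_invariant\<close>.\<close>

lemma quot_box_dsum_invariant:
  assumes I: "\<And>k. k < n \<Longrightarrow> ideal_of_R (I k)" and J: "\<And>i. i < l \<Longrightarrow> ideal_of_R (J i)"
    and iso: "\<phi> \<in> module_isos (ring_on R) (quot_module (ring_on R ^^^ n) (box n n (\<lambda>t. t) I))
      (dsum_module l (\<lambda>t. quot_module (self_module (ring_on R)) (J t)))"
  shows "ideal_product n I = ideal_product l J"
proof -
  let ?Q = "quot_module (ring_on R ^^^ n) (box n n (\<lambda>t. t) I)"
  let ?D = "dsum_module l (\<lambda>t. quot_module (self_module (ring_on R)) (J t))"
  let ?c = "box_coset n n (\<lambda>t. t) I"
  have ids': "\<forall>t<n. t < n" and I': "\<forall>t<n. ideal_of_R (I t)" and J': "\<forall>i<l. ideal_of_R (J i)"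
    using I J by auto
  define res where "res y = (\<lambda>i\<in>{..<l}. residue (J i) (y i))" for y
  note Q = quot_box[where I = I, OF I' ids']
  note D = dsum_residues[where J = J, OF J', folded res_def]
  have hom: "\<phi> \<in> module_hom (ring_on R) ?Q ?D" and bij: "bij_betw \<phi> (carrier ?Q) (carrier ?D)"
    using iso unfolding module_isos_def by auto
  have cQ: "?c x \<in> carrier ?Q" if "x \<in> {..<n} \<rightarrow>\<^sub>E R" for x unfolding Q(1) using that by auto
  obtain a' where a': "\<And>k i. i < l \<Longrightarrow> a' k i \<in> R"
    and \<phi>c: "\<And>x. x \<in> {..<n} \<rightarrow>\<^sub>E R \<Longrightarrow> \<phi> (?c x) = res (\<lambda>i. \<Sum>k<n. a' k i * x k)"
  proof (rule linear_expansion[of n l "\<lambda>x. \<phi> (?c x)" res])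
    show "\<exists>u. (\<forall>i<l. u i \<in> R) \<and> \<phi> (?c x) = res u" if "x \<in> {..<n} \<rightarrow>\<^sub>E R" for x
      using module_hom_closed[OF hom] cQ[OF that] D(1) by blast
    show "\<phi> (?c (\<lambda>v\<in>{..<n}. x v + y v)) = res (\<lambda>i. u i + w i)"
      if "x \<in> {..<n} \<rightarrow>\<^sub>E R" "y \<in> {..<n} \<rightarrow>\<^sub>E R" "\<forall>i<l. u i \<in> R" "\<forall>i<l. w i \<in> R"
        "\<phi> (?c x) = res u" "\<phi> (?c y) = res w" for x y u w
      using Q(2)[OF that(1,2)] module_hom_add[OF hom cQ[OF that(1)] cQ[OF that(2)]] D(2)[of u w] that by simp
    show "\<phi> (?c (\<lambda>v\<in>{..<n}. r * x v)) = res (\<lambda>i. r * u i)"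
      if "r \<in> R" "x \<in> {..<n} \<rightarrow>\<^sub>E R" "\<forall>i<l. u i \<in> R" "\<phi> (?c x) = res u" for r x u
    proof -
      have "\<phi> (?c (\<lambda>v\<in>{..<n}. r * x v)) = \<phi> (r \<odot>\<^bsub>?Q\<^esub> ?c x)" unfolding Q(3)[OF that(1,2)] ..
      also have "\<dots> = r \<odot>\<^bsub>?D\<^esub> \<phi> (?c x)" using that(1) by (intro module_hom_smult[OF hom _ cQ[OF that(2)]]) simp
      also have "\<dots> = res (\<lambda>i. r * u i)" unfolding that(4) using that by (intro D(3)) auto
      finally show ?thesis .
    qed
  qed (rule that)
  have "\<exists>x \<in> {..<n} \<rightarrow>\<^sub>E R. \<phi> (?c x) = res (\<lambda>i. if i = j then 1 else 0)" for j
  proof -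
    have "res (\<lambda>i. if i = j then 1 else 0) \<in> carrier ?D" unfolding D(1) by (intro exI conjI) auto
    also have "carrier ?D = \<phi> ` carrier ?Q" using bij by (simp add: bij_betw_def)
    finally show ?thesis unfolding Q(1) by auto
  qed
  then obtain b where b: "\<And>j. b j \<in> {..<n} \<rightarrow>\<^sub>E R" "\<And>j. \<phi> (?c (b j)) = res (\<lambda>i. if i = j then 1 else 0)" by metis
  have lin: "(\<Sum>k<n. a' k i * x k) \<in> R" if "i < l" "\<And>k. k < n \<Longrightarrow> x k \<in> R" for i x
    using that a'(1) by (auto intro!: sum_R mult_R)
  have bR: "b j k \<in> R" if "k < n" for j k using b(1)[of j] that by auto
  show ?thesis
  proof (rule ideal_product_invariant[OF I J])
    show "a' k i \<in> R" if "i < l" "k < n" for i k using a'(1) that by simp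
    show "b j k \<in> R" if "k < n" "j < l" for k j by (rule bR[OF that(1)])
    show "(\<forall>k<n. x k \<in> I k) = (\<forall>i<l. (\<Sum>k<n. a' k i * x k) \<in> J i)" if x: "\<And>k. k < n \<Longrightarrow> x k \<in> R" for x
    proof -
      define x' where "x' = (\<lambda>v\<in>{..<n}. x v)"
      have x': "x' \<in> {..<n} \<rightarrow>\<^sub>E R" unfolding x'_def using x by (intro restrict_Rn)
      let ?z = "\<lambda>v\<in>{..<n}. 0 :: 'k"
      have z: "?z \<in> {..<n} \<rightarrow>\<^sub>E R" by (intro restrict_Rn zero_R)
      have "(\<forall>k<n. x k \<in> I k) \<longleftrightarrow> ?c x' = ?c ?z"
        using box_coset_eq_iff[where I = I, OF I' ids' x' z] unfolding x'_def by simp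
      also have "\<dots> \<longleftrightarrow> \<phi> (?c x') = \<phi> (?c ?z)"
        using inj_on_eq_iff[OF bij_betw_imp_inj_on[OF bij] cQ[OF x'] cQ[OF z]] by simp
      also have "\<dots> \<longleftrightarrow> res (\<lambda>i. \<Sum>k<n. a' k i * x' k) = res (\<lambda>i. \<Sum>k<n. a' k i * ?z k)"
        unfolding \<phi>c[OF x'] \<phi>c[OF z] ..
      also have "\<dots> \<longleftrightarrow> (\<forall>i<l. (\<Sum>k<n. a' k i * x' k) - (\<Sum>k<n. a' k i * ?z k) \<in> J i)"
        using lin[of _ x'] lin[of _ ?z] x' by (intro D(4)) auto
      finally show ?thesis unfolding x'_def by simp
    qed
    show "(\<Sum>k<n. a' k i * b j k) - (if i = j then 1 else 0) \<in> J i" if "i < l" "j < l" for i j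
    proof -
      have "res (\<lambda>i. \<Sum>k<n. a' k i * b j k) = res (\<lambda>i. if i = j then 1 else 0)"
        using \<phi>c[OF b(1)] b(2) by simp
      then have "\<forall>i<l. (\<Sum>k<n. a' k i * b j k) - (if i = j then 1 else 0) \<in> J i"
        using lin bR by (subst (asm) D(4)) auto
      then show ?thesis using that by simp
    qed
  qed
qed

lemma ideal_product_principal:
  assumes "\<alpha> \<in> R" shows "ideal_product n (\<lambda>_. (*) \<alpha> ` R) = (*) (\<alpha> ^ n) ` R"
proof (induct n)
  case 0 then show ?case by simp
next
  case (Suc n)
  have "ideal_product (Suc n) (\<lambda>_. (*) \<alpha> ` R) = ((*) \<alpha> ` R) \<star> ((*) (\<alpha> ^ n) ` R)"
    using ideal_product_Suc[of n "\<lambda>_. (*) \<alpha> ` R"] ideal_principal[OF assms] Suc by simp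
  also have "\<dots> = (*) (\<alpha> ^ Suc n) ` R"
  proof
    show "((*) \<alpha> ` R) \<star> ((*) (\<alpha> ^ n) ` R) \<subseteq> (*) (\<alpha> ^ Suc n) ` R"
    proof (rule iprod_subset[OF ideal_principal])
      show "\<alpha> ^ Suc n \<in> R" using assms by (rule power_R)
      fix x y assume "x \<in> (*) \<alpha> ` R" "y \<in> (*) (\<alpha> ^ n) ` R"
      then obtain u v where "x = \<alpha> * u" "y = \<alpha> ^ n * v" "u \<in> R" "v \<in> R" by auto
      then have "x * y = \<alpha> ^ Suc n * (u * v)" "u * v \<in> R" using mult_R by auto
      then show "x * y \<in> (*) (\<alpha> ^ Suc n) ` R" by (rule image_eqI)
    qed
    show "(*) (\<alpha> ^ Suc n) ` R \<subseteq> ((*) \<alpha> ` R) \<star> ((*) (\<alpha> ^ n) ` R)"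
    proof
      fix x assume "x \<in> (*) (\<alpha> ^ Suc n) ` R"
      then obtain u where u: "x = \<alpha> * u * (\<alpha> ^ n * 1)" "u \<in> R" by (auto simp: algebra_simps)
      have "\<alpha> * u \<in> (*) \<alpha> ` R" "\<alpha> ^ n * 1 \<in> (*) (\<alpha> ^ n) ` R" using u(2) one_R by blast+
      then show "x \<in> ((*) \<alpha> ` R) \<star> ((*) (\<alpha> ^ n) ` R)" unfolding u(1) by (rule iprodI)
    qed
  qed
  finally show ?case .
qed

text \<open>For the existence of a decomposition, the index \<open>t < nl\<close> stands for the coordinate \<open>t div l\<close> and the
prime power number \<open>t mod l\<close> of the \<open>l\<close> prime powers that divide \<open>\<alpha>\<close>. The product of the ideals in any
decomposition is \<open>(\<alpha>)\<^sup>n\<close> by \<open>quot_box_dsum_invariant\<close>, applied to \<open>n\<close> copies of the ideal \<open>(\<alpha>)\<close>.\<close>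

lemma chi_free_module:
  assumes \<alpha>: "\<alpha> \<in> R" "\<alpha> \<noteq> 0"
  shows "chi R (quot_module (ring_on R ^^^ n) ((\<lambda>x. \<alpha> \<odot>\<^bsub>class_ring ^^^ n\<^esub> x) ` carrier (ring_on R ^^^ n))) = (*) (\<alpha> ^ n) ` R"
proof -
  let ?I = "\<lambda>_. (*) \<alpha> ` R"
  have id\<alpha>: "ideal_of_R ((*) \<alpha> ` R)" by (rule ideal_principal[OF \<alpha>(1)])
  have smult: "\<alpha> \<odot>\<^bsub>class_ring ^^^ n\<^esub> x = (\<lambda>v\<in>{..<n}. \<alpha> * x v)" for x :: "nat \<Rightarrow> 'k"
    unfolding class_ring.func_space_def by simp
  have L: "(\<lambda>x. \<alpha> \<odot>\<^bsub>class_ring ^^^ n\<^esub> x) ` carrier (ring_on R ^^^ n) = box n n (\<lambda>t. t) ?I"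
  proof
    show "(\<lambda>x. \<alpha> \<odot>\<^bsub>class_ring ^^^ n\<^esub> x) ` carrier (ring_on R ^^^ n) \<subseteq> box n n (\<lambda>t. t) ?I"
    proof
      fix z assume "z \<in> (\<lambda>x. \<alpha> \<odot>\<^bsub>class_ring ^^^ n\<^esub> x) ` carrier (ring_on R ^^^ n)"
      then obtain x where x: "x \<in> {..<n} \<rightarrow>\<^sub>E R" and z: "z = (\<lambda>v\<in>{..<n}. \<alpha> * x v)"
        unfolding smult free_module by (elim imageE)
      have xR: "x v \<in> R" if "v < n" for v using x that by auto
      have "z \<in> {..<n} \<rightarrow>\<^sub>E R" unfolding z using xR \<alpha>(1) by (intro restrict_Rn mult_R)
      moreover have "z t \<in> (*) \<alpha> ` R" if "t < n" for t
        unfolding z using that imageI[OF xR[OF that], of "(*) \<alpha>"] by simp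
      ultimately show "z \<in> box n n (\<lambda>t. t) ?I" unfolding box_def by simp
    qed
    show "box n n (\<lambda>t. t) ?I \<subseteq> (\<lambda>x. \<alpha> \<odot>\<^bsub>class_ring ^^^ n\<^esub> x) ` carrier (ring_on R ^^^ n)"
    proof
      fix z assume z: "z \<in> box n n (\<lambda>t. t) ?I"
      define x where "x = (\<lambda>v\<in>{..<n}. z v / \<alpha>)"
      have "z v / \<alpha> \<in> R" if "v < n" for v using z that \<alpha>(2) unfolding box_def by auto
      then have "x \<in> {..<n} \<rightarrow>\<^sub>E R" unfolding x_def by (intro restrict_Rn)
      moreover have "z = (\<lambda>v\<in>{..<n}. \<alpha> * x v)"
      proof
        fix v show "z v = (\<lambda>v\<in>{..<n}. \<alpha> * x v) v"
          using z \<alpha>(2) unfolding box_def x_def by (cases "v < n") (auto simp: PiE_def extensional_def)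
      qed
      ultimately show "z \<in> (\<lambda>x. \<alpha> \<odot>\<^bsub>class_ring ^^^ n\<^esub> x) ` carrier (ring_on R ^^^ n)"
        unfolding smult free_module by auto
    qed
  qed
  let ?Q = "quot_module (ring_on R ^^^ n) (box n n (\<lambda>t. t) ?I)"
  let ?spec = "\<lambda>J. \<exists>l P e. (\<forall>i<l. primeideal (P i) (ring_on R) \<and> P i \<noteq> {0} \<and> 0 < (e i :: nat)) \<and>
    module_isos (ring_on R) ?Q (dsum_module l (\<lambda>i. quot_module (self_module (ring_on R)) (P i ^\<^sub>R e i))) \<noteq> {} \<and>
    J = ideal_product l (\<lambda>i. P i ^\<^sub>R e i)"
  have uniq: "J = (*) (\<alpha> ^ n) ` R" if J: "?spec J" for J
  proof -
    obtain l P e \<phi> where P: "\<forall>i<l. nonzero_prime (P i) \<and> 0 < (e i :: nat)" and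
      \<phi>: "\<phi> \<in> module_isos (ring_on R) ?Q (dsum_module l (\<lambda>i. quot_module (self_module (ring_on R)) (P i ^\<^sub>R e i)))"
      and "J = ideal_product l (\<lambda>i. P i ^\<^sub>R e i)"
      using J by blast
    then have "J = ideal_product l (\<lambda>i. P i ^\<^sub>R e i)" by simp
    also have "\<dots> = ideal_product n ?I"
      using P primeD(1) ideal_ideal_power id\<alpha> by (intro quot_box_dsum_invariant[OF _ _ \<phi>, symmetric]) auto
    finally show ?thesis using ideal_product_principal[OF \<alpha>(1)] by simp
  qed
  obtain l P e where P: "\<And>i. i < l \<Longrightarrow> nonzero_prime (P i)" "\<And>i. i < l \<Longrightarrow> 0 < (e i :: nat)"
    "\<And>i. i < l \<Longrightarrow> ideal_of_R (P i ^\<^sub>R e i)"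
    "\<And>i j. i < l \<Longrightarrow> j < l \<Longrightarrow> i \<noteq> j \<Longrightarrow> comaximal (P i ^\<^sub>R e i) (P j ^\<^sub>R e j)"
    "(*) \<alpha> ` R = ideal_product l (\<lambda>i. P i ^\<^sub>R e i)"
    using prime_power_decomposition[OF id\<alpha> principal_nonzero[OF \<alpha>(2)]] by blast
  have \<alpha>P: "(*) \<alpha> ` R = {x \<in> R. \<forall>i<l. x \<in> P i ^\<^sub>R e i}"
    using P(5) chinese_remainder(2)[OF P(3,4)] by simp
  define P' where "P' t = P (t mod l)" for t
  define e' where "e' t = e (t mod l)" for t
  have tl: "t mod l < l" "t div l < n" if "t < n * l" for t
    using that by (auto simp: less_mult_imp_div_less) (metis mod_less_divisor gr0I mult_0_right not_less0)
  have id': "ideal_of_R (P' t ^\<^sub>R e' t)" if "t < n * l" for t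
    unfolding P'_def e'_def using P(3) tl(1)[OF that] by simp
  have "box n n (\<lambda>t. t) ?I = box n (n * l) (\<lambda>t. t div l) (\<lambda>t. P' t ^\<^sub>R e' t)"
  proof -
    have "(\<forall>t<n. x t \<in> (*) \<alpha> ` R) \<longleftrightarrow> (\<forall>t<n * l. x (t div l) \<in> P' t ^\<^sub>R e' t)" if x: "x \<in> {..<n} \<rightarrow>\<^sub>E R" for x
    proof
      assume "\<forall>t<n. x t \<in> (*) \<alpha> ` R"
      then show "\<forall>t<n * l. x (t div l) \<in> P' t ^\<^sub>R e' t" unfolding \<alpha>P P'_def e'_def using tl by auto
    next
      assume r: "\<forall>t<n * l. x (t div l) \<in> P' t ^\<^sub>R e' t"
      have "x k \<in> P i ^\<^sub>R e i" if "k < n" "i < l" for k i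
      proof -
        have "k * l + i < n * l" using that by (metis add.commute add_less_cancel_left less_le_trans mult.commute mult_Suc mult_le_mono2 Suc_leI add_less_mono)
        then show ?thesis using r[rule_format, of "k * l + i"] that unfolding P'_def e'_def by simp
      qed
      then show "\<forall>t<n. x t \<in> (*) \<alpha> ` R" unfolding \<alpha>P using x by auto
    qed
    then show ?thesis unfolding box_def by auto
  qed
  moreover have "module_isos (ring_on R) (quot_module (ring_on R ^^^ n) (box n (n * l) (\<lambda>t. t div l) (\<lambda>t. P' t ^\<^sub>R e' t)))
     (dsum_module (n * l) (\<lambda>t. quot_module (self_module (ring_on R)) (P' t ^\<^sub>R e' t))) \<noteq> {}"
  proof (rule quot_box_isomorphic_dsum[OF id' tl(2)])
    fix y :: "nat \<Rightarrow> 'k" assume y: "\<And>t. t < n * l \<Longrightarrow> y t \<in> R"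
    have "\<exists>x\<in>R. \<forall>i<l. x - y (k * l + i) \<in> P i ^\<^sub>R e i" if "k < n" for k
    proof (rule chinese_remainder(1)[OF P(3,4)])
      show "\<forall>i<l. y (k * l + i) \<in> R"
      proof (intro allI impI)
        fix i assume "i < l"
        have "k * l + i < Suc k * l" using \<open>i < l\<close> by simp
        also have "\<dots> \<le> n * l" using that by (intro mult_right_mono) auto
        finally show "y (k * l + i) \<in> R" by (rule y)
      qed
    qed auto
    then obtain x where x: "\<And>k. k < n \<Longrightarrow> x k \<in> R" "\<And>k i. k < n \<Longrightarrow> i < l \<Longrightarrow> x k - y (k * l + i) \<in> P i ^\<^sub>R e i"
      by metis
    show "\<exists>x \<in> {..<n} \<rightarrow>\<^sub>E R. \<forall>t<n * l. x (t div l) - y t \<in> P' t ^\<^sub>R e' t"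
    proof (intro bexI[of _ "\<lambda>v\<in>{..<n}. x v"] restrict_Rn x(1) allI impI)
      fix t assume t: "t < n * l"
      show "(\<lambda>v\<in>{..<n}. x v) (t div l) - y t \<in> P' t ^\<^sub>R e' t"
        using x(2)[OF tl(2,1)[OF t]] tl(2)[OF t] unfolding P'_def e'_def by simp
    qed
  qed
  ultimately have "?spec (ideal_product (n * l) (\<lambda>t. P' t ^\<^sub>R e' t))"
    using P(1,2) tl(1) unfolding P'_def e'_def
    by (intro exI[of _ "n * l"] exI[of _ "\<lambda>t. P (t mod l)"] exI[of _ "\<lambda>t. e (t mod l)"]) auto
  note ex = this
  have eq: "ideal_product (n * l) (\<lambda>t. P' t ^\<^sub>R e' t) = (*) (\<alpha> ^ n) ` R" by (rule uniq[OF ex])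
  show ?thesis unfolding L chi_def
  proof (rule the_equality)
    show "?spec ((*) (\<alpha> ^ n) ` R)" using ex unfolding eq .
  qed (rule uniq)
qed

end

section \<open>The covolume of the free lattice\<close>

locale normed_dedekind = dedekind R for R :: "'k::field set" +
  fixes N :: "'k set \<Rightarrow> real"
  assumes ideal_norm: "ideal_norm R N"
begin

lemma norm_ge_1: "ideal_of_R I \<Longrightarrow> I \<noteq> {0} \<Longrightarrow> 1 \<le> N I"
  and norm_mult: "ideal_of_R I \<Longrightarrow> I \<noteq> {0} \<Longrightarrow> ideal_of_R J \<Longrightarrow> J \<noteq> {0} \<Longrightarrow> N (I \<star> J) = N I * N J"
  using ideal_norm unfolding ideal_norm_def by auto

lemma norm_principal_pos: "a \<in> R \<Longrightarrow> a \<noteq> 0 \<Longrightarrow> 0 < N ((*) a ` R)"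
  using norm_ge_1[OF ideal_principal principal_nonzero, of a] by simp

text \<open>The norm is multiplicative, so the denominator chosen in the definition of \<open>frac_norm\<close> cancels.\<close>

lemma frac_norm_ideal:
  assumes "ideal_of_R I" "I \<noteq> {0}"
  shows "frac_norm R N I = N I"
proof -
  define a where "a = (SOME a. a \<in> R \<and> a \<noteq> 0 \<and> (*) a ` I \<subseteq> R)"
  have "\<exists>a. a \<in> R \<and> a \<noteq> 0 \<and> (*) a ` I \<subseteq> R"
    using idealD(1)[OF assms(1)] by (intro exI[of _ 1]) auto
  then have a: "a \<in> R \<and> a \<noteq> 0 \<and> (*) a ` I \<subseteq> R" unfolding a_def by (rule someI_ex)
  then have aR: "a \<in> R" "a \<noteq> 0" by auto
  have "((*) a ` R) \<star> I = (*) a ` I"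
  proof
    show "((*) a ` R) \<star> I \<subseteq> (*) a ` I"
    proof (rule iprod_subset[OF ideal_image[OF aR(1) assms(1)]])
      fix x y assume "x \<in> (*) a ` R" and y: "y \<in> I"
      then obtain r where r: "x = a * r" "r \<in> R" by auto
      have "x * y = a * (r * y)" using r by simp
      then show "x * y \<in> (*) a ` I" using idealD(4)[OF assms(1) r(2) y] by (rule image_eqI)
    qed
    show "(*) a ` I \<subseteq> ((*) a ` R) \<star> I"
    proof
      fix x assume "x \<in> (*) a ` I"
      then obtain y where "x = a * y" "y \<in> I" by (elim imageE)
      then have y: "x = a * 1 * y" "y \<in> I" by simp_all
      have "a * 1 \<in> (*) a ` R" using one_R by blast
      then show "x \<in> ((*) a ` R) \<star> I" unfolding y(1) using y(2) by (rule iprodI)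
    qed
  qed
  then have "N ((*) a ` I) = N ((*) a ` R) * N I"
    using norm_mult[OF ideal_principal[OF aR(1)] principal_nonzero[OF aR(2)] assms] by simp
  then show ?thesis
    unfolding frac_norm_def a_def[symmetric] Let_def PIdl_eq[OF aR(1)] using norm_principal_pos[OF aR] by simp
qed

lemma elt_norm_ge_1:
  assumes "x \<in> R" "x \<noteq> 0" shows "1 \<le> elt_norm R N x"
  using frac_norm_ideal[OF ideal_principal[OF assms(1)] principal_nonzero[OF assms(2)]]
    norm_ge_1[OF ideal_principal[OF assms(1)] principal_nonzero[OF assms(2)]] assms(2)
  unfolding elt_norm_def by simp

lemma Covol_free_module: "Covol R N n (carrier (ring_on R ^^^ n)) = 1"
proof -
  let ?L = "carrier (ring_on R ^^^ n)"
  define \<alpha> where "\<alpha> = (SOME \<alpha>. \<alpha> \<in> R \<and> \<alpha> \<noteq> 0 \<and> (\<lambda>x. \<alpha> \<odot>\<^bsub>class_ring ^^^ n\<^esub> x) ` ?L \<subseteq> carrier (ring_on R ^^^ n))"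
  have "(\<lambda>x. 1 \<odot>\<^bsub>class_ring ^^^ n\<^esub> x) ` ?L \<subseteq> ?L"
    unfolding free_module class_ring.func_space_def by (auto simp: PiE_def)
  then have "\<exists>\<alpha>. \<alpha> \<in> R \<and> \<alpha> \<noteq> 0 \<and> (\<lambda>x. \<alpha> \<odot>\<^bsub>class_ring ^^^ n\<^esub> x) ` ?L \<subseteq> ?L"
    using one_R zero_neq_one by metis
  then have "\<alpha> \<in> R \<and> \<alpha> \<noteq> 0 \<and> (\<lambda>x. \<alpha> \<odot>\<^bsub>class_ring ^^^ n\<^esub> x) ` ?L \<subseteq> ?L" unfolding \<alpha>_def by (rule someI_ex)
  then have \<alpha>: "\<alpha> \<in> R" "\<alpha> \<noteq> 0" by auto
  have "chi_lattice R n ?L = (\<lambda>y. inverse (\<alpha> ^ n) * y) ` (*) (\<alpha> ^ n) ` R"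
    unfolding chi_lattice_def \<alpha>_def[symmetric] Let_def chi_free_module[OF \<alpha>] ..
  also have "\<dots> = (\<lambda>y. y) ` R"
    unfolding image_image using \<alpha>(2) by (intro image_cong) (auto simp: field_simps)
  finally have "Covol R N n ?L = frac_norm R N R" unfolding Covol_def by simp
  also have "\<dots> = N R"
    using principal_nonzero[of 1] by (intro frac_norm_ideal ideal_R) simp
  also have "\<dots> = 1"
  proof -
    have "R \<noteq> {0}" using one_R by (metis singletonD zero_neq_one)
    then show ?thesis using ideal_norm ideal_R unfolding ideal_norm_def by blast
  qed
  finally show ?thesis .
qed

end

context dedekind begin

lemma class_free_module:
  fixes x y :: "nat \<Rightarrow> 'k"
  shows "carrier (class_ring ^^^ n :: ('k, nat \<Rightarrow> 'k) module) = ({..<n} \<rightarrow>\<^sub>E UNIV)"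
    and "x \<oplus>\<^bsub>class_ring ^^^ n\<^esub> y = (\<lambda>v\<in>{..<n}. x v + y v)"
    and "r \<odot>\<^bsub>class_ring ^^^ n\<^esub> x = (\<lambda>v\<in>{..<n}. r * x v)"
    and "\<zero>\<^bsub>class_ring ^^^ n\<^esub> = (\<lambda>v\<in>{..<n}. 0 :: 'k)"
  unfolding class_ring.func_space_def by simp_all

lemma module_class_free_module: "Module.module class_ring (class_ring ^^^ n :: ('k, nat \<Rightarrow> 'k) module)"
proof -
  have "cring (class_ring :: 'k ring)" by unfold_locales (auto simp: mult.commute)
  then show ?thesis by (rule cring.func_space_is_module)
qed

lemma module_over_R: "Module.module (ring_on R) (class_ring ^^^ n :: ('k, nat \<Rightarrow> 'k) module)"
proof -
  interpret V: Module.module class_ring "class_ring ^^^ n :: ('k, nat \<Rightarrow> 'k) module" by (rule module_class_free_module)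
  show ?thesis
    by (rule module.intro[OF A.is_cring], rule V.abelian_group_axioms)
      (use V.smult_closed V.smult_l_distr V.smult_r_distr V.smult_assoc1 V.smult_one in
        \<open>simp add: module_axioms_def\<close>)
qed

lemma finsum_class_free_module:
  fixes f :: "'b \<Rightarrow> nat \<Rightarrow> 'k"
  assumes "finite B" "\<And>v. v \<in> B \<Longrightarrow> f v \<in> {..<n} \<rightarrow>\<^sub>E UNIV"
  shows "finsum (class_ring ^^^ n) f B = (\<lambda>i\<in>{..<n}. \<Sum>v\<in>B. f v i)"
proof -
  interpret V: Module.module class_ring "class_ring ^^^ n :: ('k, nat \<Rightarrow> 'k) module" by (rule module_class_free_module)
  show ?thesis using assms
  proof (induct B)
    case empty then show ?case by (simp add: class_free_module)
  next
    case (insert b B)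
    then have "finsum (class_ring ^^^ n) f (insert b B) = f b \<oplus>\<^bsub>class_ring ^^^ n\<^esub> finsum (class_ring ^^^ n) f B"
      by (intro V.finsum_insert) (auto simp: class_free_module)
    also have "\<dots> = (\<lambda>i\<in>{..<n}. \<Sum>v\<in>insert b B. f v i)"
      using insert by (auto simp: class_free_module intro!: restrict_ext)
    finally show ?case .
  qed
qed

lemma in_span_unit_vectors:
  assumes Q: "Module.module Q (class_ring ^^^ n :: ('k, nat \<Rightarrow> 'k) module)"
    and x: "x \<in> {..<n} \<rightarrow>\<^sub>E carrier Q" and S: "unit_vector n ` {..<n} \<subseteq> S"
  shows "x \<in> LinearCombinations.module.span Q (class_ring ^^^ n) S"
proof -
  let ?e = "unit_vector n"
  have inj: "inj_on ?e {..<n}"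
  proof (rule inj_onI)
    fix j k assume j: "j \<in> {..<n}" and "?e j = ?e k"
    then have "?e j j = ?e k j" by simp
    then show "j = k" using j by (simp add: unit_vector_def split: if_splits)
  qed
  define a where "a v = x (inv_into {..<n} ?e v)" for v
  have a: "a (?e k) = x k" if "k < n" for k using that inv_into_f_f[OF inj] unfolding a_def by simp
  have "finsum (class_ring ^^^ n) (\<lambda>v. a v \<odot>\<^bsub>class_ring ^^^ n\<^esub> v) (?e ` {..<n}) =
    (\<lambda>i\<in>{..<n}. \<Sum>v\<in>?e ` {..<n}. (\<lambda>i\<in>{..<n}. a v * v i) i)"
    unfolding class_free_module by (intro finsum_class_free_module) auto
  also have "\<dots> = x"
  proof
    fix i
    show "(\<lambda>i\<in>{..<n}. \<Sum>v\<in>?e ` {..<n}. (\<lambda>i\<in>{..<n}. a v * v i) i) i = x i"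
    proof (cases "i < n")
      case True
      then have "(\<Sum>v\<in>?e ` {..<n}. a v * v i) = (\<Sum>k<n. a (?e k) * ?e k i)"
        by (subst sum.reindex[OF inj]) simp
      also have "\<dots> = (\<Sum>k<n. if k = i then x i else 0)"
        using True a by (intro sum.cong) (auto simp: unit_vector_def)
      finally show ?thesis using True by simp
    next
      case False then show ?thesis using x by (auto simp: PiE_def extensional_def)
    qed
  qed
  finally have "LinearCombinations.module.lincomb (class_ring ^^^ n) a (?e ` {..<n}) = x"
    unfolding LinearCombinations.module.lincomb_def[OF Q] .
  note sum = this[symmetric]
  have "a \<in> ?e ` {..<n} \<rightarrow> carrier Q"
  proof (intro Pi_I, elim imageE)
    fix v k assume "v = ?e k" "k \<in> {..<n}"
    then show "a v \<in> carrier Q" using a[of k] x by auto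
  qed
  then show ?thesis
    unfolding LinearCombinations.module.span_def[OF Q] using S
    by (intro CollectI exI[of _ a] exI[of _ "?e ` {..<n}"] conjI sum) simp_all
qed

lemma lattice_free_module: "lattice_in R n (carrier (ring_on R ^^^ n))"
  unfolding lattice_in_def
proof (intro conjI exI)
  let ?S = "unit_vector n ` {..<n}"
  let ?V = "class_ring ^^^ n :: ('k, nat \<Rightarrow> 'k) module"
  show "finite ?S" by simp
  show "?S \<subseteq> carrier ?V" unfolding class_free_module unit_vector_def
    by (intro image_subsetI restrict_PiE_iff[THEN iffD2]) simp
  show "carrier (ring_on R ^^^ n) = LinearCombinations.module.span (ring_on R) ?V ?S"
  proof
    show "carrier (ring_on R ^^^ n) \<subseteq> LinearCombinations.module.span (ring_on R) ?V ?S"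
      unfolding free_module using in_span_unit_vectors[OF module_over_R] by auto
    show "LinearCombinations.module.span (ring_on R) ?V ?S \<subseteq> carrier (ring_on R ^^^ n)"
    proof
      fix x assume "x \<in> LinearCombinations.module.span (ring_on R) ?V ?S"
      then obtain a B where B: "finite B" "B \<subseteq> ?S" "a \<in> B \<rightarrow> R"
        and "x = LinearCombinations.module.lincomb ?V a B"
        unfolding LinearCombinations.module.span_def[OF module_over_R] by auto
      then have "x = finsum ?V (\<lambda>v. a v \<odot>\<^bsub>?V\<^esub> v) B"
        using LinearCombinations.module.lincomb_def[OF module_over_R] by metis
      also have "\<dots> = (\<lambda>i\<in>{..<n}. \<Sum>v\<in>B. (\<lambda>i\<in>{..<n}. a v * v i) i)"
        unfolding class_free_module using B(1) by (intro finsum_class_free_module) auto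
      also have "\<dots> \<in> {..<n} \<rightarrow>\<^sub>E R"
      proof (rule restrict_Rn, rule sum_R)
        fix i v assume "i < n" "v \<in> B"
        then show "(\<lambda>i\<in>{..<n}. a v * v i) i \<in> R"
          using B(2,3) unfolding unit_vector_def by (auto intro!: mult_R)
      qed
      finally show "x \<in> carrier (ring_on R ^^^ n)" unfolding free_module .
    qed
  qed
  show "LinearCombinations.module.span class_ring ?V (carrier (ring_on R ^^^ n)) = carrier ?V"
  proof
    have "carrier (ring_on R ^^^ n) \<subseteq> carrier ?V" unfolding free_module class_free_module by auto
    then show "LinearCombinations.module.span class_ring ?V (carrier (ring_on R ^^^ n)) \<subseteq> carrier ?V"
      using LinearCombinations.module.span_is_subset2[OF module_class_free_module] by simp
    have "?S \<subseteq> carrier (ring_on R ^^^ n)" unfolding free_module by (intro image_subsetI unit_vector_in_Rn)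
    then show "carrier ?V \<subseteq> LinearCombinations.module.span class_ring ?V (carrier (ring_on R ^^^ n))"
      using in_span_unit_vectors[OF module_class_free_module] unfolding class_free_module by auto
  qed
qed

section \<open>Unimodular reduction modulo an element\<close>

definition over_R :: "'k mat \<Rightarrow> bool"
  where "over_R X \<longleftrightarrow> (\<forall>i<dim_row X. \<forall>k<dim_col X. X $$ (i, k) \<in> R)"

lemma over_R_mult:
  assumes "over_R X" "over_R Y" "dim_col X = dim_row Y"
  shows "over_R (X * Y)"
  unfolding over_R_def
proof (intro allI impI)
  fix i k assume ik: "i < dim_row (X * Y)" "k < dim_col (X * Y)"
  then have "(X * Y) $$ (i, k) = (\<Sum>j = 0..<dim_row Y. X $$ (i, j) * Y $$ (j, k))"
    using assms(3) by (simp add: scalar_prod_def)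
  also have "\<dots> \<in> R" using assms ik unfolding over_R_def by (intro sum_R mult_R) auto
  finally show "(X * Y) $$ (i, k) \<in> R" .
qed

lemma det_over_R:
  assumes "X \<in> carrier_mat n n" "over_R X" shows "det X \<in> R"
proof -
  have "of_int (sign p) \<in> R" for p :: "nat \<Rightarrow> nat" unfolding sign_def using minus_R[OF one_R] by simp
  moreover have "(\<Prod>i = 0..<n. X $$ (i, p i)) \<in> R" if "p permutes {0..<n}" for p
  proof (rule prod_R)
    fix i assume i: "i \<in> {0..<n}"
    then have "p i \<in> {0..<n}" using permutes_in_image[OF that] by simp
    then show "X $$ (i, p i) \<in> R" using assms i unfolding over_R_def by auto
  qed
  ultimately show ?thesis unfolding det_def'[OF assms(1)] by (intro sum_R mult_R) auto
qed

text \<open>This makes the inverse of a matrix over \<open>R\<close> of determinant one a matrix over \<open>R\<close>.\<close>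

lemma over_R_adj_mat:
  assumes "X \<in> carrier_mat n n" "over_R X" shows "over_R (adj_mat X)"
proof -
  have "cofactor X k i \<in> R" if "i < n" "k < n" for i k
  proof -
    have "mat_delete X k i \<in> carrier_mat (n - 1) (n - 1)" using assms(1) by (auto simp: mat_delete_def)
    moreover have "over_R (mat_delete X k i)"
      using assms that unfolding over_R_def mat_delete_def by auto
    ultimately have "det (mat_delete X k i) \<in> R" by (rule det_over_R)
    moreover have "(-1) ^ (k + i) \<in> R" by (rule power_R[OF minus_R[OF one_R]])
    ultimately show ?thesis unfolding cofactor_def by (rule mult_R[rotated])
  qed
  then show ?thesis using assms(1) unfolding over_R_def adj_mat_def by simp
qed

text \<open>Elimination by integral column operations. The matrix \<open>C\<close> is a right inverse of \<open>B\<close> modulo \<open>d\<close>. Suppose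
that rows \<open>0, \<dots>, m - 1\<close> of \<open>BT\<close> are lower triangular modulo \<open>d\<close> with units on the diagonal, and let \<open>h\<close> be
column \<open>m\<close> of \<open>T\<^sup>-\<^sup>1C\<close>. Forward substitution shows that the first \<open>m\<close> entries of \<open>h\<close> lie in \<open>(d)\<close>, so the
entries of row \<open>m\<close> of \<open>BT\<close> from the diagonal on are unimodular modulo \<open>d\<close>. By \<open>stable_range\<close> the diagonal
entry becomes a unit when a combination of the later columns is added to column \<open>m\<close>; afterwards it
clears the entries to its right.\<close>

lemma triangularize_mod:
  assumes d: "d \<in> R" "d \<noteq> 0"
    and B: "B \<in> carrier_mat r n" "over_R B" and C: "C \<in> carrier_mat n r" "over_R C"
    and BC: "\<And>i j. i < r \<Longrightarrow> j < r \<Longrightarrow> (B * C) $$ (i, j) - (if i = j then 1 else 0) \<in> (*) d ` R"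
    and "m \<le> r" "r \<le> n"
  shows "\<exists>T. T \<in> carrier_mat n n \<and> over_R T \<and> det T = 1 \<and>
    (\<forall>i<m. (\<forall>k. i < k \<and> k < n \<longrightarrow> (B * T) $$ (i, k) \<in> (*) d ` R) \<and>
      (\<exists>w\<in>R. w * (B * T) $$ (i, i) - 1 \<in> (*) d ` R))"
  using \<open>m \<le> r\<close>
proof (induct m)
  case 0
  show ?case by (rule exI[of _ "1\<^sub>m n"]) (auto simp: over_R_def)
next
  case (Suc m)
  define D where "D = (*) d ` R"
  have D: "ideal_of_R D" unfolding D_def by (rule ideal_principal[OF d(1)])
  have mn: "m < n" "m < r" using Suc(2) \<open>r \<le> n\<close> by auto
  obtain T where T: "T \<in> carrier_mat n n" "over_R T" "det T = 1"
    and low: "\<And>i k. i < m \<Longrightarrow> i < k \<Longrightarrow> k < n \<Longrightarrow> (B * T) $$ (i, k) \<in> D"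
    and unit: "\<And>i. i < m \<Longrightarrow> \<exists>w\<in>R. w * (B * T) $$ (i, i) - 1 \<in> D"
    using Suc unfolding D_def by auto
  define G where "G = B * T"
  have G: "G \<in> carrier_mat r n" unfolding G_def using B T by auto
  have GR: "G $$ (i, k) \<in> R" if "i < r" "k < n" for i k
    using over_R_mult[OF B(2) T(2)] B(1) T(1) G that unfolding over_R_def G_def by auto
  define S where "S = adj_mat T"
  have S: "S \<in> carrier_mat n n" "T * S = 1\<^sub>m n" "over_R S"
    unfolding S_def using adj_mat[OF T(1)] T over_R_adj_mat by auto
  define h where "h k = (S * C) $$ (k, m)" for k
  have hR: "h k \<in> R" if "k < n" for k
    using over_R_mult[OF S(3) C(2)] S(1) C(1) that mn unfolding over_R_def h_def by auto
  have Gh: "(\<Sum>k = 0..<n. G $$ (i, k) * h k) - (if i = m then 1 else 0) \<in> D" if "i < r" for i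
  proof -
    have "G * (S * C) = B * C"
    proof -
      have "G * (S * C) = B * (T * (S * C))" unfolding G_def using B T S C by (intro assoc_mult_mat) auto
      also have "T * (S * C) = (T * S) * C" using T S C by (intro assoc_mult_mat[symmetric]) auto
      finally show ?thesis using S(2) C(1) by simp
    qed
    then have "(B * C) $$ (i, m) = (G * (S * C)) $$ (i, m)" by simp
    also have "\<dots> = (\<Sum>k = 0..<n. G $$ (i, k) * h k)"
      using that mn G S C unfolding h_def by (auto simp: scalar_prod_def intro!: sum.cong)
    finally show ?thesis using BC[OF that mn(2)] unfolding D_def by simp
  qed
  have split: "(\<Sum>k = 0..<n. f k) = (\<Sum>k<i. f k) + f i + (\<Sum>k\<in>{i<..<n}. f k)" if "i < n" for i and f :: "nat \<Rightarrow> 'k"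
  proof -
    have "{0..<n} = insert i ({..<i} \<union> {i<..<n})" using that by auto
    then have "sum f {0..<n} = f i + sum f ({..<i} \<union> {i<..<n})" by simp
    also have "sum f ({..<i} \<union> {i<..<n}) = sum f {..<i} + sum f {i<..<n}" by (rule sum.union_disjoint) auto
    finally show ?thesis by (simp add: algebra_simps)
  qed
  have hD: "k < m \<Longrightarrow> h k \<in> D" for k
  proof (induct k rule: less_induct)
    case (less k)
    have kn: "k < n" "k < r" using less(2) mn by auto
    have "(\<Sum>j = 0..<n. G $$ (k, j) * h j) \<in> D" using Gh[OF kn(2)] less(2) by simp
    moreover have "(\<Sum>j<k. G $$ (k, j) * h j) \<in> D"
      using less kn GR by (intro ideal_sum[OF D] idealD(4)[OF D]) auto
    moreover have "(\<Sum>j\<in>{k<..<n}. G $$ (k, j) * h j) \<in> D"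
      using low[OF less(2)] hR unfolding G_def by (intro ideal_sum[OF D] idealD(5)[OF D]) auto
    ultimately have "(\<Sum>j = 0..<n. G $$ (k, j) * h j) - (\<Sum>j<k. G $$ (k, j) * h j) - (\<Sum>j\<in>{k<..<n}. G $$ (k, j) * h j) \<in> D"
      by (intro ideal_diff[OF D])
    then have Gkk: "G $$ (k, k) * h k \<in> D" unfolding split[OF kn(1)] by simp
    obtain w where w: "w \<in> R" "w * G $$ (k, k) - 1 \<in> D" using unit[OF less(2)] unfolding G_def by auto
    have "w * (G $$ (k, k) * h k) - (w * G $$ (k, k) - 1) * h k \<in> D"
      using idealD(4)[OF D w(1) Gkk] idealD(5)[OF D hR[OF kn(1)] w(2)] by (rule ideal_diff[OF D])
    then show "h k \<in> D" by (simp add: algebra_simps)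
  qed
  define g where "g k = G $$ (m, k)" for k
  have gR: "g k \<in> R" if "k < n" for k unfolding g_def using GR[OF mn(2) that] .
  define b where "b = (\<Sum>k\<in>{m<..<n}. g k * h k)"
  have bR: "b \<in> R" unfolding b_def using gR hR by (intro sum_R mult_R) auto
  have "(\<Sum>k<m. g k * h k) \<in> D"
    using hD gR mn by (intro ideal_sum[OF D] idealD(4)[OF D]) auto
  from ideal_diff[OF D Gh[OF mn(2)] this]
  have "g m * h m + b - 1 \<in> D" unfolding split[OF mn(1)] b_def g_def by (simp add: algebra_simps)
  then obtain z where z: "z \<in> R" "g m * h m + b - 1 = d * z" unfolding D_def by auto
  have eq1: "g m * h m + b * 1 + d * (- z) = 1" using z(2) by (simp add: algebra_simps)
  obtain t s z' where tsz: "t \<in> R" "s \<in> R" "z' \<in> R" "(g m + t * b) * s + d * z' = 1"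
    using stable_range[OF d gR[OF mn(1)] bR hR[OF mn(1)] one_R minus_R[OF z(1)] eq1] by blast
  \<comment> \<open>\<open>E\<close> adds \<open>t\<close> times the combination \<open>h\<close> of the later columns to column \<open>m\<close>, and \<open>F\<close> then subtracts
    the multiple \<open>s g k\<close> of column \<open>m\<close> from each later column \<open>k\<close>.\<close>
  define E where "E = mat n n (\<lambda>(i, k). if i = k then 1 else if k = m \<and> m < i then t * h i else 0)"
  define F where "F = mat n n (\<lambda>(i, k). if i = k then 1 else if i = m \<and> m < k then - (s * g k) else 0)"
  have E: "E \<in> carrier_mat n n" "over_R E" "det E = 1"
  proof -
    show "E \<in> carrier_mat n n" unfolding E_def by simp
    then show "det E = 1" by (rule det_unit_triangular) (auto simp: E_def)
    show "over_R E" using tsz(1) hR mult_R unfolding over_R_def E_def by auto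
  qed
  have F: "F \<in> carrier_mat n n" "over_R F" "det F = 1"
  proof -
    show "F \<in> carrier_mat n n" unfolding F_def by simp
    then show "det F = 1" by (rule det_unit_triangular) (auto simp: F_def)
    show "over_R F" using tsz(2) gR minus_R mult_R unfolding over_R_def F_def by auto
  qed
  have GE: "(G * E) $$ (i, k) = G $$ (i, k) + (if k = m then t * (\<Sum>j\<in>{m<..<n}. G $$ (i, j) * h j) else 0)"
    if "i < r" "k < n" for i k
  proof -
    have "(G * E) $$ (i, k) = (\<Sum>j = 0..<n. G $$ (i, j) * E $$ (j, k))"
      using G E that by (auto simp: scalar_prod_def intro!: sum.cong)
    also have "\<dots> = (\<Sum>j = 0..<n. (if j = k then G $$ (i, k) else 0) + (if j \<in> {m<..<n} then (if k = m then t * (G $$ (i, j) * h j) else 0) else 0))"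
      using that unfolding E_def by (intro sum.cong) auto
    also have "\<dots> = G $$ (i, k) + (\<Sum>j\<in>{0..<n} \<inter> {m<..<n}. if k = m then t * (G $$ (i, j) * h j) else 0)"
      unfolding sum.distrib using that by (simp add: sum.inter_restrict)
    also have "{0..<n} \<inter> {m<..<n} = {m<..<n}" by auto
    finally show ?thesis by (auto simp: sum_distrib_left)
  qed
  define H where "H = G * E"
  have H: "H \<in> carrier_mat r n" unfolding H_def using G E by auto
  have HF: "(H * F) $$ (i, k) = H $$ (i, k) - (if m < k then H $$ (i, m) * (s * g k) else 0)"
    if "i < r" "k < n" for i k
  proof -
    have "(H * F) $$ (i, k) = (\<Sum>j = 0..<n. H $$ (i, j) * F $$ (j, k))"
      using H F that by (auto simp: scalar_prod_def intro!: sum.cong)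
    also have "\<dots> = (\<Sum>j = 0..<n. (if j = k then H $$ (i, k) else 0) + (if j = m then (if m < k then - (H $$ (i, m) * (s * g k)) else 0) else 0))"
      using that unfolding F_def by (intro sum.cong) auto
    also have "\<dots> = H $$ (i, k) + (if m < k then - (H $$ (i, m) * (s * g k)) else 0)"
      unfolding sum.distrib using that mn by simp
    finally show ?thesis by simp
  qed
  define T' where "T' = T * (E * F)"
  have BT': "B * T' = H * F"
  proof -
    have "B * T' = G * (E * F)" unfolding T'_def G_def using B T E F by (intro assoc_mult_mat[symmetric]) auto
    also have "\<dots> = H * F" unfolding H_def using G E F by (intro assoc_mult_mat[symmetric]) auto
    finally show ?thesis .
  qed
  have H_low: "H $$ (i, k) \<in> D" if i: "i < m" and k: "i < k" "k < n" for i k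
  proof -
    have "(\<Sum>j\<in>{m<..<n}. G $$ (i, j) * h j) \<in> D"
      using low[OF i] i hR unfolding G_def by (intro ideal_sum[OF D] idealD(5)[OF D]) auto
    then have "t * (\<Sum>j\<in>{m<..<n}. G $$ (i, j) * h j) \<in> D" by (rule idealD(4)[OF D tsz(1)])
    then show ?thesis using low[OF i k] i mn k GE[of i k] idealD(2,3)[OF D] unfolding H_def G_def by auto
  qed
  have Hm: "H $$ (m, m) = g m + t * b" "\<And>k. m < k \<Longrightarrow> k < n \<Longrightarrow> H $$ (m, k) = g k"
    unfolding H_def using GE[OF mn(2)] mn unfolding g_def b_def by auto
  have sgR: "s * g k \<in> R" if "k < n" for k using tsz(2) gR[OF that] by (rule mult_R)
  have "T' \<in> carrier_mat n n" unfolding T'_def using T E F by auto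
  moreover have "over_R T'" unfolding T'_def using T E F by (intro over_R_mult) auto
  moreover have "det T' = 1"
    unfolding T'_def using T E F det_mult[of T n "E * F"] det_mult[of E n F] by simp
  moreover have "(B * T') $$ (i, k) \<in> D" if i: "i < Suc m" and k: "i < k" "k < n" for i k
  proof (cases "i = m")
    case True
    have "(B * T') $$ (i, k) = g k - (g m + t * b) * (s * g k)"
      unfolding BT' using True k HF[OF mn(2) k(2)] Hm by simp
    also have "\<dots> = ((g m + t * b) * s + d * z') * g k - (g m + t * b) * (s * g k)" unfolding tsz(4) by simp
    also have "\<dots> = d * (z' * g k)" by (simp add: algebra_simps)
    also have "\<dots> \<in> D" unfolding D_def using tsz(3) gR[OF k(2)] by (intro imageI mult_R)
    finally show ?thesis .
  next
    case False
    then have im: "i < m" using i by simp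
    have "H $$ (i, m) * (s * g k) \<in> D" using idealD(5)[OF D sgR[OF k(2)] H_low[OF im im mn(1)]] .
    then show ?thesis unfolding BT' using HF[of i k] im mn k H_low[OF im k] ideal_diff[OF D] by simp
  qed
  moreover have "\<exists>w\<in>R. w * (B * T') $$ (i, i) - 1 \<in> D" if i: "i < Suc m" for i
  proof (cases "i = m")
    case True
    have "s * (B * T') $$ (m, m) - 1 = s * (g m + t * b) - ((g m + t * b) * s + d * z')"
      unfolding BT' HF[OF mn(2,1)] Hm tsz(4) by simp
    also have "\<dots> = d * (- z')" by (simp add: algebra_simps)
    also have "\<dots> \<in> D" unfolding D_def using minus_R[OF tsz(3)] by (rule imageI)
    finally show ?thesis using True tsz(2) by auto
  next
    case False
    then have im: "i < m" using i by simp
    then have "(B * T') $$ (i, i) = (B * T) $$ (i, i)"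
      unfolding BT' using HF[of i i] GE[of i i] mn unfolding H_def G_def by simp
    then show ?thesis using unit[OF im] by simp
  qed
  ultimately show ?case unfolding D_def by blast
qed

text \<open>With \<open>T\<close> from \<open>triangularize_mod\<close>, multiply the first \<open>r\<close> columns of \<open>T\<close> by \<open>d\<close>. Row \<open>i < r\<close> of \<open>BT\<close> vanishes
modulo \<open>d\<close> from column \<open>r\<close> on.\<close>

lemma kernel_matrix_mod:
  assumes d: "d \<in> R" "d \<noteq> 0" and "r \<le> n"
    and B: "\<And>i k. i < r \<Longrightarrow> k < n \<Longrightarrow> b i k \<in> R" and C: "\<And>k j. k < n \<Longrightarrow> j < r \<Longrightarrow> c k j \<in> R"
    and BC: "\<And>i j. i < r \<Longrightarrow> j < r \<Longrightarrow> (\<Sum>k<n. b i k * c k j) - (if i = j then 1 else 0) \<in> (*) d ` R"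
  obtains P where "P \<in> carrier_mat n n" "over_R P" "det P = d ^ r"
    "\<And>x i. (\<And>k. k < n \<Longrightarrow> x k \<in> R) \<Longrightarrow> i < r \<Longrightarrow> (\<Sum>k<n. b i k * (\<Sum>j<n. P $$ (k, j) * x j)) \<in> (*) d ` R"
proof -
  define Bm where "Bm = mat r n (\<lambda>(i, k). b i k)"
  define Cm where "Cm = mat n r (\<lambda>(k, j). c k j)"
  have Bm: "Bm \<in> carrier_mat r n" "over_R Bm" and Cm: "Cm \<in> carrier_mat n r" "over_R Cm"
    using B C unfolding Bm_def Cm_def over_R_def by auto
  have BCm: "(Bm * Cm) $$ (i, j) - (if i = j then 1 else 0) \<in> (*) d ` R" if "i < r" "j < r" for i j
  proof -
    have "(Bm * Cm) $$ (i, j) = (\<Sum>k = 0..<n. b i k * c k j)"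
      using that unfolding Bm_def Cm_def by (auto simp: scalar_prod_def intro!: sum.cong)
    then show ?thesis using BC[OF that] by (simp add: atLeast0LessThan)
  qed
  obtain T where T: "T \<in> carrier_mat n n" "over_R T" "det T = 1"
    and low: "\<And>i k. i < r \<Longrightarrow> i < k \<Longrightarrow> k < n \<Longrightarrow> (Bm * T) $$ (i, k) \<in> (*) d ` R"
    using triangularize_mod[OF d Bm Cm BCm order_refl \<open>r \<le> n\<close>] by blast
  define \<delta> where "\<delta> k = (if k < r then d else 1)" for k
  define P where "P = mat n n (\<lambda>(k, j). T $$ (k, j) * \<delta> j)"
  define Dg where "Dg = mat n n (\<lambda>(i, k). if i = k then \<delta> k else 0)"
  have Dg: "Dg \<in> carrier_mat n n" unfolding Dg_def by simp
  have TDg: "P = T * Dg"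
  proof (rule eq_matI)
    fix i j assume "i < dim_row (T * Dg)" "j < dim_col (T * Dg)"
    then have ij: "i < n" "j < n" using T Dg by auto
    have "(T * Dg) $$ (i, j) = (\<Sum>k = 0..<n. T $$ (i, k) * Dg $$ (k, j))"
      using T Dg ij by (auto simp: scalar_prod_def intro!: sum.cong)
    also have "\<dots> = (\<Sum>k = 0..<n. if k = j then T $$ (i, j) * \<delta> j else 0)"
      unfolding Dg_def using ij by (intro sum.cong) auto
    finally show "P $$ (i, j) = (T * Dg) $$ (i, j)" unfolding P_def using ij by simp
  qed (use T Dg in \<open>auto simp: P_def\<close>)
  have "det Dg = d ^ r"
  proof -
    have "upper_triangular Dg" unfolding Dg_def by auto
    then have "det Dg = prod_list (diag_mat Dg)" using Dg by (rule det_upper_triangular)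
    also have "diag_mat Dg = map \<delta> [0..<n]" unfolding diag_mat_def Dg_def by (auto intro: map_cong)
    also have "prod_list \<dots> = (\<Prod>k<n. \<delta> k)"
      by (subst prod.distinct_set_conv_list[symmetric]) (auto simp: atLeast0LessThan)
    also have "\<dots> = (\<Prod>k<r. d)"
      unfolding \<delta>_def using \<open>r \<le> n\<close> by (intro prod.mono_neutral_cong_right) auto
    finally show ?thesis by simp
  qed
  then have "det P = d ^ r" unfolding TDg using det_mult[OF T(1) Dg] T(3) by simp
  moreover have P: "P \<in> carrier_mat n n" unfolding P_def by simp
  moreover have "over_R P" using T d(1) mult_R unfolding over_R_def P_def \<delta>_def by auto
  moreover have "(\<Sum>k<n. b i k * (\<Sum>j<n. P $$ (k, j) * x j)) \<in> (*) d ` R"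
    if x: "\<And>k. k < n \<Longrightarrow> x k \<in> R" and i: "i < r" for x i
  proof -
    have BTj: "(Bm * T) $$ (i, j) = (\<Sum>k<n. b i k * T $$ (k, j))" if "j < n" for j
    proof -
      have "(Bm * T) $$ (i, j) = (\<Sum>k = 0..<n. b i k * T $$ (k, j))"
        using that i T unfolding Bm_def by (auto simp: scalar_prod_def intro!: sum.cong)
      then show ?thesis by (simp add: atLeast0LessThan)
    qed
    have BTR: "(Bm * T) $$ (i, j) \<in> R" if "j < n" for j
      using over_R_mult[OF Bm(2) T(2)] Bm(1) T(1) i that unfolding over_R_def by auto
    have "(\<Sum>k<n. b i k * (\<Sum>j<n. P $$ (k, j) * x j)) = (\<Sum>j<n. \<Sum>k<n. b i k * (P $$ (k, j) * x j))"
      unfolding sum_distrib_left by (rule sum.swap)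
    also have "\<dots> = (\<Sum>j<n. (Bm * T) $$ (i, j) * (\<delta> j * x j))"
      using BTj by (intro sum.cong) (auto simp: P_def sum_distrib_right mult.assoc)
    also have "\<dots> \<in> (*) d ` R"
    proof (rule ideal_sum[OF ideal_principal[OF d(1)]])
      fix j assume "j \<in> {..<n}"
      then have j: "j < n" by simp
      show "(Bm * T) $$ (i, j) * (\<delta> j * x j) \<in> (*) d ` R"
      proof (cases "j < r")
        case True
        have "(Bm * T) $$ (i, j) * (\<delta> j * x j) = d * ((Bm * T) $$ (i, j) * x j)"
          unfolding \<delta>_def using True by simp
        then show ?thesis using BTR[OF j] x[OF j] mult_R by auto
      next
        case False
        then have "(Bm * T) $$ (i, j) \<in> (*) d ` R" using low i j by simp
        then show ?thesis using False x[OF j] idealD(5)[OF ideal_principal[OF d(1)]] unfolding \<delta>_def by simp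
      qed
    qed
    finally show ?thesis .
  qed
  ultimately show thesis using that by blast
qed

section \<open>Forms that are hyperbolic modulo an ideal\<close>

lemma qf_eval_R:
  assumes "qf_over (ring_on R) n a" "\<And>i. i < n \<Longrightarrow> x i \<in> R"
  shows "qf_eval (ring_on R) n a x = (\<Sum>i<n. \<Sum>k\<in>{i..<n}. a i k * x i * x k)"
    and "qf_eval (ring_on R) n a x \<in> R"
proof -
  have t: "a i k * x i * x k \<in> R" if "i < n" "k \<in> {i..<n}" for i k
    using assms that unfolding qf_over_def by (auto intro!: mult_R)
  have "qf_eval (ring_on R) n a x = finsum (ring_on R) (\<lambda>i. finsum (ring_on R) (\<lambda>k. a i k * x i * x k) {i..<n}) {..<n}"
    unfolding qf_eval_def by simp
  also have "\<dots> = finsum (ring_on R) (\<lambda>i. \<Sum>k\<in>{i..<n}. a i k * x i * x k) {..<n}"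
  proof (rule A.add.finprod_cong')
    show "(\<lambda>i. \<Sum>k\<in>{i..<n}. a i k * x i * x k) \<in> {..<n} \<rightarrow> R"
      by (intro funcsetI sum_R t) auto
    fix i assume "i \<in> {..<n}"
    then show "finsum (ring_on R) (\<lambda>k. a i k * x i * x k) {i..<n} = (\<Sum>k\<in>{i..<n}. a i k * x i * x k)"
      by (intro finsum_R t) auto
  qed simp
  also have "\<dots> = (\<Sum>i<n. \<Sum>k\<in>{i..<n}. a i k * x i * x k)"
    by (intro finsum_R sum_R t) auto
  finally show eq: "qf_eval (ring_on R) n a x = (\<Sum>i<n. \<Sum>k\<in>{i..<n}. a i k * x i * x k)" .
  show "qf_eval (ring_on R) n a x \<in> R" unfolding eq by (intro sum_R t) auto
qed

context
  fixes I :: "'k set"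
  assumes I: "ideal_of_R I"
begin

lemma coset_residue: "x \<in> R \<Longrightarrow> I +>\<^bsub>ring_on R\<^esub> x = residue I x"
  using coset_self_module[OF I, of x] unfolding a_r_coset_def' self_module_def by simp

lemma quot_ring:
  shows "carrier (ring_on R Quot I) = residue I ` R"
    and "x \<in> R \<Longrightarrow> y \<in> R \<Longrightarrow> residue I x \<oplus>\<^bsub>ring_on R Quot I\<^esub> residue I y = residue I (x + y)"
    and "x \<in> R \<Longrightarrow> y \<in> R \<Longrightarrow> residue I x \<otimes>\<^bsub>ring_on R Quot I\<^esub> residue I y = residue I (x * y)"
    and "\<zero>\<^bsub>ring_on R Quot I\<^esub> = residue I 0"
    and "\<one>\<^bsub>ring_on R Quot I\<^esub> = residue I 1"
    and "cring (ring_on R Quot I)"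
proof -
  interpret ideal I "ring_on R" by (rule I)
  note h = rcos_ring_hom
  show "carrier (ring_on R Quot I) = residue I ` R"
    unfolding FactRing_def A_RCOSETS_def' using coset_residue by auto
  show "residue I x \<oplus>\<^bsub>ring_on R Quot I\<^esub> residue I y = residue I (x + y)" if "x \<in> R" "y \<in> R"
    using ring_hom_add[OF h, of x y] that coset_residue add_R by simp
  show "residue I x \<otimes>\<^bsub>ring_on R Quot I\<^esub> residue I y = residue I (x * y)" if "x \<in> R" "y \<in> R"
    using ring_hom_mult[OF h, of x y] that coset_residue mult_R by simp
  show "\<zero>\<^bsub>ring_on R Quot I\<^esub> = residue I 0"
    unfolding FactRing_def residue_def using idealD(1)[OF I] by auto
  show "\<one>\<^bsub>ring_on R Quot I\<^esub> = residue I 1"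
    unfolding FactRing_def using coset_residue[OF one_R] by simp
  show "cring (ring_on R Quot I)" by (rule quotient_is_cring[OF A.is_cring])
qed

lemma finsum_residue:
  assumes "finite S" "\<And>i. i \<in> S \<Longrightarrow> f i \<in> R"
  shows "finsum (ring_on R Quot I) (\<lambda>i. residue I (f i)) S = residue I (sum f S)"
proof -
  interpret Q: cring "ring_on R Quot I" by (rule quot_ring(6))
  show ?thesis using assms
  proof (induct S)
    case empty then show ?case using quot_ring(4) by simp
  next
    case (insert i S)
    then have "finsum (ring_on R Quot I) (\<lambda>i. residue I (f i)) (insert i S) =
      residue I (f i) \<oplus>\<^bsub>ring_on R Quot I\<^esub> finsum (ring_on R Quot I) (\<lambda>i. residue I (f i)) S"
      by (intro Q.finsum_insert) (auto simp: quot_ring(1))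
    also have "\<dots> = residue I (f i) \<oplus>\<^bsub>ring_on R Quot I\<^esub> residue I (sum f S)"
      using insert by simp
    also have "\<dots> = residue I (f i + sum f S)" using insert(4) by (intro quot_ring(2) sum_R) auto
    finally show ?case using insert by simp
  qed
qed

definition reduce :: "nat \<Rightarrow> (nat \<Rightarrow> 'k) \<Rightarrow> nat \<Rightarrow> 'k set"
  where "reduce n x = (\<lambda>i\<in>{..<n}. residue I (x i))"

lemma qf_eval_reduce:
  assumes a: "\<And>i k. i \<le> k \<Longrightarrow> k < n \<Longrightarrow> a i k \<in> R" and x: "\<And>i. i < n \<Longrightarrow> x i \<in> R"
    and b: "\<And>i k. i \<le> k \<Longrightarrow> k < n \<Longrightarrow> b i k = residue I (a i k)"
  shows "qf_eval (ring_on R Quot I) n b (reduce n x) = residue I (\<Sum>i<n. \<Sum>k\<in>{i..<n}. a i k * x i * x k)"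
proof -
  interpret Q: cring "ring_on R Quot I" by (rule quot_ring(6))
  have t: "a i k * x i * x k \<in> R" if "i < n" "k \<in> {i..<n}" for i k
    using a x that by (auto intro!: mult_R)
  have inner: "finsum (ring_on R Quot I) (\<lambda>k. b i k \<otimes>\<^bsub>ring_on R Quot I\<^esub> reduce n x i \<otimes>\<^bsub>ring_on R Quot I\<^esub> reduce n x k) {i..<n} =
    residue I (\<Sum>k\<in>{i..<n}. a i k * x i * x k)" if i: "i < n" for i
  proof -
    have "finsum (ring_on R Quot I) (\<lambda>k. b i k \<otimes>\<^bsub>ring_on R Quot I\<^esub> reduce n x i \<otimes>\<^bsub>ring_on R Quot I\<^esub> reduce n x k) {i..<n} =
      finsum (ring_on R Quot I) (\<lambda>k. residue I (a i k * x i * x k)) {i..<n}"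
    proof (rule Q.add.finprod_cong')
      show "(\<lambda>k. residue I (a i k * x i * x k)) \<in> {i..<n} \<rightarrow> carrier (ring_on R Quot I)"
        unfolding quot_ring(1) using t[OF i] by auto
      fix k assume k: "k \<in> {i..<n}"
      have "b i k \<otimes>\<^bsub>ring_on R Quot I\<^esub> reduce n x i \<otimes>\<^bsub>ring_on R Quot I\<^esub> reduce n x k =
        residue I (a i k) \<otimes>\<^bsub>ring_on R Quot I\<^esub> residue I (x i) \<otimes>\<^bsub>ring_on R Quot I\<^esub> residue I (x k)"
        using b[of i k] k i unfolding reduce_def by simp
      also have "\<dots> = residue I (a i k * x i * x k)"
        using quot_ring(3) a[of i k] x[of i] x[of k] k i mult_R by simp
      finally show "b i k \<otimes>\<^bsub>ring_on R Quot I\<^esub> reduce n x i \<otimes>\<^bsub>ring_on R Quot I\<^esub> reduce n x k = residue I (a i k * x i * x k)" .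
    qed simp
    also have "\<dots> = residue I (\<Sum>k\<in>{i..<n}. a i k * x i * x k)"
      using t[OF i] by (intro finsum_residue) auto
    finally show ?thesis .
  qed
  have "qf_eval (ring_on R Quot I) n b (reduce n x) = finsum (ring_on R Quot I) (\<lambda>i. residue I (\<Sum>k\<in>{i..<n}. a i k * x i * x k)) {..<n}"
    unfolding qf_eval_def
  proof (rule Q.add.finprod_cong')
    show "(\<lambda>i. residue I (\<Sum>k\<in>{i..<n}. a i k * x i * x k)) \<in> {..<n} \<rightarrow> carrier (ring_on R Quot I)"
      unfolding quot_ring(1) by (intro funcsetI imageI sum_R t) auto
  qed (use inner in auto)
  also have "\<dots> = residue I (\<Sum>i<n. \<Sum>k\<in>{i..<n}. a i k * x i * x k)"
    by (intro finsum_residue sum_R t) auto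
  finally show ?thesis .
qed

lemma reduced_free_module:
  fixes n :: nat
  defines "M \<equiv> (ring_on R Quot I) ^^^ n"
  shows "X \<in> carrier M \<longleftrightarrow> (\<exists>y. (\<forall>i<n. y i \<in> R) \<and> X = reduce n y)"
    and "\<forall>i<n. y i \<in> R \<Longrightarrow> \<forall>i<n. z i \<in> R \<Longrightarrow> reduce n y \<oplus>\<^bsub>M\<^esub> reduce n z = reduce n (\<lambda>i. y i + z i)"
    and "r \<in> R \<Longrightarrow> \<forall>i<n. y i \<in> R \<Longrightarrow> residue I r \<odot>\<^bsub>M\<^esub> reduce n y = reduce n (\<lambda>i. r * y i)"
    and "\<forall>i<n. y i \<in> R \<Longrightarrow> \<forall>i<n. z i \<in> R \<Longrightarrow> reduce n y = reduce n z \<longleftrightarrow> (\<forall>i<n. y i - z i \<in> I)"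
proof -
  interpret Q: cring "ring_on R Quot I" by (rule quot_ring(6))
  show "X \<in> carrier M \<longleftrightarrow> (\<exists>y. (\<forall>i<n. y i \<in> R) \<and> X = reduce n y)"
  proof
    assume X: "X \<in> carrier M"
    then have "\<forall>i\<in>{..<n}. \<exists>y\<in>R. X i = residue I y" unfolding M_def Q.func_space_def quot_ring(1) by auto
    then obtain y where y: "\<forall>i\<in>{..<n}. y i \<in> R \<and> X i = residue I (y i)" by metis
    then have "X = reduce n y" using X unfolding M_def Q.func_space_def quot_ring(1) reduce_def
      by (intro ext) (auto simp: PiE_def extensional_def)
    with y show "\<exists>y. (\<forall>i<n. y i \<in> R) \<and> X = reduce n y" by auto
  next
    assume "\<exists>y. (\<forall>i<n. y i \<in> R) \<and> X = reduce n y"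
    then obtain y where "\<forall>i<n. y i \<in> R" "X = reduce n y" by auto
    then show "X \<in> carrier M" unfolding M_def Q.func_space_def quot_ring(1) reduce_def by auto
  qed
  show "reduce n y \<oplus>\<^bsub>M\<^esub> reduce n z = reduce n (\<lambda>i. y i + z i)" if "\<forall>i<n. y i \<in> R" "\<forall>i<n. z i \<in> R"
    unfolding M_def Q.func_space_def reduce_def using that quot_ring(2) by (auto intro!: restrict_ext)
  show "residue I r \<odot>\<^bsub>M\<^esub> reduce n y = reduce n (\<lambda>i. r * y i)" if "r \<in> R" "\<forall>i<n. y i \<in> R"
    unfolding M_def Q.func_space_def reduce_def using that quot_ring(3) by (auto intro!: restrict_ext)
  show "reduce n y = reduce n z \<longleftrightarrow> (\<forall>i<n. y i - z i \<in> I)" if yz: "\<forall>i<n. y i \<in> R" "\<forall>i<n. z i \<in> R"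
  proof -
    have "reduce n y = reduce n z \<longleftrightarrow> (\<forall>i<n. residue I (y i) = residue I (z i))"
    proof
      assume eq: "reduce n y = reduce n z"
      show "\<forall>i<n. residue I (y i) = residue I (z i)"
      proof (intro allI impI)
        fix i assume "i < n"
        then show "residue I (y i) = residue I (z i)" using fun_cong[OF eq, of i] unfolding reduce_def by simp
      qed
    qed (auto simp: reduce_def intro!: restrict_ext)
    then show ?thesis using residue_eq_iff[OF I] yz by simp
  qed
qed

text \<open>Here \<open>\<beta>\<close> is a matrix of the isometry, and \<open>\<gamma>\<close> consists of preimages of the unit vectors. The hyperbolic
form \<open>t\<^sub>0t\<^sub>1 + t\<^sub>2t\<^sub>3 + \<dots>\<close> vanishes where all odd coordinates do.\<close>

lemma hyperbolic_coordinates: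
  assumes a: "qf_over (ring_on R) n a" and hyp: "qf_hyperbolic (ring_on R Quot I) n (qf_mod (ring_on R) I a)"
  obtains \<beta> \<gamma> where "\<And>k i. i < n \<Longrightarrow> \<beta> k i \<in> R" "\<And>j k. k < n \<Longrightarrow> \<gamma> j k \<in> R"
    "\<And>i j. i < n \<Longrightarrow> (\<Sum>k<n. \<beta> k i * \<gamma> j k) - (if i = j then 1 else 0) \<in> I"
    "\<And>x. (\<And>k. k < n \<Longrightarrow> x k \<in> R) \<Longrightarrow> (\<And>i. i < n \<Longrightarrow> odd i \<Longrightarrow> (\<Sum>k<n. \<beta> k i * x k) \<in> I) \<Longrightarrow>
      qf_eval (ring_on R) n a x \<in> I"
proof -
  let ?Q = "ring_on R Quot I"
  let ?M = "?Q ^^^ n"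
  note M = reduced_free_module[where n = n]
  obtain \<phi> where "\<phi> \<in> module_isos ?Q ?M ?M"
    and eval: "\<And>v. v \<in> carrier ?M \<Longrightarrow> qf_eval ?Q n (hyperbolic_form ?Q) (\<phi> v) = qf_eval ?Q n (qf_mod (ring_on R) I a) v"
    using hyp unfolding qf_hyperbolic_def qf_isomorphic_def by auto
  then have hom: "\<phi> \<in> module_hom ?Q ?M ?M" and bij: "bij_betw \<phi> (carrier ?M) (carrier ?M)"
    unfolding module_isos_def by auto
  have redM: "reduce n x \<in> carrier ?M" if "x \<in> {..<n} \<rightarrow>\<^sub>E R" for x
    unfolding M(1) using that by (intro exI[of _ x]) auto
  have resQ: "residue I r \<in> carrier ?Q" if "r \<in> R" for r unfolding quot_ring(1) using that by auto
  have Rn: "\<forall>i<n. x i \<in> R" if "x \<in> {..<n} \<rightarrow>\<^sub>E R" for x using that by auto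
  have red_restrict: "reduce n (\<lambda>v\<in>{..<n}. f v) = reduce n f" for f
    unfolding reduce_def by (rule restrict_ext) simp
  obtain \<beta> where \<beta>: "\<And>k i. i < n \<Longrightarrow> \<beta> k i \<in> R"
    and \<phi>\<beta>: "\<And>x. x \<in> {..<n} \<rightarrow>\<^sub>E R \<Longrightarrow> \<phi> (reduce n x) = reduce n (\<lambda>i. \<Sum>k<n. \<beta> k i * x k)"
  proof (rule linear_expansion[of n n "\<lambda>x. \<phi> (reduce n x)" "reduce n"])
    show "\<exists>u. (\<forall>i<n. u i \<in> R) \<and> \<phi> (reduce n x) = reduce n u" if "x \<in> {..<n} \<rightarrow>\<^sub>E R" for x
      using module_hom_closed[OF hom] redM[OF that] M(1) by blast
    show "\<phi> (reduce n (\<lambda>v\<in>{..<n}. x v + y v)) = reduce n (\<lambda>i. u i + w i)"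
      if "x \<in> {..<n} \<rightarrow>\<^sub>E R" "y \<in> {..<n} \<rightarrow>\<^sub>E R" "\<forall>i<n. u i \<in> R" "\<forall>i<n. w i \<in> R"
        "\<phi> (reduce n x) = reduce n u" "\<phi> (reduce n y) = reduce n w" for x y u w
    proof -
      have "\<phi> (reduce n (\<lambda>v\<in>{..<n}. x v + y v)) = \<phi> (reduce n x \<oplus>\<^bsub>?M\<^esub> reduce n y)"
        unfolding red_restrict M(2)[OF Rn[OF that(1)] Rn[OF that(2)]] ..
      also have "\<dots> = \<phi> (reduce n x) \<oplus>\<^bsub>?M\<^esub> \<phi> (reduce n y)"
        by (rule module_hom_add[OF hom redM[OF that(1)] redM[OF that(2)]])
      also have "\<dots> = reduce n (\<lambda>i. u i + w i)" unfolding that(5,6) by (rule M(2)[OF that(3,4)])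
      finally show ?thesis .
    qed
    show "\<phi> (reduce n (\<lambda>v\<in>{..<n}. r * x v)) = reduce n (\<lambda>i. r * u i)"
      if "r \<in> R" "x \<in> {..<n} \<rightarrow>\<^sub>E R" "\<forall>i<n. u i \<in> R" "\<phi> (reduce n x) = reduce n u" for r x u
    proof -
      have "\<phi> (reduce n (\<lambda>v\<in>{..<n}. r * x v)) = \<phi> (residue I r \<odot>\<^bsub>?M\<^esub> reduce n x)"
        unfolding red_restrict M(3)[OF that(1) Rn[OF that(2)]] ..
      also have "\<dots> = residue I r \<odot>\<^bsub>?M\<^esub> \<phi> (reduce n x)"
        by (rule module_hom_smult[OF hom resQ[OF that(1)] redM[OF that(2)]])
      also have "\<dots> = reduce n (\<lambda>i. r * u i)" unfolding that(4) by (rule M(3)[OF that(1,3)])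
      finally show ?thesis .
    qed
  qed (rule that)
  have lin: "\<forall>i<n. (\<Sum>k<n. \<beta> k i * x k) \<in> R" if "\<forall>k<n. x k \<in> R" for x
    using that \<beta> by (auto intro!: sum_R mult_R)
  have "\<exists>x \<in> {..<n} \<rightarrow>\<^sub>E R. \<phi> (reduce n x) = reduce n (\<lambda>i. if i = j then 1 else 0)" for j
  proof -
    have "reduce n (\<lambda>i. if i = j then 1 else 0) \<in> carrier ?M" unfolding M(1) by (intro exI conjI) auto
    also have "carrier ?M = \<phi> ` carrier ?M" using bij by (simp add: bij_betw_def)
    finally obtain X where X: "X \<in> carrier ?M" "reduce n (\<lambda>i. if i = j then 1 else 0) = \<phi> X" by (elim imageE)
    then obtain y where y: "\<forall>i<n. y i \<in> R" "X = reduce n y" unfolding M(1) by blast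
    then have "(\<lambda>v\<in>{..<n}. y v) \<in> {..<n} \<rightarrow>\<^sub>E R" by (intro restrict_Rn) simp
    moreover have "\<phi> (reduce n (\<lambda>v\<in>{..<n}. y v)) = reduce n (\<lambda>i. if i = j then 1 else 0)"
      unfolding red_restrict y(2)[symmetric] X(2) ..
    ultimately show ?thesis by blast
  qed
  then obtain \<gamma> where \<gamma>: "\<And>j. \<gamma> j \<in> {..<n} \<rightarrow>\<^sub>E R" "\<And>j. \<phi> (reduce n (\<gamma> j)) = reduce n (\<lambda>i. if i = j then 1 else 0)" by metis
  show thesis
  proof (rule that)
    show "\<beta> k i \<in> R" if "i < n" for k i using \<beta> that .
    show "\<gamma> j k \<in> R" if "k < n" for j k using Rn[OF \<gamma>(1)] that by simp
    show "(\<Sum>k<n. \<beta> k i * \<gamma> j k) - (if i = j then 1 else 0) \<in> I" if i: "i < n" for i j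
    proof -
      have "reduce n (\<lambda>i. \<Sum>k<n. \<beta> k i * \<gamma> j k) = reduce n (\<lambda>i. if i = j then 1 else 0)"
        using \<phi>\<beta>[OF \<gamma>(1)] \<gamma>(2) by simp
      then have "\<forall>i<n. (\<Sum>k<n. \<beta> k i * \<gamma> j k) - (if i = j then 1 else 0) \<in> I"
        using lin[OF Rn[OF \<gamma>(1)]] by (subst (asm) M(4)) auto
      then show ?thesis using i by simp
    qed
    fix x assume x: "\<And>k. k < n \<Longrightarrow> x k \<in> R" and odd: "\<And>i. i < n \<Longrightarrow> odd i \<Longrightarrow> (\<Sum>k<n. \<beta> k i * x k) \<in> I"
    define y where "y i = (\<Sum>k<n. \<beta> k i * x k)" for i
    define h where "h i k = (if even i \<and> k = Suc i then 1 else (0::'k))" for i k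
    have yR: "y i \<in> R" if "i < n" for i using lin[of x] x that unfolding y_def by simp
    have xE: "(\<lambda>v\<in>{..<n}. x v) \<in> {..<n} \<rightarrow>\<^sub>E R" using x by (intro restrict_Rn)
    have "\<phi> (reduce n (\<lambda>v\<in>{..<n}. x v)) = reduce n (\<lambda>i. \<Sum>k<n. \<beta> k i * (\<lambda>v\<in>{..<n}. x v) k)" by (rule \<phi>\<beta>[OF xE])
    then have \<phi>x: "\<phi> (reduce n x) = reduce n y" unfolding red_restrict y_def by simp
    have "qf_eval ?Q n (qf_mod (ring_on R) I a) (reduce n x) = residue I (\<Sum>i<n. \<Sum>k\<in>{i..<n}. a i k * x i * x k)"
      using a x coset_residue unfolding qf_over_def qf_mod_def by (intro qf_eval_reduce) auto
    moreover have "qf_eval ?Q n (hyperbolic_form ?Q) (reduce n y) = residue I (\<Sum>i<n. \<Sum>k\<in>{i..<n}. h i k * y i * y k)"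
      using yR quot_ring(4,5) unfolding hyperbolic_form_def h_def by (intro qf_eval_reduce) auto
    moreover have "qf_eval ?Q n (hyperbolic_form ?Q) (\<phi> (reduce n x)) = qf_eval ?Q n (qf_mod (ring_on R) I a) (reduce n x)"
      using eval[OF redM[OF xE]] unfolding red_restrict .
    ultimately have "residue I (\<Sum>i<n. \<Sum>k\<in>{i..<n}. a i k * x i * x k) = residue I (\<Sum>i<n. \<Sum>k\<in>{i..<n}. h i k * y i * y k)"
      unfolding \<phi>x by simp
    moreover have "qf_eval (ring_on R) n a x = (\<Sum>i<n. \<Sum>k\<in>{i..<n}. a i k * x i * x k)"
      using x by (rule qf_eval_R(1)[OF a])
    ultimately have "residue I (qf_eval (ring_on R) n a x) = residue I (\<Sum>i<n. \<Sum>k\<in>{i..<n}. h i k * y i * y k)"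
      by simp
    moreover have "qf_eval (ring_on R) n a x \<in> R" using x by (rule qf_eval_R(2)[OF a])
    moreover have "(\<Sum>i<n. \<Sum>k\<in>{i..<n}. h i k * y i * y k) \<in> R"
      using yR unfolding h_def by (intro sum_R mult_R) auto
    ultimately have diff: "qf_eval (ring_on R) n a x - (\<Sum>i<n. \<Sum>k\<in>{i..<n}. h i k * y i * y k) \<in> I"
      using residue_eq_iff[OF I] by simp
    have "(\<Sum>i<n. \<Sum>k\<in>{i..<n}. h i k * y i * y k) \<in> I"
    proof (intro ideal_sum[OF I])
      fix i k assume ik: "i \<in> {..<n}" "k \<in> {i..<n}"
      show "h i k * y i * y k \<in> I"
      proof (cases "even i \<and> k = Suc i")
        case True
        then have "y k \<in> I" using odd[of k] ik unfolding y_def by simp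
        then show ?thesis using True yR[of i] ik idealD(4)[OF I] unfolding h_def by simp
      qed (use idealD(2)[OF I] in \<open>auto simp: h_def\<close>)
    qed
    from idealD(3)[OF I diff this] show "qf_eval (ring_on R) n a x \<in> I" by simp
  qed
qed

end

text \<open>The odd coordinates of the isometry are \<open>n/2\<close> linear forms with a right inverse modulo \<open>d\<close>, to which
\<open>kernel_matrix_mod\<close> applies. If \<open>d\<close> were \<open>0\<close>, then \<open>f\<close> would be hyperbolic over \<open>R\<close> itself, and the preimage
of the first unit vector would be a nontrivial zero of \<open>f\<close>.\<close>

lemma hyperbolic_isotropic_lattice:
  assumes n: "0 < n" and a: "qf_over (ring_on R) n a" and aniso: "qf_anisotropic (ring_on R) n a"
    and d: "d \<in> R" and hyp: "qf_hyperbolic (ring_on R Quot ((*) d ` R)) n (qf_mod (ring_on R) ((*) d ` R) a)"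
  obtains P where "d \<noteq> 0" "P \<in> carrier_mat n n" "over_R P" "det P = d ^ (n div 2)"
    "\<And>x. (\<And>k. k < n \<Longrightarrow> x k \<in> R) \<Longrightarrow> qf_eval (ring_on R) n a (\<lambda>k\<in>{..<n}. \<Sum>j<n. P $$ (k, j) * x j) \<in> (*) d ` R"
proof -
  let ?I = "(*) d ` R"
  have I: "ideal_of_R ?I" by (rule ideal_principal[OF d])
  have "even n" using hyp unfolding qf_hyperbolic_def by simp
  obtain \<beta> \<gamma> where \<beta>: "\<And>k i. i < n \<Longrightarrow> \<beta> k i \<in> R" and \<gamma>: "\<And>j k. k < n \<Longrightarrow> \<gamma> j k \<in> R"
    and \<beta>\<gamma>: "\<And>i j. i < n \<Longrightarrow> (\<Sum>k<n. \<beta> k i * \<gamma> j k) - (if i = j then 1 else 0) \<in> ?I"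
    and iso: "\<And>x. (\<And>k. k < n \<Longrightarrow> x k \<in> R) \<Longrightarrow> (\<And>i. i < n \<Longrightarrow> odd i \<Longrightarrow> (\<Sum>k<n. \<beta> k i * x k) \<in> ?I) \<Longrightarrow>
      qf_eval (ring_on R) n a x \<in> ?I"
  proof (rule hyperbolic_coordinates[OF I a hyp])
    fix \<beta> \<gamma> :: "nat \<Rightarrow> nat \<Rightarrow> 'k"
    assume h: "\<And>k i. i < n \<Longrightarrow> \<beta> k i \<in> R" "\<And>j k. k < n \<Longrightarrow> \<gamma> j k \<in> R"
      "\<And>i j. i < n \<Longrightarrow> (\<Sum>k<n. \<beta> k i * \<gamma> j k) - (if i = j then 1 else 0) \<in> ?I"
      "\<And>x. (\<And>k. k < n \<Longrightarrow> x k \<in> R) \<Longrightarrow> (\<And>i. i < n \<Longrightarrow> odd i \<Longrightarrow> (\<Sum>k<n. \<beta> k i * x k) \<in> ?I) \<Longrightarrow>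
        qf_eval (ring_on R) n a x \<in> ?I"
    show thesis using h by (rule that)
  qed
  \<comment> \<open>For \<open>d = 0\<close> the congruences are equations.\<close>
  have d0: "d \<noteq> 0"
  proof
    assume d0: "d = 0"
    then have I0: "?I = {0}" using zero_R by auto
    define x where "x = (\<lambda>k\<in>{..<n}. \<gamma> 0 k)"
    have x: "x \<in> {..<n} \<rightarrow>\<^sub>E R" unfolding x_def using \<gamma> by (intro restrict_Rn)
    have "qf_eval (ring_on R) n a x \<in> ?I"
    proof (rule iso)
      show "x k \<in> R" if "k < n" for k using x that by auto
      show "(\<Sum>k<n. \<beta> k i * x k) \<in> ?I" if "i < n" "odd i" for i
        using \<beta>\<gamma>[OF that(1), of 0] that(2) unfolding x_def by (cases "i = 0") auto
    qed
    then have "qf_eval (ring_on R) n a x = 0" using I0 by simp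
    then have "x = \<zero>\<^bsub>ring_on R ^^^ n\<^esub>"
      using aniso x unfolding qf_anisotropic_def free_module by auto
    then have xz: "x k = (\<lambda>k\<in>{..<n}. 0) k" for k unfolding A.func_space_def by simp
    have "\<gamma> 0 k = 0" if "k < n" for k using xz[of k] that unfolding x_def by simp
    then have "(\<Sum>k<n. \<beta> k 0 * \<gamma> 0 k) = 0" by simp
    then show False using \<beta>\<gamma>[OF n, of 0] I0 by simp
  qed
  define r where "r = n div 2"
  have ri: "2 * i + 1 < n" if "i < r" for i using that \<open>even n\<close> unfolding r_def by auto
  obtain P where P: "P \<in> carrier_mat n n" "over_R P" "det P = d ^ r"
    and ker: "\<And>x i. (\<And>k. k < n \<Longrightarrow> x k \<in> R) \<Longrightarrow> i < r \<Longrightarrow> (\<Sum>k<n. \<beta> k (2 * i + 1) * (\<Sum>j<n. P $$ (k, j) * x j)) \<in> ?I"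
  proof (rule kernel_matrix_mod[OF d d0, of r n "\<lambda>i k. \<beta> k (2 * i + 1)" "\<lambda>k j. \<gamma> (2 * j + 1) k"])
    show "r \<le> n" unfolding r_def by simp
    show "(\<Sum>k<n. \<beta> k (2 * i + 1) * \<gamma> (2 * j + 1) k) - (if i = j then 1 else 0) \<in> ?I" if "i < r" for i j
      using \<beta>\<gamma>[OF ri[OF that], of "2 * j + 1"] by simp
  qed (use \<beta> \<gamma> ri that in auto)
  show thesis
  proof (rule that[OF d0 P[unfolded r_def]])
    fix x assume x: "\<And>k. k < n \<Longrightarrow> x k \<in> R"
    show "qf_eval (ring_on R) n a (\<lambda>k\<in>{..<n}. \<Sum>j<n. P $$ (k, j) * x j) \<in> ?I"
    proof (rule iso)
      show "(\<lambda>k\<in>{..<n}. \<Sum>j<n. P $$ (k, j) * x j) k \<in> R" if "k < n" for k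
        using that x P(1,2) unfolding over_R_def by (auto intro!: sum_R mult_R)
      show "(\<Sum>k<n. \<beta> k i * (\<lambda>k\<in>{..<n}. \<Sum>j<n. P $$ (k, j) * x j) k) \<in> ?I" if i: "i < n" "odd i" for i
      proof -
        obtain i' where i': "i = 2 * i' + 1" using i(2) by (elim oddE)
        then have "i' < r" using i(1) unfolding r_def by auto
        from ker[OF x this] show ?thesis unfolding i' by simp
      qed
    qed
  qed
qed

end

section \<open>Multimetric norms\<close>

lemma invertible_mat_if_det_nonzero:
  fixes X :: "'a :: field mat"
  assumes X: "X \<in> carrier_mat n n" "det X \<noteq> 0"
  shows "invertible_mat X"
proof -
  define Y where "Y = inverse (det X) \<cdot>\<^sub>m adj_mat X"
  have Y: "Y \<in> carrier_mat n n" unfolding Y_def using adj_mat(1)[OF X(1)] by simp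
  have "X * Y = inverse (det X) \<cdot>\<^sub>m (X * adj_mat X)"
    unfolding Y_def using X(1) adj_mat(1)[OF X(1)] by (rule mult_smult_distrib)
  then have XY: "X * Y = 1\<^sub>m n" unfolding adj_mat(2)[OF X(1)] using X(2) by (auto intro!: eq_matI)
  have "Y * X = inverse (det X) \<cdot>\<^sub>m (adj_mat X * X)"
    unfolding Y_def using adj_mat(1)[OF X(1)] X(1) by (rule mult_smult_assoc_mat)
  then have "Y * X = 1\<^sub>m n" unfolding adj_mat(3)[OF X(1)] using X(2) by (auto intro!: eq_matI)
  with XY show ?thesis using X(1) Y unfolding invertible_mat_def inverts_mat_def by auto
qed

lemma prod_power_int:
  fixes q :: real assumes "q \<noteq> 0"
  shows "(\<Prod>j\<in>S. q powi z j) = q powi (\<Sum>j\<in>S. z j)"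
  by (induct S rule: infinite_finite_induct) (use assms in \<open>simp_all add: power_int_add\<close>)

lemma q_powers_pos: "1 < q \<Longrightarrow> x \<in> q_powers q \<Longrightarrow> 0 < x"
  unfolding q_powers_def by auto

lemma value_range_pos: "x \<in> value_range qt v \<Longrightarrow> (\<And>q. qt = Some q \<Longrightarrow> 1 < q) \<Longrightarrow> 0 < x"
  unfolding value_range_def using q_powers_pos by (auto split: option.splits)

text \<open>Distinct powers of \<open>q\<close> differ at least by the factor \<open>q\<close>, so an element of \<open>S\<close> above \<open>Sup S / q\<close> is the
largest one.\<close>

lemma q_powers_Max:
  assumes "1 < q" "S \<noteq> {}" "S \<subseteq> q_powers q" "bdd_above S"
  shows "Sup S \<in> S"
proof -
  obtain C0 where C0: "C0 \<in> S" using assms(2) by auto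
  then have "0 < C0" using assms(1,3) q_powers_pos by auto
  then have pos: "0 < Sup S" using cSup_upper[OF C0 assms(4)] by linarith
  then have "Sup S / q < Sup S" using assms(1) by (simp add: divide_less_eq)
  then obtain C where C: "C \<in> S" "Sup S / q < C" using less_cSupE[OF _ assms(2)] by metis
  have "C' \<le> C" if C': "C' \<in> S" for C'
  proof (rule ccontr)
    assume "\<not> C' \<le> C"
    then have less: "C < C'" by simp
    obtain y z :: int where yz: "C = q powi y" "C' = q powi z"
      using C(1) C' assms(3) unfolding q_powers_def by blast
    have "y < z"
    proof (rule ccontr)
      assume "\<not> y < z"
      then have "q powi z \<le> q powi y" using assms(1) by (intro power_int_increasing) auto
      then show False using less yz by simp
    qed
    then have "q powi (y + 1) \<le> C'" unfolding yz(2) using assms(1) by (intro power_int_increasing) auto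
    then have "q * C \<le> C'" unfolding yz(1) using assms(1) by (simp add: power_int_add mult.commute)
    also have "C' \<le> Sup S" using C' assms(4) by (rule cSup_upper)
    also have "Sup S < q * C" using C(2) assms(1) by (simp add: divide_less_eq mult.commute)
    finally show False by simp
  qed
  then have "Sup S = C" using C(1) by (intro cSup_eq_maximum) auto
  then show ?thesis using C(1) by simp
qed

locale multimetric_dedekind = normed_dedekind R N for R :: "'k::field set" and N +
  fixes m :: nat and nrm :: "nat \<Rightarrow> 'k \<Rightarrow> real" and qt :: "real option"
  assumes multimetric: "multimetric R N m nrm qt"
begin

lemma absolute_value_nrm: "j < m \<Longrightarrow> absolute_value (nrm j)"
  using multimetric unfolding multimetric_def absolute_value_def by auto

lemma elt_norm_prod: "elt_norm R N x = (\<Prod>j<m. nrm j x)"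
  using multimetric unfolding multimetric_def by auto

lemma q_type: "qt = Some q \<Longrightarrow> 1 < q" "qt = Some q \<Longrightarrow> j < m \<Longrightarrow> value_group (nrm j) \<subseteq> q_powers q"
  using multimetric unfolding multimetric_def by auto

lemma m_pos: "0 < m"
proof (rule ccontr)
  assume "\<not> 0 < m"
  then have "elt_norm R N 0 = 1" using elt_norm_prod by simp
  then show False unfolding elt_norm_def by simp
qed

lemma elt_norm_mult: "elt_norm R N (x * y) = elt_norm R N x * elt_norm R N y"
  unfolding elt_norm_prod prod.distrib[symmetric] using absolute_value.mult[OF absolute_value_nrm] by simp

lemma elt_norm_1: "elt_norm R N 1 = 1"
  unfolding elt_norm_prod using absolute_value.one[OF absolute_value_nrm] by simp

lemma elt_norm_power: "elt_norm R N (x ^ e) = elt_norm R N x ^ e"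
  by (induct e) (simp_all add: elt_norm_1 elt_norm_mult)

lemma elt_norm_pos: "x \<noteq> 0 \<Longrightarrow> 0 < elt_norm R N x"
  unfolding elt_norm_prod using absolute_value.pos[OF absolute_value_nrm] by (intro prod_pos) simp

text \<open>A larger \<open>C\<close> would allow \<open>\<epsilon>\<^sub>i\<^sub>j = 1/q\<close> for the lattice \<open>R\<^sup>n\<close>, and so produce a nonzero element of \<open>R\<close> of norm
less than \<open>1\<close>.\<close>

lemma admissible_bounded:
  assumes qt: "qt = Some q" and n: "0 < n" and C: "admissible R N m nrm qt n C"
  shows "C \<le> q ^ (n * m)"
proof (rule ccontr)
  assume "\<not> C \<le> q ^ (n * m)"
  have q: "1 < q" by (rule q_type(1)[OF qt])
  have "elt_norm R N (det (1\<^sub>m n)) * Covol R N n (carrier (ring_on R ^^^ n)) = 1"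
    by (simp add: elt_norm_1 Covol_free_module)
  moreover have "1 \<le> C * (\<Prod>i<n. \<Prod>j<m. q powi (-1))"
    using \<open>\<not> C \<le> q ^ (n * m)\<close> q
    by (simp add: power_int_minus power_mult[symmetric] power_inverse[symmetric] field_simps mult.commute)
  moreover have "q powi (-1) \<in> value_range qt (nrm j)" for j
    unfolding value_range_def qt q_powers_def option.case by (rule rangeI)
  moreover have "invertible_mat (1\<^sub>m n :: 'k mat)" by (rule invertible_mat_if_det_nonzero[of _ n]) simp_all
  ultimately obtain x where x: "x \<in> carrier (ring_on R ^^^ n)" "x \<noteq> \<zero>\<^bsub>class_ring ^^^ n\<^esub>"
    and le: "\<And>i j. i < n \<Longrightarrow> j < m \<Longrightarrow> nrm j (\<Sum>k<n. 1\<^sub>m n $$ (i, k) * x k) \<le> q powi (-1)"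
    using C[unfolded admissible_def, THEN conjunct2, rule_format, of "1\<^sub>m n" "carrier (ring_on R ^^^ n)" "\<lambda>_ _. q powi (-1)"]
      lattice_free_module by auto
  have xE: "x \<in> {..<n} \<rightarrow>\<^sub>E R" using x(1) unfolding free_module .
  have "\<exists>i<n. x i \<noteq> 0"
  proof (rule ccontr)
    assume "\<not> ?thesis"
    then have "x = (\<lambda>v\<in>{..<n}. 0)" using xE by (intro ext) (auto simp: PiE_def extensional_def)
    then show False using x(2) unfolding class_free_module by simp
  qed
  then obtain i where i: "i < n" "x i \<noteq> 0" by auto
  have "(\<Sum>k<n. 1\<^sub>m n $$ (i, k) * x k) = (\<Sum>k<n. if k = i then x i else 0)"
    using i(1) by (intro sum.cong) auto
  then have "nrm j (x i) \<le> inverse q" if "j < m" for j using le[OF i(1) that] i(1) by (simp add: power_int_minus)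
  then have "elt_norm R N (x i) \<le> (\<Prod>j<m. inverse q)"
    unfolding elt_norm_prod using absolute_value.nonneg[OF absolute_value_nrm] by (intro prod_mono) auto
  also have "\<dots> < 1" using q m_pos by (simp add: power_less_one_iff inverse_less_1_iff)
  finally have "elt_norm R N (x i) < 1" .
  moreover have "x i \<in> R" using xE i(1) by auto
  ultimately show False using elt_norm_ge_1 i(2) by fastforce
qed

lemma C_M_admissible:
  assumes qt: "qt = Some q" and n: "0 < n" and ex: "\<exists>C. admissible R N m nrm qt n C"
  shows "admissible R N m nrm qt n (C_M R N m nrm qt n)"
proof -
  let ?S = "{C. admissible R N m nrm qt n C}"
  have "Sup ?S \<in> ?S"
  proof (rule q_powers_Max[OF q_type(1)[OF qt]])
    show "?S \<noteq> {}" using ex by simp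
    show "?S \<subseteq> q_powers q" unfolding admissible_def value_range_def qt by auto
    show "bdd_above ?S" using admissible_bounded[OF qt n] by (intro bdd_aboveI) simp
  qed
  then show ?thesis unfolding C_M_def by simp
qed

text \<open>Admissibility is applied to the matrix \<open>P\<close> and the lattice \<open>R\<^sup>n\<close>, so that \<open>v = Px\<close> runs through a lattice on
which \<open>f\<close> is divisible by \<open>d\<close>. The bounds \<open>\<epsilon>\<^sub>i\<^sub>j = e\<^sub>j\<close> do not depend on the coordinate \<open>i\<close>.\<close>

lemma small_multiple:
  assumes n: "0 < n" and a: "qf_over (ring_on R) n a" and aniso: "qf_anisotropic (ring_on R) n a"
    and d: "d \<in> R" and hyp: "qf_hyperbolic (ring_on R Quot ((*) d ` R)) n (qf_mod (ring_on R) ((*) d ` R) a)"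
    and C: "admissible R N m nrm qt n C"
    and e: "\<And>j. j < m \<Longrightarrow> e j \<in> value_range qt (nrm j)"
    and bound: "elt_norm R N d ^ (n div 2) \<le> C * (\<Prod>j<m. e j) ^ n"
  shows "\<exists>v\<in>carrier (ring_on R ^^^ n). \<exists>k\<in>R - {0}. qf_eval (ring_on R) n a v = k * d \<and> d \<noteq> 0 \<and>
    elt_norm R N k * elt_norm R N d \<le> qf_norm n a m nrm * (\<Prod>j<m. e j)\<^sup>2"
proof -
  obtain P where d0: "d \<noteq> 0" and P: "P \<in> carrier_mat n n" "over_R P" "det P = d ^ (n div 2)"
    and Pd: "\<And>x. (\<And>k. k < n \<Longrightarrow> x k \<in> R) \<Longrightarrow>
      qf_eval (ring_on R) n a (\<lambda>k\<in>{..<n}. \<Sum>j<n. P $$ (k, j) * x j) \<in> (*) d ` R"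
  proof (rule hyperbolic_isotropic_lattice[OF n a aniso d hyp])
    fix P assume h: "d \<noteq> 0" "P \<in> carrier_mat n n" "over_R P" "det P = d ^ (n div 2)"
      "\<And>x. (\<And>k. k < n \<Longrightarrow> x k \<in> R) \<Longrightarrow> qf_eval (ring_on R) n a (\<lambda>k\<in>{..<n}. \<Sum>j<n. P $$ (k, j) * x j) \<in> (*) d ` R"
    show thesis using h by (rule that)
  qed
  have detP: "det P \<noteq> 0" using d0 P(3) by simp
  have "invertible_mat P" by (rule invertible_mat_if_det_nonzero[OF P(1) detP])
  moreover have "elt_norm R N (det P) * Covol R N n (carrier (ring_on R ^^^ n)) \<le> C * (\<Prod>i<n. \<Prod>j<m. e j)"
    using bound by (simp add: P(3) elt_norm_power Covol_free_module)
  ultimately obtain x where x: "x \<in> carrier (ring_on R ^^^ n)" "x \<noteq> \<zero>\<^bsub>class_ring ^^^ n\<^esub>"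
    and le: "\<And>i j. i < n \<Longrightarrow> j < m \<Longrightarrow> nrm j (\<Sum>k<n. P $$ (i, k) * x k) \<le> e j"
    using C[unfolded admissible_def, THEN conjunct2, rule_format, of P "carrier (ring_on R ^^^ n)" "\<lambda>_ j. e j"]
      lattice_free_module P(1) e by auto
  have xE: "x \<in> {..<n} \<rightarrow>\<^sub>E R" using x(1) unfolding free_module .
  have xR: "x k \<in> R" if "k < n" for k using xE that by auto
  define v where "v = (\<lambda>k\<in>{..<n}. \<Sum>j<n. P $$ (k, j) * x j)"
  have vR: "v k \<in> R" if "k < n" for k
    unfolding v_def using that xR P(1,2) unfolding over_R_def by (auto intro!: sum_R mult_R)
  have v: "v \<in> carrier (ring_on R ^^^ n)" unfolding free_module using vR unfolding v_def by auto
  have "v \<noteq> \<zero>\<^bsub>ring_on R ^^^ n\<^esub>"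
  proof
    assume "v = \<zero>\<^bsub>ring_on R ^^^ n\<^esub>"
    then have v0: "v k = (\<lambda>k\<in>{..<n}. 0) k" for k unfolding A.func_space_def by simp
    have "P *\<^sub>v vec n x = 0\<^sub>v n"
    proof (rule eq_vecI)
      fix i assume "i < dim_vec (0\<^sub>v n :: 'k vec)"
      then have i: "i < n" by simp
      have "(P *\<^sub>v vec n x) $ i = (\<Sum>j = 0..<n. P $$ (i, j) * vec n x $ j)"
        by (rule mult_mat_vec_nth[OF P(1) _ i]) simp
      also have "\<dots> = v i" unfolding v_def using i by (simp add: atLeast0LessThan)
      finally show "(P *\<^sub>v vec n x) $ i = 0\<^sub>v n $ i" using v0[of i] i by simp
    qed (use P(1) in simp)
    moreover have "vec n x \<noteq> 0\<^sub>v n"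
    proof
      assume eq: "vec n x = 0\<^sub>v n"
      have "x k = 0" if "k < n" for k using arg_cong[OF eq, of "\<lambda>u. u $ k"] that by simp
      then have "x = (\<lambda>v\<in>{..<n}. 0)" using xE by (intro ext) (auto simp: PiE_def extensional_def)
      then show False using x(2) unfolding class_free_module by simp
    qed
    ultimately show False using det_0_iff_vec_prod_zero_field[OF P(1)] detP by (metis vec_carrier)
  qed
  then have f0: "qf_eval (ring_on R) n a v \<noteq> 0" using aniso v unfolding qf_anisotropic_def by simp
  have "qf_eval (ring_on R) n a v \<in> (*) d ` R" unfolding v_def using xR by (rule Pd)
  then obtain k where "qf_eval (ring_on R) n a v = d * k" "k \<in> R" by (elim imageE)
  then have k: "qf_eval (ring_on R) n a v = k * d" "k \<in> R" by (simp_all add: mult.commute)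
  have "k \<noteq> 0" using f0 k(1) by auto
  have epos: "0 < e j" if "j < m" for j using value_range_pos[OF e[OF that]] q_type(1) by simp
  have "elt_norm R N k * elt_norm R N d = (\<Prod>j<m. nrm j (qf_eval (ring_on R) n a v))"
    unfolding elt_norm_mult[symmetric] k(1)[symmetric] by (rule elt_norm_prod)
  also have "\<dots> \<le> (\<Prod>j<m. qf_norm_at n a (nrm j) * (e j)\<^sup>2)"
  proof (rule prod_mono)
    fix j assume "j \<in> {..<m}"
    then have j: "j < m" by simp
    interpret absolute_value "nrm j" by (rule absolute_value_nrm[OF j])
    have "nrm j (v i) \<le> e j" if "i < n" for i using le[OF that j] that unfolding v_def by simp
    then have "nrm j (\<Sum>i<n. \<Sum>k\<in>{i..<n}. a i k * v i * v k) \<le> qf_norm_at n a (nrm j) * (e j)\<^sup>2"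
      using epos[OF j] n by (intro quadratic_form_le) auto
    moreover have "qf_eval (ring_on R) n a v = (\<Sum>i<n. \<Sum>k\<in>{i..<n}. a i k * v i * v k)"
      using vR by (rule qf_eval_R(1)[OF a])
    ultimately show "0 \<le> nrm j (qf_eval (ring_on R) n a v) \<and>
      nrm j (qf_eval (ring_on R) n a v) \<le> qf_norm_at n a (nrm j) * (e j)\<^sup>2" by simp
  qed
  also have "\<dots> = qf_norm n a m nrm * (\<Prod>j<m. e j)\<^sup>2"
    unfolding qf_norm_def by (simp add: prod.distrib prod_power_distrib)
  finally show ?thesis using v k \<open>k \<noteq> 0\<close> d0 by blast
qed

end

section \<open>Small multiples represented by the form\<close>

theorem theorem7p2:
  fixes R :: "'k::field set" and N :: "'k set \<Rightarrow> real"
    and m :: nat and nrm :: "nat \<Rightarrow> 'k \<Rightarrow> real" and qt :: "real option"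
    and n :: nat and a :: "nat \<Rightarrow> nat \<Rightarrow> 'k" and d :: 'k
  assumes "dedekind_domain_in R" and "ideal_norm R N"
    and "multimetric R N m nrm qt"
    and "multimetric_linear_type R N m nrm qt"
    and "0 < n" and "qf_over (ring_on R) n a" and "qf_anisotropic (ring_on R) n a"
    and "d \<in> R" and "coprime_elts (ring_on R) d 2"
    and "coprime_elts (ring_on R) d (qf_disc n a)"
    and "even n"
    and "qf_hyperbolic (ring_on R Quot (PIdl\<^bsub>ring_on R\<^esub> d)) n
           (qf_mod (ring_on R) (PIdl\<^bsub>ring_on R\<^esub> d) a)"
  shows "((\<exists>j<m. archimedean (nrm j)) \<longrightarrow>
      (\<forall>c. 0 < c \<and> c < C_M R N m nrm qt n \<longrightarrow>
        (\<exists>v \<in> carrier (ring_on R ^^^ n). \<exists>k \<in> R.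
           qf_eval (ring_on R) n a v = k * d \<and>
           0 < elt_norm R N k \<and>
           elt_norm R N k \<le> c powr (- 2 / real n) * qf_norm n a m nrm))) \<and>
    (\<forall>q. qt = Some q \<longrightarrow>
        (\<exists>v \<in> carrier (ring_on R ^^^ n). \<exists>k \<in> R - {0}.
           qf_eval (ring_on R) n a v = k * d \<and>
           log q (elt_norm R N k) \<le>
             log q (qf_norm n a m nrm) + 2 * (real m * real n - 1) / real n
               - 2 * c_M R N m nrm q n / real n))"

proof -
  interpret multimetric_dedekind R N m nrm qt
    by unfold_locales (use assms(1-3) in auto)
  have PIdl: "PIdl\<^bsub>ring_on R\<^esub> d = (*) d ` R" by (rule PIdl_eq[OF assms(8)])
  note hyp = assms(12)[unfolded PIdl]
  define r where "r = n div 2"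
  have n: "n = 2 * r" "0 < r" using assms(5,11) unfolding r_def by auto
  note small = small_multiple[OF assms(5,6,7,8) hyp, folded r_def]
  let ?f = "qf_norm n a m nrm"
  have ex: "\<exists>C. admissible R N m nrm qt n C"
    using assms(4,5) unfolding multimetric_linear_type_def by simp
  have partA: "\<exists>v\<in>carrier (ring_on R ^^^ n). \<exists>k\<in>R. qf_eval (ring_on R) n a v = k * d \<and>
      0 < elt_norm R N k \<and> elt_norm R N k \<le> c powr (- 2 / real n) * ?f"
    if arch: "\<exists>j<m. archimedean (nrm j)" and c: "0 < c" "c < C_M R N m nrm qt n" for c
  proof -
    obtain j0 where j0: "j0 < m" "archimedean (nrm j0)" using arch by auto
    interpret v0: absolute_value "nrm j0" by (rule absolute_value_nrm[OF j0(1)])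
    have qt: "qt = None"
    proof (rule ccontr)
      assume "qt \<noteq> None"
      then obtain q where "qt = Some q" by auto
      then show False using q_type j0 v0.discrete_not_archimedean by blast
    qed
    obtain C where C: "admissible R N m nrm qt n C" "c < C"
      using c(2) less_cSupE[of c "{C. admissible R N m nrm qt n C}"] ex unfolding C_M_def by auto
    have d0: "d \<noteq> 0"
      using hyperbolic_isotropic_lattice[OF assms(5,6,7,8) hyp] by metis
    define D where "D = elt_norm R N d"
    have D: "0 < D" unfolding D_def by (rule elt_norm_pos[OF d0])
    \<comment> \<open>The value of \<open>\<Prod>\<^sub>j \<epsilon>\<^sub>j\<close> for which \<open>|d|\<^sup>r = c (\<Prod>\<^sub>j \<epsilon>\<^sub>j)\<^sup>n\<close>; all of it is put on the Archimedean place.\<close>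
    define s where "s = sqrt D * c powr (- 1 / real n)"
    have s: "0 < s" unfolding s_def using D c(1) by simp
    have s2: "s\<^sup>2 = D * c powr (- 2 / real n)"
      unfolding s_def power_mult_distrib using D c(1) by (simp add: power2_eq_square powr_add[symmetric])
    have sn: "s ^ n = D ^ r / c"
    proof -
      have "s ^ n = D ^ r * (c powr (- 2 / real n)) ^ r" unfolding n(1) power_mult s2[unfolded n(1)] power_mult_distrib ..
      also have "(c powr (- 2 / real n)) ^ r = c powr (- 1)"
        using c(1) n by (simp add: powr_realpow[symmetric] powr_powr)
      finally show ?thesis using c(1) by (simp add: powr_minus_divide)
    qed
    define e where "e j = (if j = j0 then s else 1)" for j
    have prod_e: "(\<Prod>j<m. e j) = s" unfolding e_def using j0(1) by simp
    have "\<exists>v\<in>carrier (ring_on R ^^^ n). \<exists>k\<in>R - {0}. qf_eval (ring_on R) n a v = k * d \<and> d \<noteq> 0 \<and>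
      elt_norm R N k * elt_norm R N d \<le> ?f * (\<Prod>j<m. e j)\<^sup>2"
    proof (rule small[OF C(1)])
      show "e j \<in> value_range qt (nrm j)" if "j < m" for j
      proof (cases "j = j0")
        case True
        then show ?thesis using v0.archimedean_value_group_dense[OF j0(2) s] s
          unfolding value_range_def qt e_def by simp
      next
        case False
        have "1 \<in> value_group (nrm j)"
          unfolding value_group_def using absolute_value.one[OF absolute_value_nrm[OF that]] by force
        then show ?thesis using False closure_subset unfolding value_range_def qt e_def by auto
      qed
      have "D ^ r * c \<le> D ^ r * C" using C(2) D by (intro mult_left_mono) auto
      then show "elt_norm R N d ^ r \<le> C * (\<Prod>j<m. e j) ^ n"
        unfolding prod_e sn D_def[symmetric] using c(1) by (simp add: field_simps)
    qed
    then obtain v k where v: "v \<in> carrier (ring_on R ^^^ n)" and k: "k \<in> R" "k \<noteq> 0"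
      and f: "qf_eval (ring_on R) n a v = k * d" and le: "elt_norm R N k * D \<le> ?f * s\<^sup>2"
      unfolding prod_e D_def by auto
    have "elt_norm R N k * D \<le> (c powr (- 2 / real n) * ?f) * D" using le unfolding s2 by (simp add: mult_ac)
    then have "elt_norm R N k \<le> c powr (- 2 / real n) * ?f" using D by simp
    then show ?thesis using v k(1) f elt_norm_pos[OF k(2)] by blast
  qed
  have partB: "\<exists>v\<in>carrier (ring_on R ^^^ n). \<exists>k\<in>R - {0}. qf_eval (ring_on R) n a v = k * d \<and>
      log q (elt_norm R N k) \<le> log q ?f + 2 * (real m * real n - 1) / real n - 2 * c_M R N m nrm q n / real n"
    if qt: "qt = Some q" for q
  proof -
    have q: "1 < q" by (rule q_type(1)[OF qt])
    define C where "C = C_M R N m nrm qt n"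
    have C: "admissible R N m nrm qt n C" unfolding C_def by (rule C_M_admissible[OF qt assms(5) ex])
    then obtain c0 :: int where c0: "C = q powi c0"
      unfolding admissible_def value_range_def qt q_powers_def by auto
    have d0: "d \<noteq> 0"
      using hyperbolic_isotropic_lattice[OF assms(5,6,7,8) hyp] by metis
    have "\<exists>z. nrm j d = q powi z" if "j < m" for j
      using q_type(2)[OF qt that] d0 unfolding value_group_def q_powers_def by auto
    then obtain z :: "nat \<Rightarrow> int" where z: "\<And>j. j < m \<Longrightarrow> nrm j d = q powi z j" by metis
    define D where "D = (\<Sum>j<m. z j)"
    have D: "elt_norm R N d = q powi D"
      unfolding elt_norm_prod D_def using z q by (simp add: prod_power_int)
    \<comment> \<open>The least integer \<open>E\<close> with \<open>D r \<le> c0 + n E\<close>, that is, \<open>(D r - c0)/n\<close> rounded up.\<close>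
    define E where "E = - ((c0 - D * int r) div int n)"
    have E: "D * int r - c0 \<le> int n * E" "int n * E \<le> D * int r - c0 + int n - 1"
    proof -
      define X where "X = c0 - D * int r"
      have "int n * E = - (X - X mod int n)" unfolding E_def X_def[symmetric] minus_mod_eq_mult_div by simp
      moreover have "0 \<le> X mod int n" "X mod int n < int n" using assms(5) by simp_all
      ultimately show "D * int r - c0 \<le> int n * E" "int n * E \<le> D * int r - c0 + int n - 1"
        unfolding X_def by linarith+
    qed
    define e where "e j = (if j = 0 then q powi E else 1)" for j :: nat
    have prod_e: "(\<Prod>j<m. e j) = q powi E" unfolding e_def using m_pos by simp
    have "\<exists>v\<in>carrier (ring_on R ^^^ n). \<exists>k\<in>R - {0}. qf_eval (ring_on R) n a v = k * d \<and> d \<noteq> 0 \<and>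
      elt_norm R N k * elt_norm R N d \<le> ?f * (\<Prod>j<m. e j)\<^sup>2"
    proof (rule small[OF C])
      show "e j \<in> value_range qt (nrm j)" for j
        unfolding value_range_def qt e_def q_powers_def by (auto intro: range_eqI[of _ _ 0])
      have "q powi (D * int r) \<le> q powi (c0 + E * int n)"
        using E(1) q by (intro power_int_increasing) (auto simp: mult.commute)
      then show "elt_norm R N d ^ r \<le> C * (\<Prod>j<m. e j) ^ n"
        unfolding prod_e D c0 using q by (simp add: power_int_add power_int_power')
    qed
    then obtain v k where v: "v \<in> carrier (ring_on R ^^^ n)" and k: "k \<in> R - {0}"
      and f: "qf_eval (ring_on R) n a v = k * d" and le: "elt_norm R N k * q powi D \<le> ?f * (q powi E)\<^sup>2"
      unfolding prod_e D by auto
    have kpos: "0 < elt_norm R N k" using k elt_norm_pos by simp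
    have "0 < elt_norm R N k * q powi D" using kpos q by simp
    then have fpos: "0 < ?f" using le q by (smt (verit) zero_less_power_int mult_nonpos_nonneg zero_le_power2)
    have logq: "log q (q powi y) = real_of_int y" for y
    proof -
      have "q powr real_of_int y = q powi y" using q by (intro powr_real_of_int') auto
      then show ?thesis using log_powr_cancel[of q "real_of_int y"] q by simp
    qed
    have "log q (elt_norm R N k * q powi D) \<le> log q (?f * (q powi E)\<^sup>2)"
      using le q \<open>0 < elt_norm R N k * q powi D\<close> by simp
    then have "log q (elt_norm R N k) + D \<le> log q ?f + 2 * E"
      using q kpos fpos by (simp add: log_mult logq log_nat_power)
    moreover have "2 * real_of_int E \<le> D + 2 * (real m * real n - 1) / real n - 2 * c0 / real n"
    proof -
      have "real_of_int (int n * E) \<le> real_of_int (D * int r - c0 + int n - 1)"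
        using E(2) by (simp only: of_int_le_iff)
      then have "real n * E \<le> D * r - c0 + real n - 1" by simp
      also have "real n \<le> real m * real n" using m_pos mult_right_mono[of 1 "real m" "real n"] by simp
      finally have "real n * E \<le> D * r - c0 + (real m * real n - 1)" by simp
      then have "2 * (real n * E) / real n \<le> 2 * (D * r - c0 + (real m * real n - 1)) / real n"
        by (intro divide_right_mono) auto
      also have "\<dots> = 2 * (D * r) / real n + 2 * (real m * real n - 1) / real n - 2 * c0 / real n"
        by (simp add: add_divide_distrib diff_divide_distrib distrib_left right_diff_distrib)
      also have "2 * (D * r) / real n = D" using n by simp
      finally show ?thesis using assms(5) by simp
    qed
    moreover have "c_M R N m nrm q n = c0"
      unfolding c_M_def qt[symmetric] C_def[symmetric] c0 by (rule logq)
    ultimately show ?thesis using v k f by (intro bexI[of _ v] bexI[of _ k]) auto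
  qed
  show ?thesis using partA partB by blast
qed

end
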